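(* Let $X$ be a geodesic space with basepoint $\bullet$ and let $G$ be an Abelian group. The maps $\lambda_r^{\pi_1}$ provide an isomorphism of persistences $$\{\pi_1(\mathrm{Rips}(X,r),\bullet)\}_{r>0}\cong\{\mathcal{L}(X,\mathrm{fin},\pi_1)/\mathcal{L}(X,3r,\pi_1)\}_{r>0}.$$ The maps $\lambda_r^{G}$ provide an isomorphism of persistences $$\{H_1(\mathrm{Rips}(X,r),G)\}_{r>0}\cong\{\mathcal{L}(X,\mathrm{fin},G)/\mathcal{L}(X,3r,G)\}_{r>0}.$$ Furthermore, if $X$ is semi-locally simply-connected, then $$\{\pi_1(\mathrm{Rips}(X,r),\bullet)\}_{r>0}\cong\{\pi_1(X,\bullet)/\mathcal{L}(X,3r,\pi_1)\}_{r>0}.$$ Also, if $X$ is $G$-semi-locally simply-connected, then $$\{H_1(\mathrm{Rips}(X,r),G)\}_{r>0}\cong\{H_1(X,G)/\mathcal{L}(X,3r,G)\}_{r>0}.$$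
   Context: A metric space $(X,d)$ is geodesic if any $x,y\in X$ are joined by a path (a geodesic) of length $d(x,y)$. $\mathrm{Rips}(X,r)$ is the simplicial complex with vertex set $X$ in which a finite nonempty $\sigma\subset X$ is a simplex iff $\operatorname{diam}(\sigma)<r$. An $l$-lasso is a based loop $\alpha*\beta*\alpha^-$, where $\alpha$ is a finite-length path starting at $\bullet$, $\alpha^-$ its reverse, and $\beta$ a loop of length $l$ based at the endpoint of $\alpha$. $\mathcal L(X,r,\pi_1)\le\pi_1(X,\bullet)$ is generated by all $l$-lassos with $l<r$. $\mathcal L(X,r,G)\le H_1(X,G)$ is generated by the classes (with arbitrary coefficients in $G$) of loops of length less than $r$. $\mathcal L(X,\mathrm{fin},\pi_1)=\bigcup_{n\in\mathbb N}\mathcal L(X,n,\pi_1)$ and $\mathcal L(X,\mathrm{fin},G)=\bigcup_{n\in\mathbb N}\mathcal L(X,n,G)$. The group $\mathcal L(X,3r,\pi_1)$ is normal in $\mathcal L(X,\mathrm{fin},\pi_1)$. An $r$-loop is a sequence $(x_0,\dots,x_k,x_{k+1}=x_0)$ in $X$ with $d(x_i,x_{i+1})<r$, viewed as a simplicial loop in $\mathrm{Rips}(X,r)$; a filling of it is a loop in $X$ obtained by connecting consecutive points by geodesics. The maps $\lambda_r^{\pi_1}:\pi_1(\mathrm{Rips}(X,r),\bullet)\to\mathcal L(X,\mathrm{fin},\pi_1)/\mathcal L(X,3r,\pi_1)$ and $\lambda_r^G:H_1(\mathrm{Rips}(X,r),G)\to\mathcal L(X,\mathrm{fin},G)/\mathcal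 L(X,3r,G)$ map (the class of) an $r$-loop to (the class of) its filling; they are well defined. A path-connected $X$ is semi-locally simply-connected (resp. $G$-semi-locally simply-connected) if every $x\in X$ has a neighborhood $U$ such that $\pi_1(U,x)\to\pi_1(X,x)$ (resp. $H_1(U,G)\to H_1(X,G)$) has trivial image. Persistences have bonding maps for $p<q$ induced by inclusions of Rips complexes on the left and natural quotient maps on the right. An isomorphism of persistences is a family of isomorphisms, one for each $r>0$, commuting with the bonding maps. *)

theory Defs
  imports "HOL-Analysis.Analysis" "HOL-Homology.Homology"
begin

section \<open>Fundamental groups\<close>

text \<open>
  The fundamental group is defined for an arbitrary topology, because the geometric realization
  of a complex does not carry the type-class topology of its points. The sort
  \<^class>\<open>topological_space\<close> below is only inherited from the library's path concatenation
  \<open>+++\<close> and plays no other role.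
\<close>

definition loop_in :: "'a topology \<Rightarrow> 'a \<Rightarrow> (real \<Rightarrow> 'a) \<Rightarrow> bool" where
  "loop_in X a g \<longleftrightarrow> pathin X g \<and> g 0 = a \<and> g 1 = a"

definition loop_class :: "'a topology \<Rightarrow> 'a \<Rightarrow> (real \<Rightarrow> 'a) \<Rightarrow> (real \<Rightarrow> 'a) set" where
  "loop_class X a g =
     {h. homotopic_with (\<lambda>k. k 0 = a \<and> k 1 = a) (top_of_set {0..1}) X g h}"

definition fundamental_group ::
  "'a::topological_space topology \<Rightarrow> 'a \<Rightarrow> (real \<Rightarrow> 'a) set monoid" where
  "fundamental_group X a =
     \<lparr> carrier = loop_class X a ` Collect (loop_in X a),
       mult = (\<lambda>C D. \<Union>g\<in>C. \<Union>h\<in>D. loop_class X a (g +++ h)),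
       one = loop_class X a (\<lambda>_. a) \<rparr>"

definition fundamental_group_map ::
  "'b topology \<Rightarrow> 'a \<Rightarrow> ('a \<Rightarrow> 'b) \<Rightarrow> (real \<Rightarrow> 'a) set \<Rightarrow> (real \<Rightarrow> 'b) set" where
  "fundamental_group_map Y a f C = (\<Union>g\<in>C. loop_class Y (f a) (f \<circ> g))"


section \<open>Singular homology with coefficients\<close>

text \<open>
  The library's singular homology has integer coefficients only. A singular chain with
  coefficients in \<open>G\<close> is a finitely supported function from singular simplices to \<open>G\<close>. The
  coefficient group is passed as a type, \<open>G :: 'g itself\<close>.
\<close>

type_synonym ('a, 'g) gchain = "((nat \<Rightarrow> real) \<Rightarrow> 'a) \<Rightarrow>\<^sub>0 'g"

definition gchain_boundary :: "nat \<Rightarrow> ('a, 'g::ab_group_add) gchain \<Rightarrow> ('a, 'g) gchain" where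
  "gchain_boundary p c =
     (if p = 0 then 0
      else \<Sum>f\<in>Poly_Mapping.keys c. \<Sum>k\<le>p.
             Poly_Mapping.single (singular_face p k f)
               (if even k then Poly_Mapping.lookup c f else - Poly_Mapping.lookup c f))"

definition gchain_map ::
  "nat \<Rightarrow> ('a \<Rightarrow> 'b) \<Rightarrow> ('a, 'g::ab_group_add) gchain \<Rightarrow> ('b, 'g) gchain" where
  "gchain_map p f c =
     (\<Sum>s\<in>Poly_Mapping.keys c.
        Poly_Mapping.single (simplex_map p f s) (Poly_Mapping.lookup c s))"

definition gcycle_group ::
  "'g::ab_group_add itself \<Rightarrow> nat \<Rightarrow> 'a topology \<Rightarrow> ('a, 'g) gchain monoid" where
  "gcycle_group G p X =
     \<lparr> carrier = {c. Poly_Mapping.keys c \<subseteq> singular_simplex_set p X \<and> gchain_boundary p c = 0},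
       mult = (+), one = 0 \<rparr>"

definition gboundaries ::
  "'g::ab_group_add itself \<Rightarrow> nat \<Rightarrow> 'a topology \<Rightarrow> ('a, 'g) gchain set" where
  "gboundaries G p X =
     gchain_boundary (Suc p) ` {d. Poly_Mapping.keys d \<subseteq> singular_simplex_set (Suc p) X}"

definition ghomology_group ::
  "'g::ab_group_add itself \<Rightarrow> nat \<Rightarrow> 'a topology \<Rightarrow> ('a, 'g) gchain set monoid" where
  "ghomology_group G p X = gcycle_group G p X Mod gboundaries G p X"

definition ghomology_class ::
  "'g::ab_group_add itself \<Rightarrow> nat \<Rightarrow> 'a topology \<Rightarrow> ('a, 'g) gchain \<Rightarrow> ('a, 'g) gchain set" where
  "ghomology_class G p X c = gboundaries G p X #>\<^bsub>gcycle_group G p X\<^esub> c"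

definition ghomology_map ::
  "'g::ab_group_add itself \<Rightarrow> nat \<Rightarrow> 'b topology \<Rightarrow> ('a \<Rightarrow> 'b) \<Rightarrow>
     ('a, 'g) gchain set \<Rightarrow> ('b, 'g) gchain set" where
  "ghomology_map G p Y f C = (\<Union>c\<in>C. ghomology_class G p Y (gchain_map p f c))"

text \<open>The class \<open>u [g]\<close> in first homology of a loop \<open>g\<close> with coefficient \<open>u\<close>; a point \<open>z\<close> of the
  standard 1-simplex has barycentric coordinates \<open>(z 0, z 1)\<close>.\<close>

definition loop_homology_class ::
  "'g::ab_group_add itself \<Rightarrow> 'a topology \<Rightarrow> 'g \<Rightarrow> (real \<Rightarrow> 'a) \<Rightarrow> ('a, 'g) gchain set" where
  "loop_homology_class G X u g =
     ghomology_class G 1 X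
       (Poly_Mapping.single (restrict (\<lambda>z. g (z 1)) (standard_simplex 1)) u)"


section \<open>Simplicial complexes and Rips complexes\<close>

text \<open>A simplicial complex is given by its set of (finite nonempty) simplices. Points of its
  geometric realization are the functions of barycentric coordinates; the topology is the weak
  one, coherent with the closed simplices in their Euclidean topology.\<close>

definition closed_simplex :: "'v set \<Rightarrow> ('v \<Rightarrow> real) set" where
  "closed_simplex s = {f. (\<forall>v. 0 \<le> f v) \<and> (\<forall>v. v \<notin> s \<longrightarrow> f v = 0) \<and> sum f s = 1}"

definition realization :: "'v set set \<Rightarrow> ('v \<Rightarrow> real) topology" where
  "realization K =
     topology (\<lambda>U. U \<subseteq> (\<Union>s\<in>K. closed_simplex s) \<and>
       (\<forall>s\<in>K. openin (subtopology (powertop_real UNIV) (closed_simplex s)) (U \<inter> closed_simplex s)))"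

lemma openin_realization:
  "openin (realization K) U \<longleftrightarrow>
     U \<subseteq> (\<Union>s\<in>K. closed_simplex s) \<and>
     (\<forall>s\<in>K. openin (subtopology (powertop_real UNIV) (closed_simplex s)) (U \<inter> closed_simplex s))"
proof -
  have "istopology (\<lambda>U. U \<subseteq> (\<Union>s\<in>K. closed_simplex s) \<and>
       (\<forall>s\<in>K. openin (subtopology (powertop_real UNIV) (closed_simplex s)) (U \<inter> closed_simplex s)))"
    (is "istopology ?P")
    unfolding istopology_def
  proof (intro conjI allI impI)
    fix S T assume S: "?P S" and T: "?P T"
    show "S \<inter> T \<subseteq> (\<Union>s\<in>K. closed_simplex s)"
      using S by blast
    show "\<forall>s\<in>K. openin (subtopology (powertop_real UNIV) (closed_simplex s)) (S \<inter> T \<inter> closed_simplex s)"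
    proof
      fix s assume "s \<in> K"
      then have "openin (subtopology (powertop_real UNIV) (closed_simplex s)) (S \<inter> closed_simplex s)"
        and "openin (subtopology (powertop_real UNIV) (closed_simplex s)) (T \<inter> closed_simplex s)"
        using S T by blast+
      from openin_Int[OF this]
      show "openin (subtopology (powertop_real UNIV) (closed_simplex s)) (S \<inter> T \<inter> closed_simplex s)"
        by (simp add: Int_ac)
    qed
  next
    fix \<K> assume A: "\<forall>U\<in>\<K>. ?P U"
    show "\<Union>\<K> \<subseteq> (\<Union>s\<in>K. closed_simplex s)"
      using A by blast
    show "\<forall>s\<in>K. openin (subtopology (powertop_real UNIV) (closed_simplex s)) (\<Union>\<K> \<inter> closed_simplex s)"
      unfolding Int_Union2 using A by (intro ballI openin_Union) blast
  qed
  then show ?thesis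
    by (simp add: realization_def topology_inverse')
qed

definition realization_edge :: "'v \<Rightarrow> 'v \<Rightarrow> real \<Rightarrow> 'v \<Rightarrow> real" where
  "realization_edge x y = (\<lambda>t v. (1 - t) * indicator {x} v + t * indicator {y} v)"

text \<open>The value at \<open>[]\<close> is irrelevant.\<close>

fun concat_paths :: "(real \<Rightarrow> 'a::topological_space) list \<Rightarrow> real \<Rightarrow> 'a" where
  "concat_paths [] = undefined"
| "concat_paths [p] = p"
| "concat_paths (p # q # ps) = p +++ concat_paths (q # ps)"

definition edge_path :: "'v list \<Rightarrow> real \<Rightarrow> 'v \<Rightarrow> real" where
  "edge_path xs = concat_paths (map2 realization_edge xs (tl xs))"

definition Rips :: "real \<Rightarrow> 'a::metric_space set set" where
  "Rips r = {s. finite s \<and> s \<noteq> {} \<and> diameter s < r}"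

text \<open>An \<open>r\<close>-loop \<open>(x\<^sub>0, \<dots>, x\<^sub>k, x\<^sub>k\<^sub>+\<^sub>1 = x\<^sub>0)\<close> is the list of all \<open>k + 2\<close> entries.\<close>

definition r_loop :: "real \<Rightarrow> 'a::metric_space list \<Rightarrow> bool" where
  "r_loop r xs \<longleftrightarrow> 2 \<le> length xs \<and> last xs = hd xs \<and>
     (\<forall>i. Suc i < length xs \<longrightarrow> dist (xs ! i) (xs ! Suc i) < r)"


section \<open>Length, geodesics and lassos\<close>

text \<open>The metric space \<open>X\<close> is the whole type \<open>'a\<close>.\<close>

definition path_length :: "(real \<Rightarrow> 'a::metric_space) \<Rightarrow> ereal" where
  "path_length g =
     (SUP ts \<in> {ts. sorted ts \<and> set ts \<subseteq> {0..1}}.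
        ereal (\<Sum>i<length ts - 1. dist (g (ts ! i)) (g (ts ! Suc i))))"

definition geodesic :: "'a::metric_space \<Rightarrow> 'a \<Rightarrow> (real \<Rightarrow> 'a) \<Rightarrow> bool" where
  "geodesic x y g \<longleftrightarrow>
     path g \<and> pathstart g = x \<and> pathfinish g = y \<and> path_length g = ereal (dist x y)"

definition geodesic_space :: "'a::metric_space itself \<Rightarrow> bool" where
  "geodesic_space X \<longleftrightarrow> (\<forall>x y :: 'a. \<exists>g. geodesic x y g)"

definition filling :: "'a::metric_space list \<Rightarrow> (real \<Rightarrow> 'a) \<Rightarrow> bool" where
  "filling xs g \<longleftrightarrow>
     (\<exists>ps. Suc (length ps) = length xs \<and>
       (\<forall>i<length ps. geodesic (xs ! i) (xs ! Suc i) (ps ! i)) \<and>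
       g = concat_paths ps)"

definition lasso :: "'a::metric_space \<Rightarrow> real \<Rightarrow> (real \<Rightarrow> 'a) \<Rightarrow> bool" where
  "lasso b l g \<longleftrightarrow>
     (\<exists>\<alpha> \<beta>. path \<alpha> \<and> pathstart \<alpha> = b \<and> path_length \<alpha> < \<infinity> \<and>
        path \<beta> \<and> pathstart \<beta> = pathfinish \<alpha> \<and> pathfinish \<beta> = pathfinish \<alpha> \<and>
        path_length \<beta> = ereal l \<and>
        g = \<alpha> +++ \<beta> +++ reversepath \<alpha>)"

abbreviation pi1 :: "'a::metric_space \<Rightarrow> (real \<Rightarrow> 'a) set monoid" where
  "pi1 b \<equiv> fundamental_group euclidean b"

abbreviation H1 :: "'g::ab_group_add itself \<Rightarrow> ('a::metric_space, 'g) gchain set monoid" where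
  "H1 G \<equiv> ghomology_group G 1 euclidean"

definition L_pi1 :: "'a::metric_space \<Rightarrow> real \<Rightarrow> (real \<Rightarrow> 'a) set set" where
  "L_pi1 b r = generate (pi1 b) {loop_class euclidean b g | g l. lasso b l g \<and> l < r}"

definition L_H1 ::
  "'g::ab_group_add itself \<Rightarrow> real \<Rightarrow> ('a::metric_space, 'g) gchain set set" where
  "L_H1 G r =
     generate (H1 G)
       {loop_homology_class G euclidean u g | u g.
          path g \<and> pathfinish g = pathstart g \<and> path_length g < ereal r}"

definition Lfin_pi1 :: "'a::metric_space \<Rightarrow> (real \<Rightarrow> 'a) set monoid" where
  "Lfin_pi1 b = (pi1 b)\<lparr>carrier := \<Union>n::nat. L_pi1 b (real n)\<rparr>"

definition Lfin_H1 :: "'g::ab_group_add itself \<Rightarrow> ('a::metric_space, 'g) gchain set monoid" where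
  "Lfin_H1 G = (H1 G)\<lparr>carrier := \<Union>n::nat. L_H1 G (real n)\<rparr>"

definition semi_locally_simply_connected :: "'a::metric_space itself \<Rightarrow> bool" where
  "semi_locally_simply_connected X \<longleftrightarrow>
     (\<forall>x::'a. \<exists>U. x \<in> interior U \<and>
        fundamental_group_map euclidean x id ` carrier (fundamental_group (top_of_set U) x)
          = {\<one>\<^bsub>pi1 x\<^esub>})"

definition G_semi_locally_simply_connected ::
  "'g::ab_group_add itself \<Rightarrow> 'a::metric_space itself \<Rightarrow> bool" where
  "G_semi_locally_simply_connected G X \<longleftrightarrow>
     (\<forall>x::'a. \<exists>U. x \<in> interior U \<and>
        ghomology_map G 1 euclidean id ` carrier (ghomology_group G 1 (top_of_set U))
          = {\<one>\<^bsub>H1 G\<^esub>})"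


section \<open>Persistences\<close>

text \<open>A persistence consists of groups indexed by \<open>r > 0\<close> and bonding maps indexed by \<open>p < q\<close>;
  values at other indices are ignored.\<close>

type_synonym 'c persistence = "(real \<Rightarrow> 'c monoid) \<times> (real \<Rightarrow> real \<Rightarrow> 'c \<Rightarrow> 'c)"

definition persistence_iso ::
  "'c persistence \<Rightarrow> 'd persistence \<Rightarrow> (real \<Rightarrow> 'c \<Rightarrow> 'd) \<Rightarrow> bool" where
  "persistence_iso P Q \<phi> \<longleftrightarrow>
     (\<forall>r>0. \<phi> r \<in> iso (fst P r) (fst Q r)) \<and>
     (\<forall>p q. 0 < p \<and> p < q \<longrightarrow>
        (\<forall>c\<in>carrier (fst P p). \<phi> q (snd P p q c) = snd Q p q (\<phi> p c)))"

definition isomorphic_persistences :: "'c persistence \<Rightarrow> 'd persistence \<Rightarrow> bool" where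
  "isomorphic_persistences P Q \<longleftrightarrow> (\<exists>\<phi>. persistence_iso P Q \<phi>)"

definition Rips_pi1 :: "'a::metric_space \<Rightarrow> real \<Rightarrow> (real \<Rightarrow> 'a \<Rightarrow> real) set monoid" where
  "Rips_pi1 b r = fundamental_group (realization (Rips r)) (indicator {b})"

definition Rips_H1 ::
  "'g::ab_group_add itself \<Rightarrow> real \<Rightarrow> ('a::metric_space \<Rightarrow> real, 'g) gchain set monoid" where
  "Rips_H1 G r = ghomology_group G 1 (realization (Rips r))"

definition Rips_pi1_persistence ::
  "'a::metric_space \<Rightarrow> (real \<Rightarrow> 'a \<Rightarrow> real) set persistence" where
  "Rips_pi1_persistence b =
     (Rips_pi1 b, \<lambda>p q. fundamental_group_map (realization (Rips q)) (indicator {b}) id)"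

definition Rips_H1_persistence ::
  "'g::ab_group_add itself \<Rightarrow> ('a::metric_space \<Rightarrow> real, 'g) gchain set persistence" where
  "Rips_H1_persistence G = (Rips_H1 G, \<lambda>p q. ghomology_map G 1 (realization (Rips q)) id)"

text \<open>For subgroups \<open>N p \<subseteq> N q\<close> the quotient map \<open>A Mod N p \<rightarrow> A Mod N q\<close> sends a coset \<open>C\<close> to
  \<open>N q <#> C\<close>.\<close>

definition quotient_persistence ::
  "'c monoid \<Rightarrow> (real \<Rightarrow> 'c set) \<Rightarrow> 'c set persistence" where
  "quotient_persistence A N = (\<lambda>r. A Mod N r, \<lambda>p q C. N q <#>\<^bsub>A\<^esub> C)"

text \<open>The maps \<open>\<lambda>\<^sub>r\<close> are characterized by sending \<open>r\<close>-loops to their fillings. In homology, the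
  classes of \<open>r\<close>-loops with coefficients only generate the group, so additivity is part of the
  description.\<close>

definition is_lambda_pi1 ::
  "'a::metric_space \<Rightarrow> real \<Rightarrow> ((real \<Rightarrow> 'a \<Rightarrow> real) set \<Rightarrow> (real \<Rightarrow> 'a) set set) \<Rightarrow> bool" where
  "is_lambda_pi1 b r h \<longleftrightarrow>
     h \<in> extensional (carrier (Rips_pi1 b r)) \<and>
     (\<forall>xs g. r_loop r xs \<and> hd xs = b \<and> filling xs g \<longrightarrow>
        h (loop_class (realization (Rips r)) (indicator {b}) (edge_path xs))
          = L_pi1 b (3 * r) #>\<^bsub>Lfin_pi1 b\<^esub> loop_class euclidean b g)"

definition lambda_pi1 ::
  "'a::metric_space \<Rightarrow> real \<Rightarrow> (real \<Rightarrow> 'a \<Rightarrow> real) set \<Rightarrow> (real \<Rightarrow> 'a) set set" where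
  "lambda_pi1 b r = (THE h. is_lambda_pi1 b r h)"

definition is_lambda_H1 ::
  "'g::ab_group_add itself \<Rightarrow> real \<Rightarrow>
     (('a::metric_space \<Rightarrow> real, 'g) gchain set \<Rightarrow> ('a, 'g) gchain set set) \<Rightarrow> bool" where
  "is_lambda_H1 G r h \<longleftrightarrow>
     h \<in> extensional (carrier (Rips_H1 G r)) \<and>
     h \<in> hom (Rips_H1 G r) (Lfin_H1 G Mod L_H1 G (3 * r)) \<and>
     (\<forall>u xs g. r_loop r xs \<and> filling xs g \<longrightarrow>
        h (loop_homology_class G (realization (Rips r)) u (edge_path xs))
          = L_H1 G (3 * r) #>\<^bsub>Lfin_H1 G\<^esub> loop_homology_class G euclidean u g)"

definition lambda_H1 ::
  "'g::ab_group_add itself \<Rightarrow> real \<Rightarrow>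
     ('a::metric_space \<Rightarrow> real, 'g) gchain set \<Rightarrow> ('a, 'g) gchain set set" where
  "lambda_H1 G r = (THE h. is_lambda_H1 G r h)"

end

theory Submission
  imports Defs
begin

text \<open>
  Fundamental groups and first homology are both universal among functors which send paths to a
  group, multiplicatively under concatenation and invariantly under homotopy. A group-valued Cech
  cocycle on an open cover has a holonomy, which is such a functor. The open stars of vertices cover
  \<open>Rips(X,r)\<close>; sending a pair \<open>(x,y)\<close> to the class of a geodesic from \<open>x\<close> to \<open>y\<close> is a cocycle modulo
  loops shorter than \<open>3r\<close>, because a geodesic triangle over a simplex has perimeter less than \<open>3r\<close>.
  Its holonomy is \<open>\<lambda>\<^sub>r\<close>. Conversely the balls of radius \<open>r/2\<close> cover \<open>X\<close>, and sending \<open>(x,y)\<close> to the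
  class of the edge is a cocycle with values in the group of \<open>Rips(X,r)\<close>. Its holonomy kills loops
  shorter than \<open>3r\<close>, since these split into three arcs shorter than \<open>r\<close> and so bound a
  single triangle, and it inverts \<open>\<lambda>\<^sub>r\<close> on \<open>r\<close>-loops. Surjectivity of \<open>\<lambda>\<^sub>r\<close> comes from
  replacing short arcs of a rectifiable loop by geodesics.
\<close>

text \<open>Group elements are attached to all paths, not just to based loops, because holonomy and
  discretization cut a path at interior points; the base point enters only through connecting paths
  fixed once. The cocycle condition is required only where three members of the cover share a point,
  and vertices whose open stars share a point span a simplex, so the combinatorics of the Rips
  complex is reached through its open cover. The constant \<open>3 * r\<close> is where the two
  directions meet: it bounds the perimeter of a triangle with sides below \<open>r\<close>, and
  continuity of arc length cuts every loop shorter than that into three arcs below \<open>r\<close>.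
  Radius \<open>r / 2\<close> is chosen because centres of balls that meet are closer than
  \<open>r\<close> and span an edge. A path of infinite length cannot be cut into finitely many
  short pieces, which is why finite-length classes appear; under a local triviality condition its
  pieces can still be exchanged for geodesics. In homology there is one functor for each coefficient
  \<open>u\<close>, and additivity in \<open>u\<close> turns the family into a homomorphism.\<close>

definition path_homotopic :: "'a topology \<Rightarrow> (real \<Rightarrow> 'a) \<Rightarrow> (real \<Rightarrow> 'a) \<Rightarrow> bool" where
  "path_homotopic X p q \<longleftrightarrow>
     homotopic_with (\<lambda>k. k 0 = p 0 \<and> k 1 = p 1) (top_of_set {0..1}) X p q"

lemma path_homotopicD:
  assumes "path_homotopic X p q"
  shows "pathin X p" "pathin X q" "q 0 = p 0" "q 1 = p 1"
  using homotopic_with_imp_continuous_maps[OF assms[unfolded path_homotopic_def]]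
    homotopic_with_imp_property[OF assms[unfolded path_homotopic_def]]
  by (auto simp: pathin_def)

lemma path_homotopic_refl: "pathin X p \<Longrightarrow> path_homotopic X p p"
  by (simp add: path_homotopic_def pathin_def)

lemma path_homotopic_sym: "path_homotopic X p q \<Longrightarrow> path_homotopic X q p"
  using path_homotopicD(3,4)[of X p q]
  by (simp add: path_homotopic_def homotopic_with_sym)

lemma path_homotopic_trans:
  "path_homotopic X p q \<Longrightarrow> path_homotopic X q r \<Longrightarrow> path_homotopic X p r"
  using path_homotopicD(3,4)[of X p q]
  by (auto simp: path_homotopic_def intro: homotopic_with_trans)

lemma path_homotopic_eq:
  assumes "pathin X p" "\<And>t. 0 \<le> t \<Longrightarrow> t \<le> 1 \<Longrightarrow> q t = p t"
  shows "path_homotopic X p q"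
  unfolding path_homotopic_def
  by (rule homotopic_with_equal) (use assms in \<open>auto simp: pathin_def\<close>)

lemma path_homotopic_map:
  "path_homotopic X p q \<Longrightarrow> continuous_map X Y f \<Longrightarrow> path_homotopic Y (f \<circ> p) (f \<circ> q)"
  unfolding path_homotopic_def
  by (erule homotopic_with_compose_continuous_map_left) auto

text \<open>Fixes the convention for squares used throughout: the first coordinate is the homotopy
  parameter, the second the path parameter.\<close>

lemma path_homotopicI:
  fixes H :: "real \<times> real \<Rightarrow> 'a"
  assumes "continuous_map (top_of_set ({0..1} \<times> {0..1})) X H"
    and "\<And>t. 0 \<le> t \<Longrightarrow> t \<le> 1 \<Longrightarrow> H (0, t) = p t" "\<And>t. 0 \<le> t \<Longrightarrow> t \<le> 1 \<Longrightarrow> H (1, t) = q t"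
    and "\<And>s. 0 \<le> s \<Longrightarrow> s \<le> 1 \<Longrightarrow> H (s, 0) = p 0" "\<And>s. 0 \<le> s \<Longrightarrow> s \<le> 1 \<Longrightarrow> H (s, 1) = p 1"
  shows "path_homotopic X p q"
  unfolding path_homotopic_def
proof (subst homotopic_with)
  show "\<exists>h :: real \<times> real \<Rightarrow> 'a. continuous_map (prod_topology (top_of_set {0..1}) (top_of_set {0..1})) X h \<and>
      (\<forall>x\<in>topspace (top_of_set {0..1}). h (0, x) = p x) \<and>
      (\<forall>x\<in>topspace (top_of_set {0..1}). h (1, x) = q x) \<and>
      (\<forall>t\<in>{0..1}. h (t, 0) = p 0 \<and> h (t, 1) = p 1)"
    by (rule exI[of _ H]) (use assms in auto)
qed auto

lemma path_homotopicE:
  fixes p :: "real \<Rightarrow> 'a"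
  assumes "path_homotopic X p q"
  obtains H :: "real \<times> real \<Rightarrow> 'a" where "continuous_map (top_of_set ({0..1} \<times> {0..1})) X H"
    "\<And>t. H (0, t) = p t" "\<And>t. H (1, t) = q t"
    "\<And>s. 0 \<le> s \<Longrightarrow> s \<le> 1 \<Longrightarrow> H (s, 0) = p 0" "\<And>s. 0 \<le> s \<Longrightarrow> s \<le> 1 \<Longrightarrow> H (s, 1) = p 1"
proof -
  from assms obtain h :: "real \<times> real \<Rightarrow> 'a" where h: "continuous_map (top_of_set ({0..1} \<times> {0..1})) X h"
    "\<forall>x. h (0, x) = p x" "\<forall>x. h (1, x) = q x" "\<forall>t\<in>{0..1}. h (t, 0) = p 0 \<and> h (t, 1) = p 1"
    unfolding path_homotopic_def homotopic_with_def prod_topology_subtopology_eu by blast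
  show thesis
    by (rule that[of h]) (use h in auto)
qed

text \<open>The straight-line homotopy in \<open>Z\<close>, pushed forward by \<open>H\<close>.
  Reparametrization, squares and triangles are the instances with \<open>Z\<close> an interval, a
  square and \<open>unit_triangle\<close>.\<close>

lemma path_homotopic_convex:
  fixes Z :: "'z::real_normed_vector set"
  assumes Z: "convex Z" and H: "continuous_map (top_of_set Z) X H"
    and p: "continuous_on {0..1} p" "p ` {0..1} \<subseteq> Z"
    and q: "continuous_on {0..1} q" "q ` {0..1} \<subseteq> Z"
    and "q 0 = p 0" "q 1 = p 1"
  shows "path_homotopic X (H \<circ> p) (H \<circ> q)"
proof -
  let ?K = "\<lambda>(s, t). (1 - s) *\<^sub>R p t + s *\<^sub>R q t"
  have cont: "continuous_on ({0..1} \<times> {0..1}) ?K"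
    unfolding split_def
    by (intro continuous_intros continuous_on_compose2[OF p(1)] continuous_on_compose2[OF q(1)]) auto
  have "?K \<in> ({0..1} \<times> {0..1}) \<rightarrow> Z"
    using Z p(2) q(2) by (auto simp: convex_alt image_subset_iff)
  with cont have "continuous_map (top_of_set ({0..1} \<times> {0..1})) X (H \<circ> ?K)"
    by (intro continuous_map_compose[OF _ H]) (auto simp: continuous_map_in_subtopology)
  then show ?thesis
    by (rule path_homotopicI) (use assms in \<open>auto simp: algebra_simps simp flip: scaleR_add_left\<close>)
qed

lemma path_homotopic_reparam:
  assumes g: "pathin X g"
    and p: "continuous_on {0..1} p" "p ` {0..1} \<subseteq> {0..1}"
    and q: "continuous_on {0..1} q" "q ` {0..1} \<subseteq> {0..1}"
    and "q 0 = p 0" "q 1 = p 1"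
  shows "path_homotopic X (g \<circ> p) (g \<circ> q)"
  by (rule path_homotopic_convex[of "{0..1}"]) (use assms in \<open>auto simp: pathin_def\<close>)

lemma pathin_reparam:
  assumes "pathin X g" "continuous_on {0..1} p" "p ` {0..1} \<subseteq> {0..1}"
  shows "pathin X (g \<circ> p)"
  using path_homotopic_reparam[OF assms assms(2,3)] by (auto dest: path_homotopicD)

lemma pathin_join:
  assumes p: "pathin X p" and q: "pathin X q" and "p 1 = q 0"
  shows "pathin X (p +++ q)"
  unfolding joinpaths_def pathin_def
proof (rule continuous_map_cases_le)
  have *: "continuous_map (subtopology (top_of_set {0..1}) {x \<in> topspace (top_of_set {0..1}). x \<le> 1 / 2}) (top_of_set {0..1}) (\<lambda>x. 2 * x :: real)"
    by (auto simp: continuous_map_in_subtopology subtopology_subtopology intro!: continuous_intros)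
  show "continuous_map (subtopology (top_of_set {0..1}) {x \<in> topspace (top_of_set {0..1}). x \<le> 1 / 2}) X (\<lambda>x. p (2 * x))"
    using continuous_map_compose[OF * p[unfolded pathin_def]] by (simp add: o_def)
  have *: "continuous_map (subtopology (top_of_set {0..1}) {x \<in> topspace (top_of_set {0..1}). 1/2 \<le> x}) (top_of_set {0..1}) (\<lambda>x. 2 * x - 1 :: real)"
    by (auto simp: continuous_map_in_subtopology subtopology_subtopology intro!: continuous_intros)
  show "continuous_map (subtopology (top_of_set {0..1}) {x \<in> topspace (top_of_set {0..1}). 1/2 \<le> x}) X (\<lambda>x. q (2 * x - 1))"
    using continuous_map_compose[OF * q[unfolded pathin_def]] by (simp add: o_def)
next
  fix x :: real assume "x = 1/2"
  then have "2 * x = 1" by simp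
  then show "p (2 * x) = q (2 * x - 1)" using assms by simp
qed (auto intro!: continuous_intros)

lemma path_homotopic_join:
  assumes p: "path_homotopic X p p'" and q: "path_homotopic X q q'" and eq: "p 1 = q 0"
  shows "path_homotopic X (p +++ q) (p' +++ q')"
proof -
  from p obtain H :: "real \<times> real \<Rightarrow> 'a" where H: "continuous_map (top_of_set ({0..1} \<times> {0..1})) X H"
    "\<And>t. H (0, t) = p t" "\<And>t. H (1, t) = p' t"
    "\<And>s. 0 \<le> s \<Longrightarrow> s \<le> 1 \<Longrightarrow> H (s, 0) = p 0" "\<And>s. 0 \<le> s \<Longrightarrow> s \<le> 1 \<Longrightarrow> H (s, 1) = p 1"
    by (rule path_homotopicE) blast
  from q obtain K :: "real \<times> real \<Rightarrow> 'a" where K: "continuous_map (top_of_set ({0..1} \<times> {0..1})) X K"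
    "\<And>t. K (0, t) = q t" "\<And>t. K (1, t) = q' t"
    "\<And>s. 0 \<le> s \<Longrightarrow> s \<le> 1 \<Longrightarrow> K (s, 0) = q 0" "\<And>s. 0 \<le> s \<Longrightarrow> s \<le> 1 \<Longrightarrow> K (s, 1) = q 1"
    by (rule path_homotopicE) blast
  let ?S = "top_of_set ({0..1} \<times> {0..1}) :: (real \<times> real) topology"
  have "continuous_map ?S X (\<lambda>z. if snd z \<le> 1/2 then H (fst z, 2 * snd z) else K (fst z, 2 * snd z - 1))"
  proof (rule continuous_map_cases_le)
    have *: "continuous_map (subtopology ?S {x \<in> topspace ?S. snd x \<le> 1 / 2}) ?S (\<lambda>z. (fst z, 2 * snd z))"
      by (auto simp: continuous_map_in_subtopology subtopology_subtopology intro!: continuous_intros)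
    show "continuous_map (subtopology ?S {x \<in> topspace ?S. snd x \<le> 1 / 2}) X (\<lambda>z. H (fst z, 2 * snd z))"
      using continuous_map_compose[OF * H(1)] by (simp add: o_def)
    have *: "continuous_map (subtopology ?S {x \<in> topspace ?S. 1/2 \<le> snd x}) ?S (\<lambda>z. (fst z, 2 * snd z - 1))"
      by (auto simp: continuous_map_in_subtopology subtopology_subtopology intro!: continuous_intros)
    show "continuous_map (subtopology ?S {x \<in> topspace ?S. 1/2 \<le> snd x}) X (\<lambda>z. K (fst z, 2 * snd z - 1))"
      using continuous_map_compose[OF * K(1)] by (simp add: o_def)
  next
    fix z assume z: "z \<in> topspace ?S" "snd z = 1/2"
    then have *: "2 * snd z = 1" "0 \<le> fst z" "fst z \<le> 1" by auto
    show "H (fst z, 2 * snd z) = K (fst z, 2 * snd z - 1)"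
      unfolding *(1) using * H(5)[of "fst z"] K(4)[of "fst z"] eq by simp
  qed (auto intro!: continuous_intros)
  then show ?thesis
    by (rule path_homotopicI)
       (use H K eq path_homotopicD[OF p] path_homotopicD[OF q] in \<open>auto simp: joinpaths_def\<close>)
qed

lemma pathin_reversepath: "pathin X p \<Longrightarrow> pathin X (reversepath p)"
  using pathin_reparam[of X p "\<lambda>t. 1 - t"]
  by (auto simp: reversepath_def o_def continuous_on_op_minus)

section \<open>Subpaths and the groupoid laws\<close>

definition restrict_path :: "real \<Rightarrow> real \<Rightarrow> (real \<Rightarrow> 'a) \<Rightarrow> real \<Rightarrow> 'a" where
  "restrict_path a b g = (\<lambda>t. g ((b - a) * t + a))"

lemma restrict_path_image:
  assumes "a \<le> b"
  shows "restrict_path a b g ` {0..1} \<subseteq> g ` {a..b}"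
proof
  fix y assume "y \<in> restrict_path a b g ` {0..1}"
  then obtain t where t: "0 \<le> t" "t \<le> 1" "y = g ((b - a) * t + a)"
    by (auto simp: restrict_path_def)
  then have "0 \<le> (b - a) * t" "(b - a) * t \<le> b - a"
    using assms by (auto simp: mult_left_le)
  then show "y \<in> g ` {a..b}" using t(3) by auto
qed

lemma pathin_subpath:
  assumes g: "pathin X g" and ab: "0 \<le> a" "a \<le> 1" "0 \<le> b" "b \<le> 1"
  shows "pathin X (restrict_path a b g)"
proof -
  have "(b - a) * t + a \<in> {0..1}" if t: "t \<in> {0..1}" for t
  proof -
    have "(b - a) * t + a = (1 - t) * a + t * b" by (simp add: algebra_simps)
    then show ?thesis
      using convexD_alt[OF convex_real_interval(5)[of 0 1], of a b t] ab t by simp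
  qed
  then show ?thesis
    unfolding restrict_path_def
    by (intro pathin_reparam[OF g, unfolded o_def]) (auto intro!: continuous_intros)
qed

lemma path_homotopic_assoc:
  assumes "pathin X f" "pathin X g" "pathin X h" "f 1 = g 0" "g 1 = h 0"
  shows "path_homotopic X ((f +++ g) +++ h) (f +++ (g +++ h))"
proof -
  \<comment> \<open>Associativity is a reparametrization with slopes 1/2, 1 and 2. Since the slopes
    increase, the function is the maximum of its three linear pieces and continuity comes for
    free.\<close>
  let ?k = "(f +++ g) +++ h" and ?\<theta> = "\<lambda>t::real. max (t / 2) (max (t - 1/4) (2 * t - 1))"
  have k: "pathin X ?k"
    using assms by (intro pathin_join) (auto simp: joinpaths_def)
  have "path_homotopic X (?k \<circ> (\<lambda>t. t)) (?k \<circ> ?\<theta>)"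
    by (rule path_homotopic_reparam[OF k]) (auto simp: le_max_iff_disj intro!: continuous_intros)
  also have "?k \<circ> ?\<theta> = f +++ (g +++ h)"
  proof
    fix t :: real
    consider "t \<le> 1/2" | "1/2 < t" "t \<le> 3/4" | "3/4 < t" by linarith
    then show "(?k \<circ> ?\<theta>) t = (f +++ (g +++ h)) t"
    proof cases
      case 1
      then consider "t \<ge> 0" | "t < 0" by linarith
      then have "?\<theta> t = t / 2" using 1 by cases auto
      then show ?thesis using 1 by (simp add: joinpaths_def)
    next
      case 2
      then have "?\<theta> t = t - 1/4" by auto
      then show ?thesis using 2 by (simp add: joinpaths_def algebra_simps)
    next
      case 3
      then have "?\<theta> t = 2 * t - 1" by auto
      then show ?thesis using 3 by (simp add: joinpaths_def algebra_simps)
    qed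
  qed
  finally show ?thesis by (simp add: o_def)
qed

lemma path_homotopic_const_join:
  assumes "pathin X g"
  shows "path_homotopic X g ((\<lambda>_. g 0) +++ g)"
proof -
  have "path_homotopic X (g \<circ> (\<lambda>t. t)) (g \<circ> (\<lambda>t. max 0 (2 * t - 1)))"
    by (rule path_homotopic_reparam[OF assms]) (auto intro!: continuous_intros)
  also have "g \<circ> (\<lambda>t. max 0 (2 * t - 1)) = (\<lambda>_. g 0) +++ g"
    by (auto simp: joinpaths_def max_def fun_eq_iff intro!: arg_cong[of _ _ g])
  finally show ?thesis by (simp add: o_def)
qed

lemma path_homotopic_join_reverse:
  assumes "pathin X g"
  shows "path_homotopic X (\<lambda>_. g 0) (g +++ reversepath g)"
proof -
  \<comment> \<open>The tent function runs through the unit interval and back; with end points fixed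
    at 0 it contracts inside the interval.\<close>
  have "path_homotopic X (g \<circ> (\<lambda>t. 0)) (g \<circ> (\<lambda>t. 1 - \<bar>1 - 2 * t\<bar>))"
    by (rule path_homotopic_reparam[OF assms]) (auto intro!: continuous_intros)
  also have "g \<circ> (\<lambda>t. 1 - \<bar>1 - 2 * t\<bar>) = g +++ reversepath g"
    by (auto simp: joinpaths_def reversepath_def abs_if fun_eq_iff intro: arg_cong[of _ _ g])
  finally show ?thesis by (simp add: o_def)
qed

section \<open>Path functors\<close>

definition list_mult :: "('q, 'm) monoid_scheme \<Rightarrow> 'q list \<Rightarrow> 'q" where
  "list_mult Q xs = foldr (mult Q) xs (one Q)"

lemma list_mult_simps [simp]:
  "list_mult Q [] = \<one>\<^bsub>Q\<^esub>" "list_mult Q (x # xs) = x \<otimes>\<^bsub>Q\<^esub> list_mult Q xs"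
  by (simp_all add: list_mult_def)

lemma (in monoid) list_mult_closed [simp]: "set xs \<subseteq> carrier G \<Longrightarrow> list_mult G xs \<in> carrier G"
  by (induct xs) auto

lemma (in monoid) list_mult_append:
  "set xs \<subseteq> carrier G \<Longrightarrow> set ys \<subseteq> carrier G \<Longrightarrow>
    list_mult G (xs @ ys) = list_mult G xs \<otimes> list_mult G ys"
  by (induct xs) (auto simp: m_assoc)

text \<open>A functor from the fundamental groupoid of \<open>Y\<close> to the group
  \<open>Q\<close>, seen as a groupoid with one object. Having values on open paths is what allows a
  path to be evaluated piece by piece.\<close>

locale path_functor = group Q for Q :: "('q, 'm) monoid_scheme" (structure) +
  fixes Y :: "'y::topological_space topology" and F :: "(real \<Rightarrow> 'y) \<Rightarrow> 'q"
  assumes F_closed [simp]: "pathin Y p \<Longrightarrow> F p \<in> carrier Q"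
    and F_homotopic: "path_homotopic Y p q \<Longrightarrow> F p = F q"
    and F_join: "pathin Y p \<Longrightarrow> pathin Y q \<Longrightarrow> p 1 = q 0 \<Longrightarrow> F (p +++ q) = F p \<otimes> F q"
begin

lemma F_cong:
  assumes "pathin Y p" "\<And>t. 0 \<le> t \<Longrightarrow> t \<le> 1 \<Longrightarrow> q t = p t"
  shows "F q = F p"
  using F_homotopic[OF path_homotopic_eq[OF assms]] by simp

lemma F_const [simp]:
  assumes "a \<in> topspace Y" shows "F (\<lambda>_. a) = \<one>"
proof -
  have "(\<lambda>_::real. a) +++ (\<lambda>_. a) = (\<lambda>_. a)" by (auto simp: joinpaths_def)
  then have "F (\<lambda>_. a) \<otimes> F (\<lambda>_. a) = F (\<lambda>_. a)"
    using F_join[of "\<lambda>_. a" "\<lambda>_. a"] assms by simp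
  then show ?thesis
    using assms by (simp add: l_cancel_one)
qed

lemma F_reversepath:
  assumes "pathin Y p" shows "F (reversepath p) = inv (F p)"
proof -
  have "F p \<otimes> F (reversepath p) = F (p +++ reversepath p)"
    using assms pathin_reversepath[OF assms] by (subst F_join) (auto simp: reversepath_def)
  also have "\<dots> = F (\<lambda>_. p 0)"
    using F_homotopic[OF path_homotopic_join_reverse[OF assms]] by simp
  also have "\<dots> = \<one>"
    using assms path_start_in_topspace by force
  finally show ?thesis
    using assms by (metis F_closed inv_equality inv_comm pathin_reversepath)
qed

text \<open>Both sides are \<open>g\<close> composed with paths in the unit interval that have the
  same end points, and the interval is convex.\<close>

lemma F_subpath:
  assumes g: "pathin Y g" and abc: "0 \<le> a" "a \<le> b" "b \<le> c" "c \<le> 1"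
  shows "F (restrict_path a c g) = F (restrict_path a b g) \<otimes> F (restrict_path b c g)"
proof -
  let ?p = "restrict_path a b (\<lambda>t. t) +++ restrict_path b c (\<lambda>t. t)" and ?q = "restrict_path a c (\<lambda>t::real. t)"
  have im: "restrict_path x y (\<lambda>t. t) ` {0..1} \<subseteq> {0..1}" if "0 \<le> x" "x \<le> y" "y \<le> 1" for x y :: real
    using restrict_path_image[OF that(2), of "\<lambda>t. t"] that by auto
  have "path_homotopic Y (g \<circ> ?p) (g \<circ> ?q)"
  proof (rule path_homotopic_reparam[OF g])
    show "continuous_on {0..1} ?p"
      unfolding path_def[symmetric]
      by (rule path_join_imp)
         (auto simp: pathstart_def pathfinish_def restrict_path_def path_def intro!: continuous_intros)
    have "path_image ?p \<subseteq> {0..1}"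
      using path_image_join_subset[of "restrict_path a b (\<lambda>t. t)" "restrict_path b c (\<lambda>t. t)"]
        im[of a b] im[of b c] abc by (auto simp: path_image_def)
    then show "?p ` {0..1} \<subseteq> {0..1}" by (simp add: path_image_def)
    show "continuous_on {0..1} ?q" by (auto simp: restrict_path_def intro!: continuous_intros)
    show "?q ` {0..1} \<subseteq> {0..1}" using im[of a c] abc by simp
  qed (auto simp: restrict_path_def joinpaths_def)
  then have "F (g \<circ> ?q) = F (g \<circ> ?p)" by (simp add: F_homotopic)
  moreover have "g \<circ> ?q = restrict_path a c g" by (auto simp: restrict_path_def)
  moreover have "g \<circ> ?p = restrict_path a b g +++ restrict_path b c g" by (auto simp: restrict_path_def joinpaths_def)
  moreover have "F (restrict_path a b g +++ restrict_path b c g) = F (restrict_path a b g) \<otimes> F (restrict_path b c g)"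
    using abc by (intro F_join pathin_subpath[OF g]) (auto simp: restrict_path_def)
  ultimately show ?thesis by simp
qed

text \<open>The two ways around the boundary of the unit square are homotopic in the square. The
  lemma compares a path with its image under a deformation that moves the end points.\<close>

lemma F_square:
  assumes H: "continuous_map (top_of_set ({0..1} \<times> {0..1})) Y H"
  shows "F (\<lambda>t. H (0, t)) \<otimes> F (\<lambda>s. H (s, 1)) = F (\<lambda>s. H (s, 0)) \<otimes> F (\<lambda>t. H (1, t))"
proof -
  let ?p = "(\<lambda>t::real. (0::real, t)) +++ (\<lambda>s. (s, 1))" and ?q = "(\<lambda>s::real. (s, 0::real)) +++ (\<lambda>t. (1, t))"
  have side: "pathin Y (H \<circ> h)" if "continuous_on {0..1} h" "h \<in> {0..1} \<rightarrow> {0..1} \<times> {0..1}" for h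
    using that by (auto simp: pathin_def continuous_map_in_subtopology intro!: continuous_map_compose[OF _ H])
  have "path_homotopic Y (H \<circ> ?p) (H \<circ> ?q)"
  proof (rule path_homotopic_convex[OF _ H])
    show "convex ({0..1::real} \<times> {0..1::real})" by (intro convex_Times) auto
    show "continuous_on {0..1} ?p" "continuous_on {0..1} ?q"
      unfolding path_def[symmetric]
      by (auto intro!: path_join_imp) (auto simp: path_def pathstart_def pathfinish_def intro!: continuous_intros)
    show "?p ` {0..1} \<subseteq> {0..1} \<times> {0..1}" "?q ` {0..1} \<subseteq> {0..1} \<times> {0..1}"
      by (auto simp: joinpaths_def)
  qed (auto simp: joinpaths_def)
  then have "F (H \<circ> ?p) = F (H \<circ> ?q)" by (simp add: F_homotopic)
  moreover have "H \<circ> ?p = (\<lambda>t. H (0, t)) +++ (\<lambda>s. H (s, 1))"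
    "H \<circ> ?q = (\<lambda>s. H (s, 0)) +++ (\<lambda>t. H (1, t))"
    by (auto simp: joinpaths_def)
  moreover have "pathin Y (\<lambda>t. H (0, t))" "pathin Y (\<lambda>s. H (s, 1))"
      "pathin Y (\<lambda>s. H (s, 0))" "pathin Y (\<lambda>t. H (1, t))"
    using side[of "\<lambda>t. (0, t)"] side[of "\<lambda>s. (s, 1)"] side[of "\<lambda>s. (s, 0)"] side[of "\<lambda>t. (1, t)"]
    by (auto simp: o_def continuous_on_Pair)
  ultimately show ?thesis
    using F_join[of "\<lambda>t. H (0, t)" "\<lambda>s. H (s, 1)"] F_join[of "\<lambda>s. H (s, 0)" "\<lambda>t. H (1, t)"] by metis
qed

lemma F_uniform:
  assumes g: "pathin Y g" and n: "0 < n"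
  shows "F g = list_mult Q (map (\<lambda>j. F (restrict_path (real j / real n) (real (Suc j) / real n) g)) [0..<n])"
proof -
  have *: "F (restrict_path 0 (real k / real n) g) =
      list_mult Q (map (\<lambda>j. F (restrict_path (real j / real n) (real (Suc j) / real n) g)) [0..<k])"
    if "k \<le> n" for k
    using that
  proof (induct k)
    case 0
    have "restrict_path 0 0 g = (\<lambda>_. g 0)" by (auto simp: restrict_path_def)
    then show ?case using g path_start_in_topspace by force
  next
    case (Suc k)
    have *: "pathin Y (restrict_path (real j / real n) (real (Suc j) / real n) g)" if "j \<le> k" for j
      using g that Suc.prems n by (intro pathin_subpath) (auto simp: field_simps)
    have "F (restrict_path 0 (real (Suc k) / real n) g) =
        F (restrict_path 0 (real k / real n) g) \<otimes> F (restrict_path (real k / real n) (real (Suc k) / real n) g)"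
      using Suc.prems n g by (intro F_subpath) (auto simp: field_simps)
    also have "F (restrict_path 0 (real k / real n) g) =
       list_mult Q (map (\<lambda>j. F (restrict_path (real j / real n) (real (Suc j) / real n) g)) [0..<k])"
      using Suc by simp
    finally show ?case
      using * by (subst upt_Suc_append, simp, subst map_append, subst list_mult_append) auto
  qed
  have 1: "restrict_path 0 1 g = g" by (simp add: restrict_path_def)
  show ?thesis
    using *[OF order_refl] n 1 by simp
qed

end

section \<open>Holonomy of Cech cocycles\<close>

text \<open>The target has no metric, so the cover is pulled back along \<open>H\<close> and the
  Lebesgue number is taken in the compact source.\<close>

lemma Lebesgue_number_continuous_map:
  fixes K :: "'z::metric_space set"
  assumes K: "compact K" and H: "continuous_map (top_of_set K) Y H"
    and U: "\<And>v. openin Y (U v)" "topspace Y \<subseteq> (\<Union>v. U v)"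
  obtains \<delta> where "0 < \<delta>" "\<And>T. T \<subseteq> K \<Longrightarrow> diameter T < \<delta> \<Longrightarrow> \<exists>v. H ` T \<subseteq> U v"
proof (cases "K = {}")
  case True
  then show thesis by (intro that[of 1]) auto
next
  case False
  have "\<exists>W. open W \<and> {z \<in> K. H z \<in> U v} = K \<inter> W" for v
    using openin_continuous_map_preimage[OF H U(1)[of v]] by (auto simp: openin_open)
  then obtain W where W: "\<And>v. open (W v)" "\<And>v. {z \<in> K. H z \<in> U v} = K \<inter> W v"
    by metis
  have "K \<subseteq> \<Union>(range W)"
  proof
    fix z assume z: "z \<in> K"
    then have "H z \<in> topspace Y" using continuous_map_funspace[OF H] by auto
    then obtain v where "H z \<in> U v" using U(2) by auto
    then have "z \<in> W v" using W(2)[of v] z by blast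
    then show "z \<in> \<Union>(range W)" by blast
  qed
  then obtain \<delta> where \<delta>: "0 < \<delta>" "\<And>T. T \<subseteq> K \<Longrightarrow> diameter T < \<delta> \<Longrightarrow> \<exists>B\<in>range W. T \<subseteq> B"
    using Lebesgue_number_lemma[OF K, of "range W"] W(1) by (metis empty_not_UNIV image_is_empty rangeE)
  show thesis
  proof (rule that[OF \<delta>(1)])
    fix T assume T: "T \<subseteq> K" "diameter T < \<delta>"
    then obtain v where "T \<subseteq> W v" using \<delta>(2) by blast
    then have "T \<subseteq> {z \<in> K. H z \<in> U v}" using W(2)[of v] T(1) by blast
    then show "\<exists>v. H ` T \<subseteq> U v" by blast
  qed
qed

lemma grid_interval:
  assumes "j < n"
  shows "{real j / n..real (Suc j) / n} \<subseteq> {0..1}"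
proof -
  have "0 \<le> real j / n" "real (Suc j) / n \<le> 1" using assms by (auto simp: field_simps)
  then show ?thesis by (metis atLeastatMost_subset_iff)
qed

text \<open>Subdivisions are kept uniform because two of them, with \<open>n\<close> and
  \<open>m\<close> pieces, have the uniform common refinement with \<open>n * m\<close>
  pieces.\<close>

lemma uniform_subdivision:
  assumes g: "pathin Y g" and U: "\<And>v. openin Y (U v)" "topspace Y \<subseteq> (\<Union>v. U v)"
  obtains n w where "0 < n" "\<And>j. j < n \<Longrightarrow> g ` {real j / n..real (Suc j) / n} \<subseteq> U (w j)"
proof -
  obtain \<delta> where \<delta>: "0 < \<delta>" "\<And>T. T \<subseteq> {0..1} \<Longrightarrow> diameter T < \<delta> \<Longrightarrow> \<exists>v. g ` T \<subseteq> U v"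
    using Lebesgue_number_continuous_map[of "{0..1::real}" Y g U] g U
    unfolding pathin_def by (metis compact_Icc)
  obtain n' where n': "inverse (real (Suc n')) < \<delta>" using reals_Archimedean[OF \<delta>(1)] by blast
  define n where "n = Suc n'"
  have n: "0 < n" by (simp add: n_def)
  have "\<exists>v. g ` {real j / n..real (Suc j) / n} \<subseteq> U v" if j: "j < n" for j
  proof (rule \<delta>(2)[OF grid_interval[OF j]])
    have len: "real (Suc j) / n = real j / n + inverse (real n)" using n by (simp add: field_simps)
    have "diameter {real j / n..real (Suc j) / n} \<le> inverse (real n)"
      by (rule diameter_le) (unfold len, auto)
    then show "diameter {real j / n..real (Suc j) / n} < \<delta>" using n' by (simp add: n_def)
  qed
  then obtain w where "\<And>j. j < n \<Longrightarrow> g ` {real j / n..real (Suc j) / n} \<subseteq> U (w j)" by metis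
  then show thesis by (rule that[OF n])
qed

text \<open>A Cech 1-cocycle with values in a possibly non-abelian group. The section
  \<open>sel\<close> names a preferred member of the cover at each point; it anchors holonomy at the
  end points of a path and thereby makes it multiplicative.\<close>

locale cech_cocycle = group Q for Q :: "('q, 'm) monoid_scheme" (structure) +
  fixes Y :: "'y::topological_space topology"
    and U :: "'v \<Rightarrow> 'y set" and sel :: "'y \<Rightarrow> 'v" and \<phi> :: "'v \<Rightarrow> 'v \<Rightarrow> 'q"
  assumes U_open: "openin Y (U v)"
    and sel: "y \<in> topspace Y \<Longrightarrow> y \<in> U (sel y)"
    and \<phi>_closed: "y \<in> U u \<Longrightarrow> y \<in> U v \<Longrightarrow> \<phi> u v \<in> carrier Q"
    and cocycle: "y \<in> U u \<Longrightarrow> y \<in> U v \<Longrightarrow> y \<in> U w \<Longrightarrow> \<phi> u v \<otimes> \<phi> v w = \<phi> u w"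
begin

lemma sel_U: "y \<in> U v \<Longrightarrow> y \<in> U (sel y)"
  using sel openin_subset[OF U_open] by blast

lemma \<phi>_refl: "y \<in> U u \<Longrightarrow> \<phi> u u = \<one>"
  using cocycle[of y u u u] \<phi>_closed[of y u u] by (simp add: l_cancel_one)

text \<open>Here \<open>w\<close> labels the \<open>n\<close> equal pieces of \<open>g\<close> by
  members of the cover that contain them. Consecutive closed pieces share their common node, so each
  transition \<phi> is evaluated on a nonempty overlap.\<close>

definition chain :: "(real \<Rightarrow> 'y) \<Rightarrow> nat \<Rightarrow> (nat \<Rightarrow> 'v) \<Rightarrow> bool" where
  "chain g n w \<longleftrightarrow> 0 < n \<and> (\<forall>j<n. \<forall>t. real j \<le> t * n \<and> t * n \<le> real (Suc j) \<longrightarrow> g t \<in> U (w j))"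

fun walk :: "(real \<Rightarrow> 'y) \<Rightarrow> (nat \<Rightarrow> 'v) \<Rightarrow> nat \<Rightarrow> 'q" where
  "walk g w 0 = \<phi> (sel (g 0)) (w 0)"
| "walk g w (Suc j) = walk g w j \<otimes> \<phi> (w j) (w (Suc j))"

text \<open>The transport \<phi>(sel(g 0), w 0) \<phi>(w 0, w 1) ... \<phi>(w(n-1), sel(g 1)) along
  the labels.\<close>

definition word :: "(real \<Rightarrow> 'y) \<Rightarrow> nat \<Rightarrow> (nat \<Rightarrow> 'v) \<Rightarrow> 'q" where
  "word g n w = walk g w (n - 1) \<otimes> \<phi> (w (n - 1)) (sel (g 1))"

definition hol :: "(real \<Rightarrow> 'y) \<Rightarrow> 'q" where
  "hol g = (SOME q. \<exists>n w. chain g n w \<and> q = word g n w)"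

lemma chain_node:
  assumes "chain g n w" "Suc j < n"
  shows "g (real (Suc j) / n) \<in> U (w j)" "g (real (Suc j) / n) \<in> U (w (Suc j))"
  using assms by (auto simp: chain_def)

lemma chain_ends:
  assumes "chain g n w"
  shows "g 0 \<in> U (w 0)" "g 1 \<in> U (w (n - 1))"
  using assms by (auto simp: chain_def of_nat_diff)

lemma chain_refine:
  assumes c: "chain g n w" and m: "0 < m"
  shows "chain g (n * m) (\<lambda>i. w (i div m))"
  unfolding chain_def
proof (intro conjI allI impI)
  show "0 < n * m" using c m by (simp add: chain_def)
  fix i t assume i: "i < n * m" and t: "real i \<le> t * real (n * m) \<and> t * real (n * m) \<le> real (Suc i)"
  have "i div m * m \<le> i" "Suc i \<le> Suc (i div m) * m"
    using m dividend_less_div_times[of m i] by (auto simp: Suc_le_eq)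
  then have "real (i div m) * m \<le> real i" "real (Suc i) \<le> real (Suc (i div m)) * m"
    by (metis of_nat_le_iff of_nat_mult)+
  then have "real (i div m) * m \<le> t * n * m" "t * n * m \<le> real (Suc (i div m)) * m"
    using t by (auto simp: mult.assoc)
  then have "real (i div m) \<le> t * n" "t * n \<le> real (Suc (i div m))"
    using m by (auto simp: mult_le_cancel_right)
  moreover have "i div m < n" using i by (simp add: less_mult_imp_div_less)
  ultimately show "g t \<in> U (w (i div m))"
    using c unfolding chain_def by blast
qed

lemma walk_closed: "chain g n w \<Longrightarrow> j < n \<Longrightarrow> walk g w j \<in> carrier Q"
proof (induct j)
  case 0
  then show ?case using chain_ends(1)[of g n w] by (auto intro: \<phi>_closed[of "g 0"] sel_U)
next
  case (Suc j)
  then show ?case using chain_node[of g n w j] by (auto intro: \<phi>_closed)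
qed

lemma word_closed:
  assumes c: "chain g n w"
  shows "word g n w \<in> carrier Q"
proof -
  have "n - 1 < n" using c by (simp add: chain_def)
  then show ?thesis
    unfolding word_def
    using chain_ends(2)[OF c] walk_closed[OF c] by (blast intro: \<phi>_closed sel_U)
qed

text \<open>Inside a block the label repeats and the step contributes \<open>\<phi> u u\<close>,
  which is trivial; only passages between blocks count.\<close>

lemma walk_refine:
  assumes c: "chain g n w" and m: "0 < m" and "i < n * m"
  shows "walk g (\<lambda>i. w (i div m)) i = walk g w (i div m)"
  using \<open>i < n * m\<close>
proof (induct i)
  case (Suc i)
  have d: "Suc i div m < n" using Suc.prems by (simp add: less_mult_imp_div_less)
  consider "Suc i div m = i div m" | "Suc i div m = Suc (i div m)"
    by (metis div_Suc)
  then show ?case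
  proof cases
    case 1
    have t: "g (real (i div m) / n) \<in> U (w (i div m))"
      using c d 1 unfolding chain_def by auto
    show ?thesis using Suc 1 \<phi>_refl[OF t] walk_closed[OF c, of "i div m"] d by simp
  next
    case 2
    then show ?thesis using Suc by simp
  qed
qed simp

lemma word_refine:
  assumes c: "chain g n w" and m: "0 < m"
  shows "word g (n * m) (\<lambda>i. w (i div m)) = word g n w"
proof -
  have n: "0 < n" using c by (simp add: chain_def)
  then obtain n' where n': "n = Suc n'" by (cases n) auto
  \<comment> \<open>The last refined piece lies in the last block, so the closing factor of the word
    is unchanged.\<close>
  have "n * m - 1 = (m - 1) + n' * m" using n' m by (cases m) auto
  then have "(n * m - 1) div m = (m - 1 + n' * m) div m" by simp
  also have "\<dots> = n - 1" using n' m by (subst div_mult_self1) auto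
  finally have d: "(n * m - 1) div m = n - 1" .
  then show ?thesis
    using walk_refine[OF c m, of "n * m - 1"] n m by (simp add: word_def)
qed

text \<open>A change of labels acts as a gauge transformation: the partial products differ by the
  transition from the old to the new current label. At the end the factor into
  \<open>sel (g 1)\<close> absorbs it.\<close>

lemma walk_unique:
  assumes c: "chain g n w" "chain g n w'" and "j < n"
  shows "walk g w' j = walk g w j \<otimes> \<phi> (w j) (w' j)"
  using \<open>j < n\<close>
proof (induct j)
  case 0
  show ?case
    using chain_ends(1)[OF c(1)] chain_ends(1)[OF c(2)] by (simp add: cocycle[of "g 0"] sel_U)
next
  case (Suc j)
  let ?y = "g (real (Suc j) / n)"
  note y = chain_node[OF c(1) Suc.prems] chain_node[OF c(2) Suc.prems]
  have cl: "walk g w j \<in> carrier Q" using walk_closed[OF c(1)] Suc.prems by simp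
  have "walk g w' (Suc j) = walk g w j \<otimes> (\<phi> (w j) (w' j) \<otimes> \<phi> (w' j) (w' (Suc j)))"
    using Suc cl y by (simp add: m_assoc \<phi>_closed[of ?y])
  also have "\<phi> (w j) (w' j) \<otimes> \<phi> (w' j) (w' (Suc j)) = \<phi> (w j) (w (Suc j)) \<otimes> \<phi> (w (Suc j)) (w' (Suc j))"
    using y by (simp add: cocycle[of ?y])
  finally show ?case
    using cl y by (simp add: m_assoc \<phi>_closed[of ?y])
qed

lemma word_unique:
  assumes c: "chain g n w" "chain g n w'"
  shows "word g n w' = word g n w"
proof -
  have n: "n - 1 < n" using c(1) by (simp add: chain_def)
  note y = chain_ends(2)[OF c(1)] chain_ends(2)[OF c(2)] sel_U[OF chain_ends(2)[OF c(1)]]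
  show ?thesis
    unfolding word_def walk_unique[OF c n]
    using y walk_closed[OF c(1) n] by (simp add: m_assoc \<phi>_closed[of "g 1"] cocycle[of "g 1"])
qed

text \<open>Any two chains are compared on the common refinement with \<open>n * m\<close> pieces,
  where they differ only in their labels. This makes the choice in \<open>hol\<close>
  immaterial.\<close>

lemma hol_eq:
  assumes c: "chain g n w"
  shows "hol g = word g n w"
  unfolding hol_def
proof (rule some_equality)
  fix q assume "\<exists>n w. chain g n w \<and> q = word g n w"
  then obtain m w' where c': "chain g m w'" and q: "q = word g m w'" by blast
  have pos: "0 < n" "0 < m" using c c' by (auto simp: chain_def)
  have c'': "chain g (n * m) (\<lambda>i. w' (i div n))"
    using chain_refine[OF c' pos(1)] by (simp only: mult.commute[of m n])
  have "word g n w = word g (n * m) (\<lambda>i. w (i div m))" by (rule word_refine[OF c pos(2), symmetric])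
  also have "\<dots> = word g (n * m) (\<lambda>i. w' (i div n))"
    by (rule word_unique[OF c'' chain_refine[OF c pos(2)]])
  also have "\<dots> = word g m w'"
    using word_refine[OF c' pos(1)] by (simp only: mult.commute[of m n])
  finally show "q = word g n w" using q by simp
qed (use c in auto)

lemma chain_exists:
  assumes g: "pathin Y g"
  obtains n w where "chain g n w"
proof -
  obtain n w where n: "0 < n" and w: "\<And>j. j < n \<Longrightarrow> g ` {real j / n..real (Suc j) / n} \<subseteq> U (w j)"
    using uniform_subdivision[OF g, of U] U_open sel by blast
  have "chain g n w"
    unfolding chain_def
  proof (intro conjI allI impI n)
    fix j and t :: real assume j: "j < n" and t: "real j \<le> t * n \<and> t * n \<le> real (Suc j)"
    then have "t \<in> {real j / n..real (Suc j) / n}" using n by (simp add: field_simps)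
    then show "g t \<in> U (w j)" using w[OF j] by blast
  qed
  then show thesis by (rule that)
qed

lemma hol_closed: "pathin Y g \<Longrightarrow> hol g \<in> carrier Q"
  by (metis chain_exists hol_eq word_closed)

lemma walk_cong: "g' 0 = g 0 \<Longrightarrow> walk g' w j = walk g w j"
  by (induct j) auto

text \<open>On a grid so fine that each cell maps into one member of the cover, both long sides of a
  row admit the labels of that row, and the end points are fixed. Their words are then literally
  equal, and holonomy is carried across the square row by row.\<close>

lemma hol_homotopic:
  assumes "path_homotopic Y p q"
  shows "hol p = hol q"
proof -
  obtain H :: "real \<times> real \<Rightarrow> 'y" where H: "continuous_map (top_of_set ({0..1} \<times> {0..1})) Y H"
    "\<And>t. H (0, t) = p t" "\<And>t. H (1, t) = q t"
    "\<And>s. 0 \<le> s \<Longrightarrow> s \<le> 1 \<Longrightarrow> H (s, 0) = p 0" "\<And>s. 0 \<le> s \<Longrightarrow> s \<le> 1 \<Longrightarrow> H (s, 1) = p 1"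
    using assms by (rule path_homotopicE) blast
  obtain \<delta> where \<delta>: "0 < \<delta>"
    "\<And>T. T \<subseteq> {0..1} \<times> {0..1} \<Longrightarrow> diameter T < \<delta> \<Longrightarrow> \<exists>v. H ` T \<subseteq> U v"
    using Lebesgue_number_continuous_map[of "{0..1} \<times> {0..1::real}" Y H U] H(1) U_open sel
    by (metis UNIV_I UN_I compact_Icc compact_Times subsetI)
  \<comment> \<open>A cell with sides \<open>1 / ?N\<close> has diameter at most
    \<open>2 / ?N\<close>, which is less than two thirds of \<delta>.\<close>
  obtain n where n: "inverse (real (Suc n)) < \<delta> / 3" using reals_Archimedean[of "\<delta> / 3"] \<delta>(1) by auto
  let ?N = "Suc n"
  have "\<exists>v. \<forall>(s::real) (t::real). real i \<le> s * ?N \<and> s * ?N \<le> real (Suc i) \<and> real j \<le> t * ?N \<and> t * ?N \<le> real (Suc j)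
      \<longrightarrow> H (s, t) \<in> U v" if ij: "i < ?N" "j < ?N" for i j
  proof -
    let ?T = "{real i / ?N..real (Suc i) / ?N} \<times> {real j / ?N..real (Suc j) / ?N}"
    have "diameter ?T \<le> 2 * inverse (real ?N)"
    proof (rule diameter_le)
      fix x y assume xy: "x \<in> ?T" "y \<in> ?T"
      have d: "\<bar>a - b\<bar> \<le> inverse (real ?N)" if "a \<in> {real k / ?N..real (Suc k) / ?N}" "b \<in> {real k / ?N..real (Suc k) / ?N}" for a b k
      proof -
        have "real (Suc k) / ?N = real k / ?N + inverse (real ?N)" by (simp add: field_simps)
        then show ?thesis using that by auto
      qed
      have "norm (x - y) \<le> \<bar>fst x - fst y\<bar> + \<bar>snd x - snd y\<bar>"
        using norm_Pair_le[of "fst x - fst y" "snd x - snd y"] by (simp add: minus_prod_def)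
      also have "\<dots> \<le> 2 * inverse (real ?N)"
        using d[of "fst x" i "fst y"] d[of "snd x" j "snd y"] xy by auto
      finally show "norm (x - y) \<le> 2 * inverse (real ?N)" .
    qed simp
    then have "diameter ?T < \<delta>" using n \<delta>(1) by linarith
    moreover have "?T \<subseteq> {0..1} \<times> {0..1}" using grid_interval[OF ij(1)] grid_interval[OF ij(2)] by blast
    ultimately obtain v where "H ` ?T \<subseteq> U v" using \<delta>(2) by blast
    then show ?thesis by (intro exI[of _ v]) (auto simp: image_subset_iff field_simps)
  qed
  then obtain w where w: "\<And>i j (s::real) (t::real). i < ?N \<Longrightarrow> j < ?N \<Longrightarrow> real i \<le> s * ?N \<Longrightarrow> s * ?N \<le> real (Suc i) \<Longrightarrow>
      real j \<le> t * ?N \<Longrightarrow> t * ?N \<le> real (Suc j) \<Longrightarrow> H (s, t) \<in> U (w i j)"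
    by metis
  have "hol (\<lambda>t. H (real i / ?N, t)) = hol p" if "i \<le> ?N" for i
    using that
  proof (induct i)
    case 0
    then show ?case using H(2) by (simp add: eta_contract_eq)
  next
    case (Suc i)
    let ?a = "\<lambda>t. H (real i / ?N, t)" and ?b = "\<lambda>t. H (real (Suc i) / ?N, t)"
    have "i < ?N" "real i \<le> real i / ?N * ?N" "real i / ?N * ?N \<le> real (Suc i)"
      "real i \<le> real (Suc i) / ?N * ?N" "real (Suc i) / ?N * ?N \<le> real (Suc i)"
      using Suc.prems by auto
    \<comment> \<open>Both boundary curves of row \<open>i\<close> lie in the closed cells of that
      row, so one label sequence serves for both.\<close>
    then have a: "chain ?a ?N (w i)" and b: "chain ?b ?N (w i)"
      unfolding chain_def using w[of i] by blast+
    have e: "?b 0 = ?a 0" "?b 1 = ?a 1"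
      using H(4,5) Suc.prems by (auto simp: field_simps)
    have "hol ?b = hol ?a"
      unfolding hol_eq[OF a] hol_eq[OF b] word_def
      using walk_cong[of ?b ?a, OF e(1)] e(2) by simp
    then show ?case using Suc by simp
  qed
  from this[of ?N] show ?thesis using H(3) by (simp add: eta_contract_eq)
qed

lemma hol_join:
  assumes p: "pathin Y p" and q: "pathin Y q" and pq: "p 1 = q 0"
  shows "hol (p +++ q) = hol p \<otimes> hol q"
proof -
  obtain n w where c: "chain p n w" using chain_exists[OF p] .
  obtain m w' where c': "chain q m w'" using chain_exists[OF q] .
  have pos: "0 < n" "0 < m" using c c' by (auto simp: chain_def)
  \<comment> \<open>Both paths need the same number of pieces for their concatenation to be
    subdivided uniformly, into \<open>2 * N\<close> pieces.\<close>
  define N where "N = n * m"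
  define a where "a = (\<lambda>i. w (i div m))"
  define b where "b = (\<lambda>i. w' (i div n))"
  have a: "chain p N a" and b: "chain q N b"
    unfolding N_def a_def b_def using chain_refine[OF c pos(2)] chain_refine[OF c' pos(1)]
    by (simp_all add: mult.commute)
  have N: "0 < N" using pos by (simp add: N_def)
  let ?g = "p +++ q" and ?w = "\<lambda>j. if j < N then a j else b (j - N)"
  have g: "chain ?g (2 * N) ?w"
    unfolding chain_def
  proof (intro conjI allI impI)
    fix j t assume j: "j < 2 * N" and t: "real j \<le> t * real (2 * N) \<and> t * real (2 * N) \<le> real (Suc j)"
    show "?g t \<in> U (?w j)"
    proof (cases "j < N")
      case True
      then have "real (Suc j) \<le> real N" by simp
      moreover have "2 * t * real N = t * real (2 * N)" by simp
      ultimately have "2 * t * real N \<le> real N" using t by linarith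
      then have "2 * t \<le> 1" using N mult_right_le_imp_le[of "2 * t" "real N" 1] by force
      then have "t \<le> 1/2" by simp
      moreover have "p (2 * t) \<in> U (a j)"
        using a t True unfolding chain_def \<open>2 * t * real N = t * real (2 * N)\<close> by simp
      ultimately show ?thesis using True by (simp add: joinpaths_def)
    next
      case False
      then have "real N \<le> real j" by simp
      moreover have "2 * t * real N = t * real (2 * N)" by simp
      ultimately have "real N \<le> 2 * t * real N" using t by linarith
      then have "1 \<le> 2 * t" using N mult_right_le_imp_le[of 1 "real N" "2 * t"] by force
      then have t2: "1/2 \<le> t" by simp
      have "real (j - N) \<le> (2 * t - 1) * real N" "(2 * t - 1) * real N \<le> real (Suc (j - N))"
        using False t by (auto simp: algebra_simps of_nat_diff)
      then have *: "q (2 * t - 1) \<in> U (b (j - N))"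
        using b j False unfolding chain_def by auto
      show ?thesis
      \<comment> \<open>At the midpoint \<open>p +++ q\<close> evaluates \<open>p\<close>, while the
        label there belongs to \<open>q\<close>; the two values agree by \<open>pq\<close>.\<close>
      proof (cases "t = 1/2")
        case True
        have "?g t = q (2 * t - 1)" unfolding True using pq by (simp add: joinpaths_def)
        then show ?thesis using * False by simp
      next
        case ne: False
        then show ?thesis using * False t2 by (simp add: joinpaths_def)
      qed
    qed
  qed (use N in auto)
  have w1: "walk ?g ?w j = walk p a j" if "j < N" for j
    using that by (induct j) (auto simp: joinpaths_def)
  note e = chain_ends[OF a] chain_ends[OF b]
  have cl: "walk p a (N - 1) \<in> carrier Q" "\<phi> (a (N - 1)) (sel (p 1)) \<in> carrier Q"
     "\<phi> (sel (q 0)) (b 0) \<in> carrier Q"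
    using N e sel_U[OF e(2)] sel_U[OF e(3)]
    by (auto intro: walk_closed[OF a] \<phi>_closed[of "p 1"] \<phi>_closed[of "q 0"])
  have w2: "walk ?g ?w (N + j) = word p N a \<otimes> walk q b j" if "j < N" for j
    using that
  proof (induct j)
    case 0
    obtain N' where N': "N = Suc N'" using N by (cases N) auto
    have "walk ?g ?w N = walk p a (N - 1) \<otimes> \<phi> (a (N - 1)) (b 0)"
      using w1[of N'] N' by simp
    \<comment> \<open>The transition across the junction factors through the preferred member at
      \<open>p 1\<close>: one factor closes the word of \<open>p\<close>, the other opens the word
      of \<open>q\<close>.\<close>
    also have "\<phi> (a (N - 1)) (b 0) = \<phi> (a (N - 1)) (sel (p 1)) \<otimes> \<phi> (sel (p 1)) (b 0)"
      using e pq by (intro cocycle[of "p 1", symmetric]) (auto intro: sel_U)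
    finally show ?case using cl pq by (simp add: word_def m_assoc)
  next
    case (Suc j)
    have "\<phi> (b j) (b (Suc j)) \<in> carrier Q" "walk q b j \<in> carrier Q"
      using chain_node[OF b Suc.prems] Suc.prems by (auto intro: \<phi>_closed walk_closed[OF b])
    then show ?case using Suc word_closed[OF a] by (simp add: m_assoc Suc_diff_le)
  qed
  have "2 * N - 1 = N + (N - 1)" "\<not> 2 * N - 1 < N" using N by auto
  then have "word ?g (2 * N) ?w = word p N a \<otimes> walk q b (N - 1) \<otimes> \<phi> (b (N - 1)) (sel (q 1))"
    using w2[of "N - 1"] N by (simp add: word_def joinpaths_def)
  also have "\<dots> = word p N a \<otimes> word q N b"
    using word_closed[OF a] walk_closed[OF b, of "N - 1"] N e
    by (simp add: word_def m_assoc \<phi>_closed[of "q 1"] sel_U)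
  finally show ?thesis
    unfolding hol_eq[OF g] hol_eq[OF a] hol_eq[OF b] .
qed

lemma path_functor_hol: "path_functor Q Y hol"
  by unfold_locales (auto simp: hol_closed hol_homotopic hol_join)

end

text \<open>In a commutative group the pointwise product of two cocycles is a cocycle, and along a
  chain that serves all three the factors can be regrouped. This is the source of additivity in the
  coefficient.\<close>

lemma hol_mult:
  assumes Q: "comm_group Q"
    and "cech_cocycle Q Y U sel \<phi>" "cech_cocycle Q Y U sel \<psi>"
    and eq: "\<And>u v y. y \<in> U u \<Longrightarrow> y \<in> U v \<Longrightarrow> \<rho> u v = \<phi> u v \<otimes>\<^bsub>Q\<^esub> \<psi> u v"
    and g: "pathin Y g"
  shows "cech_cocycle.hol Q U sel \<rho> g =
    cech_cocycle.hol Q U sel \<phi> g \<otimes>\<^bsub>Q\<^esub> cech_cocycle.hol Q U sel \<psi> g"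
proof -
  interpret Q: comm_group Q by fact
  interpret A: cech_cocycle Q Y U sel \<phi> by fact
  interpret B: cech_cocycle Q Y U sel \<psi> by fact
  interpret C: cech_cocycle Q Y U sel \<rho>
  proof unfold_locales
    fix y u v w assume y: "y \<in> U u" "y \<in> U v" "y \<in> U w"
    have "\<phi> u v \<otimes>\<^bsub>Q\<^esub> \<psi> u v \<otimes>\<^bsub>Q\<^esub> (\<phi> v w \<otimes>\<^bsub>Q\<^esub> \<psi> v w) = (\<phi> u v \<otimes>\<^bsub>Q\<^esub> \<phi> v w) \<otimes>\<^bsub>Q\<^esub> (\<psi> u v \<otimes>\<^bsub>Q\<^esub> \<psi> v w)"
      using y by (simp add: Q.m_ac A.\<phi>_closed[of y] B.\<phi>_closed[of y])
    then show "\<rho> u v \<otimes>\<^bsub>Q\<^esub> \<rho> v w = \<rho> u w"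
      using y by (simp add: eq[of y] A.cocycle[of y] B.cocycle[of y])
  qed (auto simp: eq A.U_open A.sel intro: A.\<phi>_closed B.\<phi>_closed)
  obtain n w where a: "A.chain g n w" using A.chain_exists[OF g] .
  have b: "B.chain g n w" and c: "C.chain g n w"
    using a by (simp_all add: A.chain_def B.chain_def C.chain_def)
  have n: "n - 1 < n" using a by (simp add: A.chain_def)
  have "C.walk g w j = A.walk g w j \<otimes>\<^bsub>Q\<^esub> B.walk g w j" if "j < n" for j
    using that
  proof (induct j)
    case 0
    then show ?case using A.chain_ends(1)[OF a] by (simp add: eq[of "g 0"] A.sel_U)
  next
    case (Suc j)
    note y = A.chain_node[OF a Suc.prems]
    show ?case
      using Suc A.walk_closed[OF a, of j] B.walk_closed[OF b, of j] y
      by (simp add: eq[OF y] Q.m_ac A.\<phi>_closed[OF y] B.\<phi>_closed[OF y])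
  qed
  from this[OF n] show ?thesis
    using A.walk_closed[OF a n] B.walk_closed[OF b n] A.chain_ends(2)[OF a] A.sel_U[OF A.chain_ends(2)[OF a]]
    unfolding A.hol_eq[OF a] B.hol_eq[OF b] C.hol_eq[OF c] A.word_def B.word_def C.word_def
    by (simp add: eq[of "g 1"] Q.m_ac A.\<phi>_closed[of "g 1"] B.\<phi>_closed[of "g 1"])
qed

section \<open>Arc length\<close>

fun polygon_length :: "(real \<Rightarrow> 'a::metric_space) \<Rightarrow> real list \<Rightarrow> real" where
  "polygon_length g (x # y # zs) = dist (g x) (g y) + polygon_length g (y # zs)"
| "polygon_length g _ = 0"

text \<open>Length of the part of \<open>g\<close> over the interval from \<open>a\<close> to
  \<open>c\<close>. Measuring subarcs in place, without reparametrizing, makes additivity a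
  statement about splitting lists.\<close>

definition arc_length :: "(real \<Rightarrow> 'a::metric_space) \<Rightarrow> real \<Rightarrow> real \<Rightarrow> ereal" where
  "arc_length g a c = (SUP ts \<in> {ts. sorted ts \<and> set ts \<subseteq> {a..c}}. ereal (polygon_length g ts))"

lemma sum_polygon_length:
  "(\<Sum>i<length ts - 1. dist (g (ts ! i)) (g (ts ! Suc i))) = polygon_length g ts"
proof (induct g ts rule: polygon_length.induct)
  case (1 g x y zs)
  then show ?case by (simp add: sum.lessThan_Suc_shift del: sum.lessThan_Suc)
qed auto

lemma path_length_arc: "path_length g = arc_length g 0 1"
  unfolding path_length_def arc_length_def sum_polygon_length ..

lemma polygon_length_append:
  "polygon_length g (xs @ x # ys) = polygon_length g (xs @ [x]) + polygon_length g (x # ys)"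
proof (induct xs)
  case (Cons a xs)
  then show ?case by (cases xs) auto
qed simp

lemma polygon_length_Cons_le: "polygon_length g ys \<le> polygon_length g (x # ys)"
  by (cases ys) auto

lemma polygon_length_insert: "polygon_length g (xs @ ys) \<le> polygon_length g (xs @ x # ys)"
proof (induct xs)
  case Nil
  then show ?case by (simp add: polygon_length_Cons_le)
next
  case (Cons a xs)
  show ?case
  proof (cases xs)
    case Nil
    then show ?thesis
    proof (cases ys)
      case (Cons y zs)
      then show ?thesis using Nil dist_triangle[of "g a" "g y" "g x"] by simp
    qed simp
  qed (use Cons in auto)
qed

lemma polygon_length_bound:
  fixes e :: real
  assumes "\<And>s t. s \<in> set xs \<Longrightarrow> t \<in> set xs \<Longrightarrow> dist (g s) (g t) \<le> e" "0 \<le> e"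
  shows "polygon_length g xs \<le> length xs * e"
  using assms
proof (induct g xs rule: polygon_length.induct)
  case (1 g x y zs)
  then have "polygon_length g (y # zs) \<le> length (y # zs) * e" by auto
  moreover have "dist (g x) (g y) \<le> e" using 1 by auto
  ultimately show ?case by (simp add: algebra_simps)
qed auto

lemma polygon_length_cong:
  "(\<And>t. t \<in> set ts \<Longrightarrow> g t = h (f t)) \<Longrightarrow> polygon_length g ts = polygon_length h (map f ts)"
  by (induct g ts rule: polygon_length.induct) auto

lemma polygon_length_rev: "polygon_length g (rev ts) = polygon_length g ts"
proof (induct g ts rule: polygon_length.induct)
  case (1 g x y zs)
  then show ?case using polygon_length_append[of g "rev zs" y "[x]"] by (simp add: dist_commute)
qed auto

lemma arc_length_upper:
  "sorted ts \<Longrightarrow> set ts \<subseteq> {a..c} \<Longrightarrow> ereal (polygon_length g ts) \<le> arc_length g a c"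
  unfolding arc_length_def by (rule SUP_upper) auto

lemma arc_length_least:
  "(\<And>ts. sorted ts \<Longrightarrow> set ts \<subseteq> {a..c} \<Longrightarrow> ereal (polygon_length g ts) \<le> L) \<Longrightarrow> arc_length g a c \<le> L"
  unfolding arc_length_def by (rule SUP_least) auto

lemma arc_length_nonneg: "0 \<le> arc_length g a c"
  using arc_length_upper[of "[]" a c g] by (simp add: zero_ereal_def)

lemma dist_le_arc_length:
  assumes "s \<in> {a..c}" "t \<in> {a..c}"
  shows "ereal (dist (g s) (g t)) \<le> arc_length g a c"
proof (cases "s \<le> t")
  case True
  then show ?thesis using arc_length_upper[of "[s, t]" a c g] assms by simp
next
  case False
  then show ?thesis using arc_length_upper[of "[t, s]" a c g] assms by (simp add: dist_commute)
qed

lemma sorted_split: "sorted ts \<Longrightarrow> ts = filter (\<lambda>t. t < a) ts @ filter (\<lambda>t. \<not> t < a) ts" for a :: real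
proof (induct ts)
  case (Cons x ts)
  show ?case
  proof (cases "x < a")
    case False
    then have "filter (\<lambda>t. t < a) ts = []" "filter (\<lambda>t. \<not> t < a) ts = ts"
      using Cons(2) by (auto simp: filter_empty_conv filter_id_conv)
    then show ?thesis using False by simp
  qed (use Cons in auto)
qed simp

lemma polygon_length_split:
  "sorted ts \<Longrightarrow> polygon_length g ts \<le>
     polygon_length g (filter (\<lambda>t. t < a) ts @ [a]) + polygon_length g (a # filter (\<lambda>t. \<not> t < a) ts)"
  using polygon_length_insert[of g "filter (\<lambda>t. t < a) ts" "filter (\<lambda>t. \<not> t < a) ts" a]
  by (simp add: polygon_length_append[of g _ a "filter (\<lambda>t. \<not> t < a) ts"] flip: sorted_split)

text \<open>Inserting \<open>b\<close> into a subdivision does not shorten the polygon, which gives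
  one inequality; subdivisions of the two halves joined through \<open>b\<close> give the
  other.\<close>

lemma arc_length_split:
  assumes "a \<le> b" "b \<le> c"
  shows "arc_length g a c = arc_length g a b + arc_length g b c"
proof (rule antisym)
  show "arc_length g a c \<le> arc_length g a b + arc_length g b c"
  proof (rule arc_length_least)
    fix ts assume ts: "sorted ts" "set ts \<subseteq> {a..c}"
    let ?x = "filter (\<lambda>t. t < b) ts @ [b]" and ?y = "b # filter (\<lambda>t. \<not> t < b) ts"
    have "ereal (polygon_length g ?x) \<le> arc_length g a b"
      using ts assms by (intro arc_length_upper) (auto simp: sorted_append sorted_wrt_filter)
    moreover have "ereal (polygon_length g ?y) \<le> arc_length g b c"
      using ts assms by (intro arc_length_upper) (auto simp: sorted_wrt_filter)
    ultimately have "ereal (polygon_length g ?x) + ereal (polygon_length g ?y) \<le> arc_length g a b + arc_length g b c"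
      by (rule add_mono)
    then show "ereal (polygon_length g ts) \<le> arc_length g a b + arc_length g b c"
      using polygon_length_split[OF ts(1), of g b] by (auto intro: order_trans[rotated])
  qed
  have one: "ereal (polygon_length g ts) + ereal (polygon_length g us) \<le> arc_length g a c"
    if "sorted ts" "set ts \<subseteq> {a..b}" "sorted us" "set us \<subseteq> {b..c}" for ts us
  proof -
    have "polygon_length g ts + polygon_length g us \<le> polygon_length g (ts @ [b]) + polygon_length g (b # us)"
      using polygon_length_insert[of g ts "[]" b] polygon_length_Cons_le[of g us b] by simp
    also have "\<dots> = polygon_length g (ts @ b # us)" by (rule polygon_length_append[symmetric])
    finally have "ereal (polygon_length g ts + polygon_length g us) \<le> ereal (polygon_length g (ts @ b # us))"
      by simp
    also have "\<dots> \<le> arc_length g a c"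
      by (rule arc_length_upper) (use that assms in \<open>fastforce simp: sorted_append\<close>)+
    finally show ?thesis by simp
  qed
  let ?S = "\<lambda>a c. {ts::real list. sorted ts \<and> set ts \<subseteq> {a..c}}"
  have ne: "?S x y \<noteq> {}" for x y :: real
    by (auto intro: exI[of _ "[]"])
  \<comment> \<open>The two suprema are moved out of the sum one after the other; for extended reals
    this needs nonempty index sets, which the empty subdivision provides.\<close>
  have "ereal (polygon_length g ts) + arc_length g b c \<le> arc_length g a c" if "ts \<in> ?S a b" for ts
    unfolding arc_length_def[of g b c]
    by (subst SUP_ereal_add_right[symmetric], rule ne, simp, rule SUP_least, rule one) (use that in auto)
  then have *: "(SUP ts\<in>?S a b. ereal (polygon_length g ts) + arc_length g b c) \<le> arc_length g a c"
    by (intro SUP_least) auto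
  show "arc_length g a b + arc_length g b c \<le> arc_length g a c"
    unfolding arc_length_def[of g a b] using *
    by (subst SUP_ereal_add_left[symmetric]) (use ne arc_length_nonneg[of g b c] in auto)
qed

lemma arc_length_mono:
  assumes "a \<le> a'" "c' \<le> c"
  shows "arc_length g a' c' \<le> arc_length g a c"
  by (rule arc_length_least, rule arc_length_upper) (use assms in auto)

lemma path_length_restrict_path:
  assumes "a \<le> c"
  shows "path_length (restrict_path a c g) \<le> arc_length g a c"
  unfolding path_length_arc
proof (rule arc_length_least)
  fix ts :: "real list" assume ts: "sorted ts" "set ts \<subseteq> {0..1}"
  have "polygon_length (restrict_path a c g) ts = polygon_length g (map (\<lambda>t. (c - a) * t + a) ts)"
    by (rule polygon_length_cong) (simp add: restrict_path_def)
  also have "ereal \<dots> \<le> arc_length g a c"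
  proof (rule arc_length_upper)
    show "sorted (map (\<lambda>t. (c - a) * t + a) ts)"
      unfolding sorted_map
      by (rule sorted_wrt_mono_rel[OF _ ts(1)]) (use assms in \<open>auto intro: mult_left_mono\<close>)
    show "set (map (\<lambda>t. (c - a) * t + a) ts) \<subseteq> {a..c}"
    proof
      fix s assume "s \<in> set (map (\<lambda>t. (c - a) * t + a) ts)"
      then obtain t where t: "t \<in> set ts" "s = (c - a) * t + a" by auto
      then have "0 \<le> t" "t \<le> 1" using ts by auto
      then have "0 \<le> (c - a) * t" "(c - a) * t \<le> c - a" using assms by (auto simp: mult_left_le)
      then show "s \<in> {a..c}" using t by simp
    qed
  qed
  finally show "ereal (polygon_length (restrict_path a c g) ts) \<le> arc_length g a c" .
qed

lemma path_length_join:
  assumes pq: "p 1 = q 0"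
  shows "path_length (p +++ q) \<le> path_length p + path_length q"
proof -
  have "arc_length (p +++ q) 0 (1/2) \<le> arc_length p 0 1"
  proof (rule arc_length_least)
    fix ts :: "real list" assume ts: "sorted ts" "set ts \<subseteq> {0..1/2}"
    have "polygon_length (p +++ q) ts = polygon_length p (map (\<lambda>t. 2 * t) ts)"
      by (rule polygon_length_cong) (use ts in \<open>auto simp: joinpaths_def\<close>)
    also have "ereal \<dots> \<le> arc_length p 0 1"
    proof (rule arc_length_upper)
      show "sorted (map (\<lambda>t. 2 * t) ts)"
        unfolding sorted_map by (rule sorted_wrt_mono_rel[OF _ ts(1)]) auto
    qed (use ts in auto)
    finally show "ereal (polygon_length (p +++ q) ts) \<le> arc_length p 0 1" .
  qed
  moreover have "arc_length (p +++ q) (1/2) 1 \<le> arc_length q 0 1"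
  proof (rule arc_length_least)
    fix ts :: "real list" assume ts: "sorted ts" "set ts \<subseteq> {1/2..1}"
    have "polygon_length (p +++ q) ts = polygon_length q (map (\<lambda>t. 2 * t - 1) ts)"
    proof (rule polygon_length_cong)
      fix t assume "t \<in> set ts"
      then have "1/2 \<le> t" using ts by auto
      then show "(p +++ q) t = q (2 * t - 1)"
      proof (cases "t = 1/2")
        case True
        show ?thesis unfolding True using pq by (simp add: joinpaths_def)
      qed (auto simp: joinpaths_def)
    qed
    also have "ereal \<dots> \<le> arc_length q 0 1"
    proof (rule arc_length_upper)
      show "sorted (map (\<lambda>t. 2 * t - 1) ts)"
        unfolding sorted_map by (rule sorted_wrt_mono_rel[OF _ ts(1)]) auto
    qed (use ts in auto)
    finally show "ereal (polygon_length (p +++ q) ts) \<le> arc_length q 0 1" .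
  qed
  ultimately show ?thesis
    unfolding path_length_arc using arc_length_split[of 0 "1/2" 1 "p +++ q"] by (simp add: add_mono)
qed

lemma path_length_reversepath: "path_length (reversepath p) \<le> path_length p"
  unfolding path_length_arc
proof (rule arc_length_least)
  fix ts :: "real list" assume ts: "sorted ts" "set ts \<subseteq> {0..1}"
  have "polygon_length (reversepath p) ts = polygon_length p (map (\<lambda>t. 1 - t) ts)"
    by (rule polygon_length_cong) (simp add: reversepath_def)
  also have "\<dots> = polygon_length p (rev (map (\<lambda>t. 1 - t) ts))"
    by (rule polygon_length_rev[symmetric])
  also have "ereal \<dots> \<le> arc_length p 0 1"
  proof (rule arc_length_upper)
    show "sorted (rev (map (\<lambda>t. 1 - t) ts))"
      unfolding sorted_wrt_rev sorted_wrt_map by (rule sorted_wrt_mono_rel[OF _ ts(1)]) auto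
  qed (use ts in auto)
  finally show "ereal (polygon_length (reversepath p) ts) \<le> arc_length p 0 1" .
qed

lemma path_length_const: "path_length (\<lambda>_. a) = 0"
proof -
  have "polygon_length (\<lambda>_. a) ts = 0" for ts
    by (induct "\<lambda>_::real. a" ts rule: polygon_length.induct) auto
  then have "path_length (\<lambda>_. a) \<le> 0"
    unfolding path_length_arc by (intro arc_length_least) simp
  then show ?thesis using arc_length_nonneg by (metis antisym path_length_arc)
qed

text \<open>Finite length makes short parameter intervals short in length, not only in diameter. A
  fixed polygon nearly exhausts the total length; a short interval carries little of this polygon,
  by uniform continuity and its bounded number of vertices, and the curve cannot exceed the polygon
  by much on any part.\<close>

lemma arc_length_small:
  fixes g :: "real \<Rightarrow> 'a::metric_space"
  assumes g: "path g" and fin: "path_length g < \<infinity>" and e: "0 < e"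
  obtains \<delta> where "0 < \<delta>" "\<And>a c. 0 \<le> a \<Longrightarrow> a \<le> c \<Longrightarrow> c \<le> 1 \<Longrightarrow> c - a < \<delta> \<Longrightarrow> arc_length g a c < ereal e"
proof -
  obtain L where L: "arc_length g 0 1 = ereal L"
    using fin arc_length_nonneg[of g 0 1] unfolding path_length_arc
    by (cases "arc_length g 0 1") auto
  have "ereal (L - e / 2) < arc_length g 0 1" using L e by simp
  then obtain ts where ts: "sorted ts" "set ts \<subseteq> {0..1}" "L - e / 2 < polygon_length g ts"
    unfolding arc_length_def by (auto simp: less_SUP_iff)
  \<comment> \<open>The polygon inside the interval has at most the old vertices together with
    \<open>a\<close> and \<open>c\<close>, so steps bounded by \<eta> contribute at most half of
    \<open>e\<close>.\<close>
  define N where "N = real (length ts + 2)"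
  define \<eta> where "\<eta> = e / (2 * N)"
  have N: "0 < N" and \<eta>: "0 < \<eta>" using e by (auto simp: N_def \<eta>_def)
  have "uniformly_continuous_on {0..1} g"
    using g by (simp add: path_def compact_uniformly_continuous)
  then obtain \<delta> where \<delta>: "0 < \<delta>" "\<And>s t. s \<in> {0..1} \<Longrightarrow> t \<in> {0..1} \<Longrightarrow> dist s t < \<delta> \<Longrightarrow> dist (g s) (g t) < \<eta>"
    using \<eta> unfolding uniformly_continuous_on_def by metis
  show thesis
  proof (rule that[OF \<delta>(1)])
    fix a c :: real assume ac: "0 \<le> a" "a \<le> c" "c \<le> 1" "c - a < \<delta>"
    let ?l = "filter (\<lambda>t. t < a) ts" and ?r = "filter (\<lambda>t. \<not> t < a) ts"
    let ?m = "a # filter (\<lambda>t. t < c) ?r @ [c]" and ?u = "c # filter (\<lambda>t. \<not> t < c) ?r"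
    have r: "sorted ?r" using ts by (simp add: sorted_wrt_filter)
    have "polygon_length g (a # ?r) \<le> polygon_length g ?m + polygon_length g ?u"
      using polygon_length_insert[of g "a # filter (\<lambda>t. t < c) ?r" "filter (\<lambda>t. \<not> t < c) ?r" c]
        polygon_length_append[of g "a # filter (\<lambda>t. t < c) ?r" c "filter (\<lambda>t. \<not> t < c) ?r"]
        sorted_split[OF r, of c]
      by simp
    then have 1: "polygon_length g ts \<le> polygon_length g (?l @ [a]) + polygon_length g ?m + polygon_length g ?u"
      using polygon_length_split[OF ts(1), of g a] by linarith
    have "polygon_length g ?m \<le> length ?m * \<eta>"
    proof (rule polygon_length_bound)
      fix s t assume "s \<in> set ?m" "t \<in> set ?m"
      then have "s \<in> {a..c}" "t \<in> {a..c}" using ac by auto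
      then show "dist (g s) (g t) \<le> \<eta>"
        using ac by (intro less_imp_le \<delta>(2)) (auto simp: dist_real_def)
    qed (use \<eta> in simp)
    also have "length ?m \<le> length ts + 2"
      by (simp add: le_trans[OF length_filter_le length_filter_le])
    then have "real (length ?m) \<le> N" unfolding N_def by linarith
    then have "length ?m * \<eta> \<le> N * \<eta>" using \<eta> by (intro mult_right_mono) auto
    also have "N * \<eta> = e / 2" using N by (simp add: \<eta>_def)
    finally have 2: "polygon_length g ?m \<le> e / 2" .
    have "ereal (polygon_length g (?l @ [a])) \<le> arc_length g 0 a"
      by (rule arc_length_upper) (use ts ac in \<open>auto simp: sorted_append sorted_wrt_filter\<close>)
    moreover have "ereal (polygon_length g ?u) \<le> arc_length g c 1"
      by (rule arc_length_upper) (use ts ac in \<open>auto simp: sorted_wrt_filter\<close>)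
    moreover have "arc_length g 0 a + arc_length g a c + arc_length g c 1 = ereal L"
      using arc_length_split[of 0 a 1 g] arc_length_split[of a c 1 g] ac L by (simp add: add.assoc)
    \<comment> \<open>Subtracting the outer polygons from \<open>L\<close> bounds the inner arc by
      the inner polygon plus the defect of \<open>ts\<close>, each worth at most
      \<open>e / 2\<close>, the latter strictly less.\<close>
    ultimately have "ereal (polygon_length g (?l @ [a])) + arc_length g a c + ereal (polygon_length g ?u) \<le> ereal L"
      by (metis add_mono order_refl)
    then show "arc_length g a c < ereal e"
      using 1 2 ts(3) by (cases "arc_length g a c") auto
  qed
qed

lemma arc_length_finite:
  assumes "path_length g < \<infinity>" "0 \<le> a" "c \<le> 1"
  shows "arc_length g a c \<noteq> \<infinity>" "arc_length g a c \<noteq> - \<infinity>"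
  using arc_length_mono[of 0 a c 1 g] assms arc_length_nonneg[of g a c]
  unfolding path_length_arc by auto

lemma uniform_small_pieces:
  assumes g: "path g" and fin: "path_length g < \<infinity>" and r: "0 < r"
  obtains n where "0 < n"
    "\<And>j. j < n \<Longrightarrow> path_length (restrict_path (real j / real n) (real (Suc j) / real n) g) < ereal r"
proof -
  obtain \<delta> where \<delta>: "0 < \<delta>" "\<And>a c. 0 \<le> a \<Longrightarrow> a \<le> c \<Longrightarrow> c \<le> 1 \<Longrightarrow> c - a < \<delta> \<Longrightarrow> arc_length g a c < ereal r"
    using arc_length_small[OF g fin r] by blast
  obtain n where n: "inverse (real (Suc n)) < \<delta>" using reals_Archimedean[OF \<delta>(1)] by blast
  show thesis
  proof (rule that[of "Suc n"])
    fix j assume j: "j < Suc n"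
    have len: "real (Suc j) / real (Suc n) = real j / real (Suc n) + inverse (real (Suc n))"
      by (simp add: field_simps)
    have le: "real j / real (Suc n) \<le> real (Suc j) / real (Suc n)" by (simp add: divide_right_mono)
    have "arc_length g (real j / real (Suc n)) (real (Suc j) / real (Suc n)) < ereal r"
      by (rule \<delta>(2)[OF _ le]) (use j n len in \<open>auto simp: field_simps\<close>)
    then show "path_length (restrict_path (real j / real (Suc n)) (real (Suc j) / real (Suc n)) g) < ereal r"
      using path_length_restrict_path[OF le, of g] by simp
  qed simp
qed

text \<open>The length of the initial arc is a continuous function of its end parameter, by
  \<open>arc_length_small\<close>. It therefore takes the values one third and two thirds of the
  total length.\<close>

lemma trisect_path:
  assumes g: "path g" and len: "path_length g < ereal (3 * r)"
  obtains s t where "0 \<le> s" "s \<le> t" "t \<le> 1"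
    "arc_length g 0 s < ereal r" "arc_length g s t < ereal r" "arc_length g t 1 < ereal r"
proof -
  have fin: "path_length g < \<infinity>" using len by (cases "path_length g") auto
  \<comment> \<open>Finite length makes the conversion to reals faithful, so that arc lengths become
    differences of values of \<open>f\<close>.\<close>
  define f where "f t = real_of_ereal (arc_length g 0 t)" for t
  have f: "arc_length g a c = ereal (f c - f a)" if "0 \<le> a" "a \<le> c" "c \<le> 1" for a c
  proof -
    have "arc_length g 0 c = arc_length g 0 a + arc_length g a c"
      using that by (intro arc_length_split)
    then show ?thesis
      using arc_length_finite[OF fin, of 0 a] arc_length_finite[OF fin, of a c] arc_length_finite[OF fin, of 0 c] that
      unfolding f_def by (cases "arc_length g 0 c"; cases "arc_length g 0 a"; cases "arc_length g a c") auto
  qed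
  have f0: "f 0 = 0"
  proof -
    have "arc_length g 0 0 = ereal 0" using f[of 0 0] by simp
    then show ?thesis unfolding f_def by simp
  qed
  have mono: "f a \<le> f c" if "0 \<le> a" "a \<le> c" "c \<le> 1" for a c
    using f[OF that] arc_length_nonneg[of g a c] by simp
  have cont: "continuous_on {0..1} f"
    unfolding continuous_on_iff
  proof (intro ballI allI impI)
    fix x e :: real assume x: "x \<in> {0..1}" and e: "0 < e"
    obtain \<delta> where \<delta>: "0 < \<delta>" "\<And>a c. 0 \<le> a \<Longrightarrow> a \<le> c \<Longrightarrow> c \<le> 1 \<Longrightarrow> c - a < \<delta> \<Longrightarrow> arc_length g a c < ereal e"
      using arc_length_small[OF g fin e] by blast
    show "\<exists>d>0. \<forall>y\<in>{0..1}. dist y x < d \<longrightarrow> dist (f y) (f x) < e"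
    proof (intro exI[of _ \<delta>] conjI ballI impI \<delta>(1))
      fix y assume y: "y \<in> {0..1}" "dist y x < \<delta>"
      show "dist (f y) (f x) < e"
      proof (cases "x \<le> y")
        case True
        then show ?thesis using \<delta>(2)[of x y] f[of x y] mono[of x y] x y by (auto simp: dist_real_def)
      next
        case False
        then show ?thesis using \<delta>(2)[of y x] f[of y x] mono[of y x] x y by (auto simp: dist_real_def)
      qed
    qed
  qed
  define L where "L = f 1"
  have L: "0 \<le> L" "L < 3 * r" using mono[of 0 1] f0 f[of 0 1] len by (auto simp: L_def path_length_arc)
  have "\<exists>s\<ge>0. s \<le> 1 \<and> f s = L / 3"
    by (rule IVT'[OF _ _ _ cont]) (use L f0 in \<open>auto simp: L_def\<close>)
  then obtain s where s: "0 \<le> s" "s \<le> 1" "f s = L / 3" by blast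
  have "\<exists>t\<ge>s. t \<le> 1 \<and> f t = 2 * L / 3"
    by (rule IVT') (use L s cont in \<open>auto simp: L_def intro: continuous_on_subset\<close>)
  then obtain t where t: "s \<le> t" "t \<le> 1" "f t = 2 * L / 3" by blast
  show thesis
  proof (rule that[OF s(1) t(1,2)])
    show "arc_length g 0 s < ereal r" "arc_length g s t < ereal r" "arc_length g t 1 < ereal r"
      using f[of 0 s] f[of s t] f[of t 1] s t L f0 by (auto simp: L_def)
  qed
qed

lemma geodesicD:
  assumes "geodesic x y g"
  shows "path g" "g 0 = x" "g 1 = y" "path_length g = ereal (dist x y)"
    "\<And>s t. 0 \<le> s \<Longrightarrow> s \<le> 1 \<Longrightarrow> 0 \<le> t \<Longrightarrow> t \<le> 1 \<Longrightarrow> dist (g s) (g t) \<le> dist x y"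
  using assms dist_le_arc_length[of _ 0 1 _ g] unfolding geodesic_def path_length_arc
  by (auto simp: pathstart_def pathfinish_def)

section \<open>Geometric realizations\<close>

lemma closed_closed_simplex: "closed (closed_simplex s)"
proof -
  have c: "continuous_on UNIV (\<lambda>f::'a \<Rightarrow> real. f v)" for v by simp
  show ?thesis
    unfolding closed_simplex_def
    by (intro closed_Collect_conj closed_Collect_all closed_Collect_imp closed_Collect_le closed_Collect_eq
        continuous_on_sum continuous_on_const c) auto
qed

lemma finite_closed_fun: "finite D \<Longrightarrow> closed D" for D :: "('v \<Rightarrow> real) set"
proof (induct rule: finite_induct)
  case (insert f D)
  have "{f} = {h. \<forall>v. h v = f v}" by auto
  moreover have "closed {h. \<forall>v. h v = f v}"
    by (intro closed_Collect_all closed_Collect_eq continuous_on_const) simp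
  ultimately have "closed {f}" by simp
  then show ?case using insert closed_Un[of "{f}" D] by simp
qed simp

lemma topspace_realization: "topspace (realization K) = (\<Union>s\<in>K. closed_simplex s)"
proof -
  have "openin (realization K) (\<Union>s\<in>K. closed_simplex s)"
    unfolding openin_realization
  proof (intro conjI ballI)
    fix s assume "s \<in> K"
    then have "(\<Union>s\<in>K. closed_simplex s) \<inter> closed_simplex s = closed_simplex s" by blast
    then show "openin (subtopology (powertop_real UNIV) (closed_simplex s)) ((\<Union>s\<in>K. closed_simplex s) \<inter> closed_simplex s)"
      by (simp add: openin_subtopology_self euclidean_product_topology)
  qed auto
  moreover have "U \<subseteq> (\<Union>s\<in>K. closed_simplex s)" if "openin (realization K) U" for U
    using that by (simp add: openin_realization)
  ultimately show ?thesis
    unfolding topspace_def by blast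
qed

lemma closed_simplex_map:
  assumes "s \<in> K"
  shows "continuous_map (top_of_set (closed_simplex s)) (realization K) (\<lambda>f. f)"
  unfolding continuous_map topspace_realization
proof (intro conjI allI impI)
  show "(\<lambda>f. f) ` topspace (top_of_set (closed_simplex s)) \<subseteq> (\<Union>s\<in>K. closed_simplex s)"
    using assms by auto
  fix U assume "openin (realization K) U"
  then have "openin (top_of_set (closed_simplex s)) (U \<inter> closed_simplex s)"
    using assms by (simp add: openin_realization euclidean_product_topology)
  moreover have "{x \<in> topspace (top_of_set (closed_simplex s)). x \<in> U} = U \<inter> closed_simplex s" by auto
  ultimately show "openin (top_of_set (closed_simplex s)) {x \<in> topspace (top_of_set (closed_simplex s)). x \<in> U}"
    by simp
qed

text \<open>As long as the image stays in one closed simplex, continuity into the weak topology is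
  ordinary coordinatewise continuity.\<close>

lemma continuous_map_realization:
  assumes "s \<in> K" "continuous_on Z h" "h \<in> Z \<rightarrow> closed_simplex s"
  shows "continuous_map (top_of_set Z) (realization K) h"
  using continuous_map_compose[OF _ closed_simplex_map[OF assms(1)], of "top_of_set Z" h] assms(2,3)
  by (simp add: o_def continuous_map_in_subtopology image_subset_iff_funcset)

lemma continuous_map_realization_mono:
  assumes "K \<subseteq> L"
  shows "continuous_map (realization K) (realization L) (\<lambda>f. f)"
  unfolding continuous_map
proof (intro conjI allI impI)
  show "(\<lambda>f. f) ` topspace (realization K) \<subseteq> topspace (realization L)"
    using assms by (auto simp: topspace_realization)
  fix U assume U: "openin (realization L) U"
  have "{x \<in> topspace (realization K). x \<in> U} \<inter> closed_simplex s = U \<inter> closed_simplex s" if "s \<in> K" for s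
    using that by (auto simp: topspace_realization)
  then show "openin (realization K) {x \<in> topspace (realization K). x \<in> U}"
    unfolding openin_realization using U assms by (auto simp: topspace_realization openin_realization)
qed

text \<open>The weak topology is at least as fine as the product topology, hence barycentric
  coordinates are continuous. This gives open stars, and forgets the weak topology where only
  coordinates matter.\<close>

lemma continuous_on_realization_euclidean:
  "continuous_map (realization K) euclidean (\<lambda>f. f)"
  unfolding continuous_map
proof (intro conjI allI impI)
  fix U :: "('a \<Rightarrow> real) set" assume U: "openin euclidean U"
  have "{x \<in> topspace (realization K). x \<in> U} \<inter> closed_simplex s = U \<inter> closed_simplex s" if "s \<in> K" for s
    using that by (auto simp: topspace_realization)
  then show "openin (realization K) {x \<in> topspace (realization K). x \<in> U}"
    unfolding openin_realization using U
    by (auto simp: topspace_realization euclidean_product_topology openin_subtopology)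
qed auto

lemma pathin_realization_continuous: "pathin (realization K) p \<Longrightarrow> continuous_on {0..1} p"
  using continuous_map_compose[OF _ continuous_on_realization_euclidean, of "top_of_set {0..1}" K p]
  by (simp add: pathin_def o_def continuous_map_iff_continuous)

lemma closed_simplex_convex:
  assumes "f \<in> closed_simplex s" "g \<in> closed_simplex s" "0 \<le> t" "t \<le> 1"
  shows "(\<lambda>v. (1 - t) * f v + t * g v) \<in> closed_simplex s"
  using assms by (simp add: closed_simplex_def sum.distrib flip: sum_distrib_left)

lemma indicator_closed_simplex:
  assumes "finite s" "v \<in> s"
  shows "indicator {v} \<in> closed_simplex s"
proof -
  have "sum (indicator {v}) s = (\<Sum>x\<in>s. if x = v then 1 else 0 :: real)"
    by (rule sum.cong) (auto simp: indicator_def)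
  also have "\<dots> = 1" using assms by simp
  finally have "sum (indicator {v}) s = (1::real)" .
  moreover have "indicator {v} x = (0::real)" if "x \<notin> s" for x
    using that assms by (cases "x = v") auto
  ultimately show ?thesis
    unfolding closed_simplex_def mem_Collect_eq by (intro conjI allI impI indicator_pos_le)
qed

lemma continuous_on_coordinate_snd:
  fixes p :: "real \<Rightarrow> 'v \<Rightarrow> real" and A :: "'z::topological_space set"
  assumes "continuous_on {0..1} p"
  shows "continuous_on (A \<times> {0..1}) (\<lambda>z. p (snd z) v)"
proof -
  have c: "continuous_on {0..1} (\<lambda>t. p t v)"
    using assms by (rule continuous_on_product_then_coordinatewise)
  have "continuous_on (A \<times> {0..1}) ((\<lambda>t. p t v) \<circ> snd)"
  proof (rule continuous_on_compose)
    show "continuous_on (A \<times> {0..1}) (snd :: 'z \<times> real \<Rightarrow> real)"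
      using continuous_on_snd[OF continuous_on_id] by simp
    show "continuous_on (snd ` (A \<times> {0..1})) (\<lambda>t. p t v)"
      by (rule continuous_on_subset[OF c]) force
  qed
  then show ?thesis by (simp add: o_def)
qed

text \<open>The straight-line homotopy again, but carried out coordinate by coordinate: the ambient
  space of functions is not normed, so \<open>path_homotopic_convex\<close> does not apply.\<close>

lemma simplex_path_homotopic:
  assumes s: "s \<in> K" and p: "continuous_on {0..1} p" "p \<in> {0..1} \<rightarrow> closed_simplex s"
    and q: "continuous_on {0..1} q" "q \<in> {0..1} \<rightarrow> closed_simplex s" and "q 0 = p 0" "q 1 = p 1"
  shows "path_homotopic (realization K) p q"
proof (rule path_homotopicI)
  let ?H = "\<lambda>z v. (1 - fst z) * p (snd z) v + fst z * q (snd z) v"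
  show "continuous_map (top_of_set ({0..1} \<times> {0..1})) (realization K) ?H"
  proof (rule continuous_map_realization[OF s])
    show "continuous_on ({0..1} \<times> {0..1}) ?H"
      by (intro continuous_on_coordinatewise_then_product continuous_on_add continuous_on_mult
          continuous_on_diff continuous_on_const continuous_on_fst continuous_on_id
          continuous_on_coordinate_snd p(1) q(1))
    show "?H \<in> {0..1} \<times> {0..1} \<rightarrow> closed_simplex s"
    proof
      fix z :: "real \<times> real" assume "z \<in> {0..1} \<times> {0..1}"
      then show "?H z \<in> closed_simplex s"
        by (intro closed_simplex_convex funcset_mem[OF p(2)] funcset_mem[OF q(2)]) auto
    qed
  qed
qed (simp_all add: assms left_diff_distrib)

section \<open>Segments, supports and open stars\<close>

definition segment_to :: "('v \<Rightarrow> real) \<Rightarrow> 'v \<Rightarrow> real \<Rightarrow> 'v \<Rightarrow> real" where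
  "segment_to f w = (\<lambda>s v. (1 - s) * f v + s * indicator {w} v)"

lemma realization_edge_segment: "realization_edge x y = segment_to (indicator {x}) y"
  by (simp add: realization_edge_def segment_to_def)

lemma segment_to_ends [simp]: "segment_to f w 0 = f" "segment_to f w 1 = indicator {w}"
  by (auto simp: segment_to_def)

lemma continuous_on_segment_to: "continuous_on S (segment_to f w)"
  unfolding segment_to_def by (intro continuous_intros)

lemma realization_edge_ends [simp]:
  "realization_edge x y 0 = indicator {x}" "realization_edge x y 1 = indicator {y}"
  by (simp_all add: realization_edge_segment)

lemma segment_to_closed_simplex:
  assumes "f \<in> closed_simplex s" "w \<in> s" "finite s"
  shows "segment_to f w \<in> {0..1} \<rightarrow> closed_simplex s"
  unfolding segment_to_def using assms by (auto intro!: closed_simplex_convex indicator_closed_simplex)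

locale complex =
  fixes K :: "'v set set"
  assumes K_finite: "s \<in> K \<Longrightarrow> finite s" and K_nonempty: "s \<in> K \<Longrightarrow> s \<noteq> {}"
    and K_subset: "s \<in> K \<Longrightarrow> t \<subseteq> s \<Longrightarrow> t \<noteq> {} \<Longrightarrow> t \<in> K"
begin

definition star :: "'v \<Rightarrow> ('v \<Rightarrow> real) set" where
  "star w = {f \<in> topspace (realization K). 0 < f w}"

definition supp :: "('v \<Rightarrow> real) \<Rightarrow> 'v set" where "supp f = {v. f v \<noteq> 0}"

text \<open>The support is the smallest simplex containing the point; passing to it removes the
  dependence on the simplex through which the point was given.\<close>

lemma supp_simplex:
  assumes "f \<in> closed_simplex s" "s \<in> K"
  shows "supp f \<subseteq> s" "supp f \<in> K" "f \<in> closed_simplex (supp f)"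
proof -
  show s: "supp f \<subseteq> s" using assms by (auto simp: supp_def closed_simplex_def)
  have "supp f \<noteq> {}"
  proof
    assume "supp f = {}"
    then have "sum f s = 0" by (simp add: supp_def)
    then show False using assms by (simp add: closed_simplex_def)
  qed
  then show "supp f \<in> K" using K_subset assms s by blast
  have "sum f (supp f) = sum f s"
    using K_finite[OF assms(2)] s by (intro sum.mono_neutral_left) (auto simp: supp_def)
  then show "f \<in> closed_simplex (supp f)"
    using assms by (auto simp: closed_simplex_def supp_def)
qed

lemma supp_in_K:
  assumes "f \<in> topspace (realization K)"
  shows "supp f \<in> K" "finite (supp f)" "f \<in> closed_simplex (supp f)"
  using assms supp_simplex K_finite unfolding topspace_realization by blast+

lemma openin_star: "openin (realization K) (star w)"
proof -
  have "open {f :: 'v \<Rightarrow> real. 0 < f w}"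
    by (intro open_Collect_less continuous_on_const) simp
  moreover have "star w = {f \<in> topspace (realization K). f \<in> {f. 0 < f w}}"
    by (auto simp: star_def)
  ultimately show ?thesis
    using openin_continuous_map_preimage[OF continuous_on_realization_euclidean, of "{f. 0 < f w}"]
    by simp
qed

lemma star_supp: "f \<in> star w \<Longrightarrow> w \<in> supp f" "f \<in> star w \<Longrightarrow> f \<in> topspace (realization K)"
  by (auto simp: star_def supp_def)

text \<open>A common point of the stars has all the vertices in its support. Conditions on overlaps
  of stars thus become conditions on simplices with at most three vertices.\<close>

lemma star_simplex:
  assumes "f \<in> star u" "f \<in> star v" "f \<in> star w"
  shows "{u, v, w} \<in> K"
  using K_subset[OF supp_in_K(1)[OF star_supp(2)[OF assms(1)]], of "{u, v, w}"] assms star_supp by blast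

definition vertex_of :: "('v \<Rightarrow> real) \<Rightarrow> 'v" where "vertex_of f = (SOME v. 0 < f v)"

lemma star_vertex_of:
  assumes "f \<in> topspace (realization K)" shows "f \<in> star (vertex_of f)"
proof -
  obtain s where s: "s \<in> K" "f \<in> closed_simplex s" using assms by (auto simp: topspace_realization)
  have "\<exists>v. 0 < f v"
  proof (rule ccontr)
    assume "\<not> ?thesis"
    then have "f v = 0" for v using s by (auto simp: closed_simplex_def less_le)
    then show False using s by (simp add: closed_simplex_def)
  qed
  then show ?thesis
    using assms unfolding vertex_of_def star_def by (auto intro: someI_ex)
qed

text \<open>At a vertex the choice is forced, so holonomy along an edge path starts and ends at the
  vertices of the path itself.\<close>

lemma vertex_of_indicator [simp]: "vertex_of (indicator {v}) = v"
  unfolding vertex_of_def by (rule some_equality) (auto simp: indicator_def split: if_splits)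

lemma indicator_in_topspace: "{v} \<in> K \<Longrightarrow> indicator {v} \<in> topspace (realization K)"
  unfolding topspace_realization using indicator_closed_simplex[of "{v}" v] by blast

text \<open>Closedness in the weak topology is tested on closed simplices, and a finite set is
  closed there.\<close>

lemma closedin_realization_finite:
  assumes D: "D \<subseteq> topspace (realization K)" and fin: "\<And>s. s \<in> K \<Longrightarrow> finite (D \<inter> closed_simplex s)"
  shows "closedin (realization K) D"
  unfolding closedin_def openin_realization
proof (intro conjI ballI D)
  fix s assume s: "s \<in> K"
  have "(topspace (realization K) - D) \<inter> closed_simplex s = closed_simplex s - (D \<inter> closed_simplex s)"
    using s by (auto simp: topspace_realization)
  moreover have "closed (D \<inter> closed_simplex s)"
    using fin[OF s] by (rule finite_closed_fun)
  ultimately show "openin (subtopology (powertop_real UNIV) (closed_simplex s)) ((topspace (realization K) - D) \<inter> closed_simplex s)"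
    by (auto simp: euclidean_product_topology openin_open open_Compl intro!: exI[of _ "- (D \<inter> closed_simplex s)"])
qed (auto simp: topspace_realization)

text \<open>Choose one point of \<open>C\<close> for each support. A closed simplex contains at most
  one of them for each of its faces, so this set and all its subsets are closed; being discrete
  inside a compact set, it is finite.\<close>

lemma finite_supports:
  assumes C: "compactin (realization K) C"
  shows "finite (supp ` C)"
proof -
  define pick where "pick \<sigma> = (SOME f. f \<in> C \<and> supp f = \<sigma>)" for \<sigma>
  have pick: "pick \<sigma> \<in> C" "supp (pick \<sigma>) = \<sigma>" if "\<sigma> \<in> supp ` C" for \<sigma>
    using that someI_ex[of "\<lambda>f. f \<in> C \<and> supp f = \<sigma>"] unfolding pick_def by auto
  define D where "D = pick ` supp ` C"
  have CT: "C \<subseteq> topspace (realization K)" using C by (rule compactin_subset_topspace)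
  have D: "D \<subseteq> C" using pick by (auto simp: D_def)
  have fin: "finite (D \<inter> closed_simplex s)" if "s \<in> K" for s
  proof (rule finite_subset)
    show "D \<inter> closed_simplex s \<subseteq> pick ` Pow s"
    proof
      fix f assume f: "f \<in> D \<inter> closed_simplex s"
      then obtain \<sigma> where "\<sigma> \<in> supp ` C" "f = pick \<sigma>" by (auto simp: D_def)
      then show "f \<in> pick ` Pow s" using pick(2) supp_simplex(1)[of f s] f that by auto
    qed
  qed (use K_finite[OF that] in simp)
  have op: "openin (realization K) (topspace (realization K) - (D - {x}))" for x
  proof (rule openin_diff)
    show "closedin (realization K) (D - {x})"
      using D CT by (intro closedin_realization_finite) (auto intro: finite_subset[OF _ fin])
  qed simp
  \<comment> \<open>The member with index \<open>x\<close> omits every chosen point except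
    \<open>x\<close>, so a finite subcover leaves room for only finitely many of them.\<close>
  let ?\<U> = "(\<lambda>x. topspace (realization K) - (D - {x})) ` D"
  have "finite D"
  proof (cases "D = {}")
    case False
    then have "C \<subseteq> \<Union>?\<U>" using CT by blast
    then obtain \<F> where \<F>: "finite \<F>" "\<F> \<subseteq> ?\<U>" "C \<subseteq> \<Union>\<F>"
      using C op unfolding compactin_def by (metis (no_types, lifting) imageE)
    then obtain B where B: "finite B" "B \<subseteq> D" "\<F> = (\<lambda>x. topspace (realization K) - (D - {x})) ` B"
      by (meson finite_subset_image)
    have "D \<subseteq> B" using D \<F>(3) B(3) by blast
    then show ?thesis using B finite_subset by blast
  qed simp
  moreover have "supp ` D = supp ` C" using pick by (auto simp: D_def image_image)
  ultimately show ?thesis by (metis finite_imageI)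
qed

text \<open>Continuity into the weak topology is the point here: a path meets only finitely many open
  simplices, so the straight-line contraction takes place in a finite union of closed ones.\<close>

lemma star_contraction:
  assumes p: "pathin (realization K) p" and w: "\<And>t. 0 \<le> t \<Longrightarrow> t \<le> 1 \<Longrightarrow> p t \<in> star w"
  shows "continuous_map (top_of_set ({0..1} \<times> {0..1})) (realization K) (\<lambda>z. segment_to (p (snd z)) w (fst z))"
    (is "continuous_map ?S _ ?H")
proof -
  have cont: "continuous_on ({0..1} \<times> {0..1}) ?H"
    unfolding segment_to_def
    by (intro continuous_on_coordinatewise_then_product continuous_on_add continuous_on_mult
        continuous_on_diff continuous_on_const continuous_on_fst continuous_on_id
        continuous_on_coordinate_snd pathin_realization_continuous[OF p])
  define I where "I = supp ` p ` {0..1}"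
  have pK: "p t \<in> topspace (realization K)" "w \<in> supp (p t)" if "0 \<le> t" "t \<le> 1" for t
    using w[OF that] star_supp by blast+
  have I: "finite I" "I \<subseteq> K"
    unfolding I_def using finite_supports[OF compactin_path_image[OF p]] pK supp_in_K(1) by auto
  let ?T = "\<lambda>s. {z \<in> {0..1} \<times> {0..1}. ?H z \<in> closed_simplex s}"
  show ?thesis
  proof (rule pasting_lemma_closed[OF I(1), of _ ?T _ "\<lambda>_. ?H"])
    fix s assume s: "s \<in> I"
    show "closedin ?S (?T s)"
      using continuous_closedin_preimage[OF cont closed_closed_simplex, of s]
      by (simp add: vimage_def Int_def conj_ac)
    show "continuous_map (subtopology ?S (?T s)) (realization K) ?H"
    proof -
      have "subtopology ?S (?T s) = top_of_set (?T s)"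
        by (simp add: subtopology_subtopology) (metis (no_types, lifting) inf.absorb_iff2 mem_Collect_eq subsetI)
      then show ?thesis
        using continuous_map_realization[of s K "?T s" ?H] s I cont
        by (auto intro: continuous_on_subset)
    qed
  next
    fix z assume "z \<in> topspace ?S"
    then have z: "0 \<le> fst z" "fst z \<le> 1" "0 \<le> snd z" "snd z \<le> 1" by auto
    let ?f = "p (snd z)"
    have "?H z \<in> closed_simplex (supp ?f)"
      using segment_to_closed_simplex[OF supp_in_K(3) pK(2) supp_in_K(2), of "snd z"] pK(1)[of "snd z"] z
      by (auto simp: Pi_iff)
    then show "\<exists>j. j \<in> I \<and> z \<in> ?T j \<and> ?H z = ?H z"
      using z by (intro exI[of _ "supp ?f"]) (auto simp: I_def mem_Times_iff)
  qed auto
qed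

lemma pathin_segment_to:
  assumes "f \<in> closed_simplex s" "w \<in> s" "s \<in> K"
  shows "pathin (realization K) (segment_to f w)"
  unfolding pathin_def
  by (rule continuous_map_realization[OF assms(3) continuous_on_segment_to])
     (use assms K_finite in \<open>auto intro: segment_to_closed_simplex[THEN funcset_mem]\<close>)

lemma pathin_realization_edge: "{x, y} \<in> K \<Longrightarrow> pathin (realization K) (realization_edge x y)"
  unfolding realization_edge_segment by (rule pathin_segment_to[of _ "{x, y}"]) (auto intro: indicator_closed_simplex)

text \<open>Both paths lie in the closed simplex \<open>s\<close>. Degenerate triangles are
  included, since the vertices need not differ.\<close>

lemma segment_triangle:
  assumes f: "f \<in> closed_simplex s" and s: "s \<in> K" "u \<in> s" "w \<in> s"
  shows "path_homotopic (realization K) (segment_to f w) (segment_to f u +++ realization_edge u w)"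
proof (rule simplex_path_homotopic[OF s(1)])
  have fin: "finite s" using K_finite s by simp
  note sub = segment_to_closed_simplex[OF f s(3) fin] segment_to_closed_simplex[OF f s(2) fin]
    segment_to_closed_simplex[OF indicator_closed_simplex[OF fin s(2)] s(3) fin]
  show "segment_to f w \<in> {0..1} \<rightarrow> closed_simplex s" by fact
  show "segment_to f u +++ realization_edge u w \<in> {0..1} \<rightarrow> closed_simplex s"
    unfolding realization_edge_segment using sub(2,3) by (auto simp: joinpaths_def Pi_iff)
  show "continuous_on {0..1} (segment_to f u +++ realization_edge u w)"
    unfolding path_def[symmetric] realization_edge_segment
    by (rule path_join_imp) (auto simp: path_def pathstart_def pathfinish_def continuous_on_segment_to)
qed (auto simp: continuous_on_segment_to joinpaths_def)

end

section \<open>Path functors on realizations\<close>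

lemma concat_paths_ends:
  assumes "ps \<noteq> []" "successively (\<lambda>p q. p 1 = q 0) ps"
  shows "concat_paths ps 0 = hd ps 0" "concat_paths ps 1 = last ps 1"
  using assms by (induct ps rule: concat_paths.induct) (auto simp: joinpaths_def)

lemma pathin_concat_paths:
  assumes "ps \<noteq> []" "successively (\<lambda>p q. p 1 = q 0) ps" "\<And>p. p \<in> set ps \<Longrightarrow> pathin Y p"
  shows "pathin Y (concat_paths ps)"
  using assms
proof (induct ps rule: concat_paths.induct)
  case (3 p q ps)
  then show ?case using concat_paths_ends(1)[of "q # ps"] by (auto intro!: pathin_join)
qed auto

lemma (in path_functor) F_concat_paths:
  assumes "ps \<noteq> []" "successively (\<lambda>p q. p 1 = q 0) ps" "\<And>p. p \<in> set ps \<Longrightarrow> pathin Y p"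
  shows "F (concat_paths ps) = list_mult Q (map F ps)"
  using assms
proof (induct ps rule: concat_paths.induct)
  case (3 p q ps)
  then have "F (p +++ concat_paths (q # ps)) = F p \<otimes> F (concat_paths (q # ps))"
    using concat_paths_ends(1)[of "q # ps"] pathin_concat_paths[of "q # ps" Y] by (intro F_join) auto
  then show ?case using 3 by simp
qed auto

lemma successively_map2_tl:
  assumes "\<And>x y z. P x y \<Longrightarrow> P y z \<Longrightarrow> R (f x y) (f y z)" "successively P xs"
  shows "successively R (map2 f xs (tl xs))"
  using assms(2)
proof (induct xs rule: induct_list012)
  case (3 x y zs)
  then show ?case using assms(1) by (cases zs) auto
qed auto

lemma set_map2_tl: "successively P xs \<Longrightarrow> p \<in> set (map2 f xs (tl xs)) \<Longrightarrow> \<exists>x y. P x y \<and> p = f x y"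
  by (induct xs rule: induct_list012) auto

lemma hd_last_map2_tl:
  assumes "2 \<le> length xs"
  shows "map2 f xs (tl xs) \<noteq> []" "\<exists>y. hd (map2 f xs (tl xs)) = f (hd xs) y"
    "\<exists>x. last (map2 f xs (tl xs)) = f x (last xs)"
proof -
  show "map2 f xs (tl xs) \<noteq> []" "\<exists>y. hd (map2 f xs (tl xs)) = f (hd xs) y"
    using assms by (cases xs; cases "tl xs"; auto)+
  show "\<exists>x. last (map2 f xs (tl xs)) = f x (last xs)"
    using assms by (induct xs rule: induct_list012) (auto simp: Suc_le_eq neq_Nil_conv)
qed

context complex begin

lemma edge_path_pathin:
  assumes "2 \<le> length xs" "successively (\<lambda>x y. {x, y} \<in> K) xs"
  shows "pathin (realization K) (edge_path xs)"
    "edge_path xs 0 = indicator {hd xs}" "edge_path xs 1 = indicator {last xs}"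
proof -
  let ?ps = "map2 realization_edge xs (tl xs)"
  note ne = hd_last_map2_tl[OF assms(1), of realization_edge]
  have s: "successively (\<lambda>p q. p 1 = q 0) ?ps"
    by (rule successively_map2_tl[OF _ assms(2)]) simp
  have p: "pathin (realization K) p" if "p \<in> set ?ps" for p
    using set_map2_tl[OF assms(2) that] pathin_realization_edge by blast
  show "pathin (realization K) (edge_path xs)"
    unfolding edge_path_def by (rule pathin_concat_paths[OF ne(1) s p])
  show "edge_path xs 0 = indicator {hd xs}" "edge_path xs 1 = indicator {last xs}"
    unfolding edge_path_def using concat_paths_ends[OF ne(1) s] ne(2,3) by auto
qed

end

locale realization_functor = complex K + path_functor Q "realization K" F
  for K :: "'v set set" and Q :: "('q, 'm) monoid_scheme" (structure) and F
begin

lemma F_edge_path: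
  assumes "2 \<le> length xs" "successively (\<lambda>x y. {x, y} \<in> K) xs"
  shows "F (edge_path xs) = list_mult Q (map2 (\<lambda>x y. F (realization_edge x y)) xs (tl xs))"
proof -
  let ?ps = "map2 realization_edge xs (tl xs)"
  note ne = hd_last_map2_tl(1)[OF assms(1), of realization_edge]
  have s: "successively (\<lambda>p q. p 1 = q 0) ?ps"
    by (rule successively_map2_tl[OF _ assms(2)]) simp
  have p: "pathin (realization K) p" if "p \<in> set ?ps" for p
    using set_map2_tl[OF assms(2) that] pathin_realization_edge by blast
  show ?thesis
    unfolding edge_path_def using F_concat_paths[OF ne s p] by (simp add: split_def o_def)
qed

text \<open>A path is cut into pieces lying in open stars; each piece is pushed to the centre of its star
  along straight segments.\<close>

lemma F_eq_edge_path:
  assumes g: "pathin (realization K) g"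
    and x: "g 0 = indicator {x}" and y: "g 1 = indicator {y}"
  obtains xs where "2 \<le> length xs" "successively (\<lambda>x y. {x, y} \<in> K) xs" "hd xs = x" "last xs = y"
    "F g = F (edge_path xs)"
proof -
  let ?Y = "realization K"
  let ?a = "\<lambda>f w. F (segment_to f w)"
  have cover: "topspace ?Y \<subseteq> (\<Union>v. star v)" using star_vertex_of by blast
  obtain n w where n: "0 < n" and w: "\<And>j. j < n \<Longrightarrow> g ` {real j / n..real (Suc j) / n} \<subseteq> star (w j)"
    by (rule uniform_subdivision[OF g openin_star cover]) (rule that)
  have node: "g (real j / n) \<in> star (w j)" "g (real (Suc j) / n) \<in> star (w j)" if "j < n" for j
    using w[OF that] by (auto simp: image_subset_iff divide_right_mono)
  have seg: "pathin ?Y (segment_to f v)" if "f \<in> star v" for f v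
    using pathin_segment_to supp_in_K star_supp that by blast
  have edge: "?a f v = ?a f u \<otimes> F (realization_edge u v)" "{u, v} \<in> K" if "f \<in> star u" "f \<in> star v" for f u v
  proof -
    have s: "f \<in> closed_simplex (supp f)" "supp f \<in> K" "u \<in> supp f" "v \<in> supp f"
      using that star_supp supp_in_K by blast+
    show e: "{u, v} \<in> K" using K_subset[OF s(2), of "{u, v}"] s by simp
    show "?a f v = ?a f u \<otimes> F (realization_edge u v)"
      unfolding F_homotopic[OF segment_triangle[OF s]]
      using seg[OF that(1)] e by (intro F_join) (auto simp: pathin_realization_edge)
  qed
  \<comment> \<open>The contraction of the star gives a square whose fourth side rests at the centre
    \<open>w j\<close>. That side has trivial value, so the piece equals the segment at its start
    followed by the inverse of the segment at its end.\<close>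
  have piece: "F (restrict_path (real j / n) (real (Suc j) / n) g) \<otimes> ?a (g (real (Suc j) / n)) (w j) = ?a (g (real j / n)) (w j)"
    if j: "j < n" for j
  proof -
    let ?p = "restrict_path (real j / n) (real (Suc j) / n) g"
    have p: "pathin ?Y ?p"
      using grid_interval[OF j] n by (intro pathin_subpath[OF g]) (auto simp: field_simps)
    have "?p ` {0..1} \<subseteq> g ` {real j / n..real (Suc j) / n}"
      by (intro restrict_path_image divide_right_mono) auto
    then have st: "?p t \<in> star (w j)" if "0 \<le> t" "t \<le> 1" for t
      using w[OF j] that by fastforce
    have ends: "?p 0 = g (real j / n)" "?p 1 = g (real (Suc j) / n)" by (auto simp: restrict_path_def)
    have "F ?p \<otimes> ?a (?p 1) (w j) = ?a (?p 0) (w j) \<otimes> F (\<lambda>t. indicator {w j})"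
      using F_square[OF star_contraction[OF p st]] by (simp add: eta_contract_eq)
    moreover have "indicator {w j} \<in> topspace ?Y"
      using path_finish_in_topspace[OF seg[OF node(1)[OF j]]] by simp
    ultimately show ?thesis using ends seg[OF node(1)[OF j]] by simp
  qed
  have cl: "?a (g (real j / n)) (w j) \<in> carrier Q" "?a (g (real (Suc j) / n)) (w j) \<in> carrier Q" if "j < n" for j
    using seg node[OF that] by auto
  let ?e = "\<lambda>j. F (realization_edge (w j) (w (Suc j)))"
  have ed: "{w j, w (Suc j)} \<in> K" if "Suc j < n" for j
    using edge(2)[OF node(2)[of j] node(1)[of "Suc j"]] that by simp
  \<comment> \<open>The products telescope: at each node the segments to the two adjacent centres
    differ by the edge between these centres.\<close>
  have main: "F (restrict_path 0 (real (Suc k) / n) g) \<otimes> ?a (g (real (Suc k) / n)) (w k) = ?a (g 0) (w 0) \<otimes> list_mult Q (map ?e [0..<k])"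
    if "k < n" for k
    using that
  proof (induct k)
    case 0
    then show ?case using piece[of 0] cl[of 0] by simp
  next
    case (Suc k)
    let ?p = "restrict_path (real (Suc k) / n) (real (Suc (Suc k)) / n) g" and ?q = "restrict_path 0 (real (Suc k) / n) g"
    let ?f = "g (real (Suc k) / n)"
    have sub: "F (restrict_path 0 (real (Suc (Suc k)) / n) g) = F ?q \<otimes> F ?p"
      using Suc.prems n by (intro F_subpath[OF g]) (auto simp: field_simps)
    have pq: "pathin ?Y ?p" "pathin ?Y ?q"
      using Suc.prems n by (auto intro!: pathin_subpath[OF g] simp: field_simps)
    have es: "?e j \<in> carrier Q" if "j < Suc k" for j
      using ed[of j] Suc.prems that by (simp add: pathin_realization_edge)
    have k: "k < n" "Suc k < n" using Suc.prems by auto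
    have "F ?q \<otimes> F ?p \<otimes> ?a (g (real (Suc (Suc k)) / n)) (w (Suc k)) = F ?q \<otimes> ?a ?f (w (Suc k))"
      using piece[of "Suc k"] pq cl[OF k(2)] k by (simp add: m_assoc)
    also have "\<dots> = F ?q \<otimes> (?a ?f (w k) \<otimes> ?e k)"
      using edge(1)[OF node(2)[OF k(1)] node(1)[OF k(2)]] by simp
    also have "\<dots> = ?a (g 0) (w 0) \<otimes> list_mult Q (map ?e [0..<k]) \<otimes> ?e k"
      using Suc.hyps[OF k(1)] pq es[of k] cl(2)[OF k(1)] by (simp flip: m_assoc)
    also have "\<dots> = ?a (g 0) (w 0) \<otimes> list_mult Q (map ?e [0..<Suc k])"
    proof -
      have "set (map ?e [0..<k]) \<subseteq> carrier Q" using es by auto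
      then show ?thesis
        using es[of k] cl(1)[of 0] k by (simp add: list_mult_append m_assoc)
    qed
    finally show ?case unfolding sub .
  qed
  \<comment> \<open>The end points are put around the \<open>n\<close> centres, giving
    \<open>n + 2\<close> vertices and \<open>n + 1\<close> edges. The first edge is the segment from
    \<open>x\<close> to \<open>w 0\<close>, the last one undoes the segment from \<open>y\<close> to
    \<open>w (n - 1)\<close>.\<close>
  define w' where "w' j = (if j = 0 then x else if j \<le> n then w (j - 1) else y)" for j
  define xs where "xs = map w' [0..<n + 2]"
  have len: "length xs = n + 2" by (simp add: xs_def)
  have xw: "g 0 = indicator {x}" "indicator {x} \<in> star (w 0)" using node(1)[of 0] n x by auto
  have yw: "g 1 = indicator {y}" "indicator {y} \<in> star (w (n - 1))" "indicator {y} \<in> star y"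
  proof -
    show "g 1 = indicator {y}" by fact
    have "Suc (n - 1) = n" using n by simp
    then show *: "indicator {y} \<in> star (w (n - 1))" using node(2)[of "n - 1"] n y by auto
    show "indicator {y} \<in> star y" using star_supp(2)[OF *] by (simp add: star_def)
  qed
  have xx: "indicator {x} \<in> star x" using star_supp(2)[OF xw(2)] by (simp add: star_def)
  have edges: "{w' j, w' (Suc j)} \<in> K" if j: "j < n + 1" for j
  proof -
    consider "j = 0" | "0 < j" "j < n" | "j = n" using j by linarith
    then show ?thesis
    proof cases
      case 1
      then show ?thesis using edge(2)[OF xx xw(2)] n by (simp add: w'_def)
    next
      case 2
      then show ?thesis using ed[of "j - 1"] by (simp add: w'_def)
    next
      case 3
      then show ?thesis using edge(2)[OF yw(2,3)] n by (simp add: w'_def)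
    qed
  qed
  have succ: "successively (\<lambda>x y. {x, y} \<in> K) xs"
    unfolding successively_conv_nth using edges len by (simp add: xs_def del: upt_Suc)
  let ?E = "\<lambda>j. F (realization_edge (w' j) (w' (Suc j)))"
  have E: "?E j \<in> carrier Q" if "j < n + 1" for j
    using edges[OF that] by (simp add: pathin_realization_edge)
  have "map2 (\<lambda>x y. F (realization_edge x y)) xs (tl xs) = map ?E [0..<n + 1]"
    by (rule nth_equalityI) (auto simp: xs_def nth_tl simp del: upt_Suc)
  then have fe: "F (edge_path xs) = list_mult Q (map ?E [0..<n + 1])"
    using F_edge_path[OF _ succ] len by simp
  have "[0..<n + 1] = 0 # map Suc [0..<n - 1] @ [n]"
    using n by (simp add: map_Suc_upt upt_conv_Cons)
  then have "map ?E [0..<n + 1] = ?E 0 # map ?e [0..<n - 1] @ [?E n]"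
    using n by (auto simp: w'_def o_def)
  moreover have "set (map ?e [0..<n - 1]) \<subseteq> carrier Q"
    using ed by (auto simp: pathin_realization_edge)
  ultimately have fe': "F (edge_path xs) = ?E 0 \<otimes> list_mult Q (map ?e [0..<n - 1]) \<otimes> ?E n"
    unfolding fe using E[of 0] E[of n] n by (simp add: list_mult_append m_assoc)
  have E0: "?E 0 = ?a (g 0) (w 0)"
    using n by (simp add: w'_def xw realization_edge_segment)
  have En: "?E n = F (realization_edge (w (n - 1)) y)" using n by (simp add: w'_def)
  have "F g \<otimes> ?a (g 1) (w (n - 1)) = ?E 0 \<otimes> list_mult Q (map ?e [0..<n - 1])"
  proof -
    have "Suc (n - 1) = n" "restrict_path 0 1 g = g" using n by (auto simp: restrict_path_def)
    then show ?thesis using main[of "n - 1"] n E0 by simp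
  qed
  then have "F (edge_path xs) = F g \<otimes> ?a (g 1) (w (n - 1)) \<otimes> ?E n"
    using fe' by simp
  also have "\<dots> = F g \<otimes> (?a (indicator {y}) (w (n - 1)) \<otimes> F (realization_edge (w (n - 1)) y))"
    using g E[of n] n seg[OF yw(2)] unfolding En yw(1) by (simp add: m_assoc)
  also have "?a (indicator {y}) (w (n - 1)) \<otimes> F (realization_edge (w (n - 1)) y) = ?a (indicator {y}) y"
    using edge(1)[OF yw(2,3)] by simp
  also have "segment_to (indicator {y}) y = (\<lambda>_. indicator {y})"
    by (auto simp: segment_to_def algebra_simps)
  also have "F (\<lambda>_. indicator {y}) = \<one>"
    using star_supp(2)[OF yw(3)] by simp
  finally have "F g = F (edge_path xs)" using g by simp
  moreover have "hd xs = x" "last xs = y"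
    using n by (auto simp: xs_def w'_def hd_map last_map simp del: upt_Suc)
  ultimately show thesis using that[of xs] succ len by simp
qed

end

section \<open>Rips complexes of geodesic spaces\<close>

lemma pathin_euclidean [simp]: "pathin euclidean g \<longleftrightarrow> path g"
  by (simp add: pathin_def path_def continuous_map_iff_continuous)

lemma join_ends [simp]: "(p +++ q) 0 = p 0" "(p +++ q) 1 = q 1"
  by (simp_all add: joinpaths_def)

text \<open>The diameter of a finite nonempty set is attained, so the strict bound on it is the same
  as strict bounds on all pairs.\<close>

lemma Rips_iff:
  "s \<in> Rips r \<longleftrightarrow> finite s \<and> s \<noteq> {} \<and> (\<forall>x\<in>s. \<forall>y\<in>s. dist x y < r)"
proof (cases "finite s \<and> s \<noteq> {}")
  case True
  then have c: "compact s" "bounded s" by (auto simp: finite_imp_compact finite_imp_bounded)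
  obtain x y where "x \<in> s" "y \<in> s" "dist x y = diameter s"
    using diameter_compact_attained[OF c(1)] True by blast
  then have "diameter s < r \<longleftrightarrow> (\<forall>x\<in>s. \<forall>y\<in>s. dist x y < r)"
    using diameter_bounded_bound[OF c(2)] le_less_trans by metis
  then show ?thesis using True unfolding Rips_def by blast
qed (auto simp: Rips_def)

lemma complex_Rips: "complex (Rips r)"
  by unfold_locales (auto simp: Rips_iff finite_subset subset_iff)

lemma Rips_mono: "p \<le> q \<Longrightarrow> Rips p \<subseteq> Rips q"
  unfolding Rips_iff subset_iff by (meson order.strict_trans2)

lemma Rips_edge: "0 < r \<Longrightarrow> {x, y} \<in> Rips r \<longleftrightarrow> dist x y < r"
  by (auto simp: Rips_iff dist_commute)

lemma Rips_triangle:
  "0 < r \<Longrightarrow> dist x y < r \<Longrightarrow> dist y z < r \<Longrightarrow> dist x z < r \<Longrightarrow> {x, y, z} \<in> Rips r"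
  by (auto simp: Rips_iff dist_commute)

lemma r_loop_successively:
  "r_loop r xs \<longleftrightarrow> 2 \<le> length xs \<and> last xs = hd xs \<and> successively (\<lambda>x y. dist x y < r) xs"
  by (auto simp: r_loop_def successively_conv_nth)

section \<open>Chosen geodesics and fillings\<close>

definition geod :: "'a::metric_space \<Rightarrow> 'a \<Rightarrow> real \<Rightarrow> 'a" where
  "geod x y = (SOME g. geodesic x y g)"

lemma geodesic_geod: "geodesic_space TYPE('a::metric_space) \<Longrightarrow> geodesic x y (geod x (y::'a))"
  unfolding geod_def geodesic_space_def by (metis someI_ex)

lemma path_length_join_finite:
  "path_length p < \<infinity> \<Longrightarrow> path_length q < \<infinity> \<Longrightarrow> p 1 = q 0 \<Longrightarrow> path_length (p +++ q) < \<infinity>"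
  using path_length_join[of p q]
  by (cases "path_length p"; cases "path_length q"; cases "path_length (p +++ q)") auto

lemma fillingE:
  assumes "filling xs g" "2 \<le> length xs"
  obtains ps where "ps \<noteq> []" "g = concat_paths ps" "Suc (length ps) = length xs"
    "\<And>i. i < length ps \<Longrightarrow> geodesic (xs ! i) (xs ! Suc i) (ps ! i)"
    "successively (\<lambda>p q. p 1 = q 0) ps" "\<And>p. p \<in> set ps \<Longrightarrow> path p"
    "hd ps 0 = hd xs" "last ps 1 = last xs"
proof -
  from assms obtain ps where ps: "Suc (length ps) = length xs" "g = concat_paths ps"
    "\<And>i. i < length ps \<Longrightarrow> geodesic (xs ! i) (xs ! Suc i) (ps ! i)"
    unfolding filling_def by blast
  have ne: "ps \<noteq> []" using ps assms by auto
  have 1: "successively (\<lambda>p q. p 1 = q 0) ps"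
    unfolding successively_conv_nth using geodesicD(2,3)[OF ps(3)] by auto
  have 2: "path p" if "p \<in> set ps" for p
    using that geodesicD(1)[OF ps(3)] by (metis in_set_conv_nth)
  have 3: "hd ps 0 = hd xs"
    using geodesicD(2)[OF ps(3), of 0] ne ps(1) by (cases xs) (auto simp: hd_conv_nth)
  have "last ps 1 = xs ! Suc (length ps - 1)"
    using geodesicD(3)[OF ps(3), of "length ps - 1"] ne by (simp add: last_conv_nth)
  then have 4: "last ps 1 = last xs"
    using ne ps(1) by (cases xs) (auto simp: last_conv_nth)
  show thesis
    by (rule that[of ps]; fact)
qed

lemma filling_path:
  assumes "filling xs g" "2 \<le> length xs"
  shows "path g" "g 0 = hd xs" "g 1 = last xs" "path_length g < \<infinity>"
proof -
  obtain ps where ps: "ps \<noteq> []" "g = concat_paths ps" "Suc (length ps) = length xs"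
    "\<And>i. i < length ps \<Longrightarrow> geodesic (xs ! i) (xs ! Suc i) (ps ! i)"
    "successively (\<lambda>p q. p 1 = q 0) ps" "\<And>p. p \<in> set ps \<Longrightarrow> path p"
    "hd ps 0 = hd xs" "last ps 1 = last xs"
    by (rule fillingE[OF assms]) (rule that)
  show "path g" using pathin_concat_paths[OF ps(1,5), of euclidean] ps by simp
  show "g 0 = hd xs" "g 1 = last xs" using concat_paths_ends[OF ps(1,5)] ps by auto
  have len: "path_length p < \<infinity>" if "p \<in> set ps" for p
    using that geodesicD(4)[OF ps(4)] by (metis in_set_conv_nth ereal_less_PInfty ereal.distinct(1) less_ereal.simps(4))
  have "path_length (concat_paths qs) < \<infinity>"
    if "qs \<noteq> []" "successively (\<lambda>p q. p 1 = q 0) qs" "\<And>p. p \<in> set qs \<Longrightarrow> path_length p < \<infinity>" for qs :: "(real \<Rightarrow> 'a) list"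
    using that
  proof (induct qs rule: concat_paths.induct)
    case (3 p q ps)
    then have "path_length (p +++ concat_paths (q # ps)) \<le> path_length p + path_length (concat_paths (q # ps))"
      using concat_paths_ends(1)[of "q # ps"] by (intro path_length_join) auto
    moreover have "path_length p < \<infinity>" "path_length (concat_paths (q # ps)) < \<infinity>" using 3 by auto
    ultimately show ?case
      by (cases "path_length p"; cases "path_length (concat_paths (q # ps))";
          cases "path_length (p +++ concat_paths (q # ps))") auto
  qed auto
  then show "path_length g < \<infinity>" using ps len by auto
qed

lemma filling_exists:
  assumes "geodesic_space TYPE('a::metric_space)" "2 \<le> length (xs :: 'a list)"
  obtains g where "filling xs g"
proof
  show "filling xs (concat_paths (map2 geod xs (tl xs)))"
    unfolding filling_def using assms(2) geodesic_geod[OF assms(1)]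
    by (intro exI[of _ "map2 geod xs (tl xs)"]) (auto simp: nth_tl)
qed

section \<open>From the Rips complex to the space\<close>

text \<open>Collects what the direction from the Rips complex to the space uses: values of
  finite-length paths lie in \<open>S\<close>, values of closed paths shorter than
  \<open>3 * r\<close> lie in \<open>N\<close>. It is instantiated by the fundamental group and,
  once for each coefficient, by first homology.\<close>

locale length_functor = path_functor Q "euclidean :: 'a::metric_space topology" F
  for Q :: "('q, 'm) monoid_scheme" (structure) and F +
  fixes S N :: "'q set" and r :: real
  assumes geodesic_space: "geodesic_space TYPE('a)"
    and r_pos: "0 < r"
    and S_subgroup: "subgroup S Q"
    and N_normal: "N \<lhd> (Q\<lparr>carrier := S\<rparr>)"
    and F_finite: "path p \<Longrightarrow> path_length p < \<infinity> \<Longrightarrow> F p \<in> S"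
    and F_small: "path p \<Longrightarrow> p 1 = p 0 \<Longrightarrow> path_length p < ereal (3 * r) \<Longrightarrow> F p \<in> N"
begin

abbreviation "H \<equiv> Q\<lparr>carrier := S\<rparr>"
definition M :: "'q set monoid" where "M = H Mod N"

text \<open>Normality of \<open>N\<close> is available in \<open>S\<close> only, so multiplicativity
  of this class is claimed for paths of finite length.\<close>

definition coset :: "(real \<Rightarrow> 'a) \<Rightarrow> 'q set" where
  "coset p = N #> F p"

definition \<phi> :: "'a \<Rightarrow> 'a \<Rightarrow> 'q set" where
  "\<phi> x y = coset (geod x y)"

lemma group_M: "group M" unfolding M_def by (rule normal.factorgroup_is_group[OF N_normal])

lemma r_coset_H: "N #>\<^bsub>H\<^esub> a = N #> a"
  by (simp add: r_coset_def)

lemma N_coset_mult: "a \<in> S \<Longrightarrow> b \<in> S \<Longrightarrow> N #> (a \<otimes> b) = (N #> a) \<otimes>\<^bsub>M\<^esub> (N #> b)"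
  using normal.rcos_sum[OF N_normal, of a b] by (simp add: M_def FactGroup_def r_coset_H)

lemma N_coset_one: "a \<in> N \<Longrightarrow> N #> a = \<one>\<^bsub>M\<^esub>"
proof -
  interpret N: normal N H by (rule N_normal)
  assume a: "a \<in> N"
  have "N #>\<^bsub>H\<^esub> a = N"
    by (rule N.coset_join2[OF _ N.subgroup_axioms a]) (use a N.subset in auto)
  then show ?thesis by (simp add: M_def FactGroup_def r_coset_H)
qed

lemma one_in_N: "\<one> \<in> N"
  using subgroup.one_closed[OF normal_imp_subgroup[OF N_normal]] by simp

lemma coset_closed:
  assumes "path p" "path_length p < \<infinity>" shows "coset p \<in> carrier M"
  using F_finite[OF assms] unfolding coset_def M_def FactGroup_def RCOSETS_def by (auto simp: r_coset_H)

lemma coset_small: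
  assumes "path p" "p 1 = p 0" "path_length p < ereal (3 * r)" shows "coset p = \<one>\<^bsub>M\<^esub>"
  unfolding coset_def by (rule N_coset_one[OF F_small[OF assms]])

lemma coset_join:
  assumes "path p" "path_length p < \<infinity>" "path q" "path_length q < \<infinity>" "p 1 = q 0"
  shows "coset (p +++ q) = coset p \<otimes>\<^bsub>M\<^esub> coset q"
  unfolding coset_def using assms N_coset_mult[OF F_finite[OF assms(1,2)] F_finite[OF assms(3,4)]]
  by (simp add: F_join)

lemma geod:
  fixes x y :: 'a
  shows "path (geod x y)" "geod x y 0 = x" "geod x y 1 = y" "path_length (geod x y) = ereal (dist x y)"
  using geodesicD(1-4)[OF geodesic_geod[OF geodesic_space, of x y]] by auto

text \<open>Closing \<open>p\<close> by a geodesic back to its start gives a loop shorter than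
  \<open>2 * r\<close>, hence shorter than \<open>3 * r\<close>.\<close>

lemma coset_two:
  assumes p: "path p" "path_length p < ereal r" and d: "dist (p 0) (p 1) < r"
  shows "coset p \<otimes>\<^bsub>M\<^esub> \<phi> (p 1) (p 0) = \<one>\<^bsub>M\<^esub>"
proof -
  let ?g = "geod (p 1) (p 0)"
  have fin: "path_length p < \<infinity>" using p by (cases "path_length p") auto
  have "path_length (p +++ ?g) \<le> path_length p + path_length ?g"
    by (rule path_length_join) (simp add: geod)
  also have "\<dots> < ereal r + ereal r"
    using p d by (intro ereal_add_strict_mono2) (auto simp: geod dist_commute)
  also have "\<dots> \<le> ereal (3 * r)" using r_pos by simp
  finally have "coset (p +++ ?g) = \<one>\<^bsub>M\<^esub>"
    using p geod by (intro coset_small) (auto simp: pathfinish_def pathstart_def)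
  then show ?thesis
    using p fin geod unfolding \<phi>_def by (subst (asm) coset_join) auto
qed

lemma \<phi>_closed: "\<phi> x y \<in> carrier M"
  unfolding \<phi>_def by (intro coset_closed) (simp_all add: geod)

text \<open>A geodesic triangle with sides shorter than \<open>r\<close> has perimeter less than \<open>3 r\<close>.\<close>

lemma \<phi>_cocycle:
  assumes "dist x y < r" "dist y z < r" "dist x z < r"
  shows "\<phi> x y \<otimes>\<^bsub>M\<^esub> \<phi> y z = \<phi> x z"
proof -
  interpret M: group M by (rule group_M)
  let ?t = "geod y z +++ geod z x" and ?u = "geod x y +++ (geod y z +++ geod z x)"
  have t: "path ?t" "?t 0 = y" "?t 1 = x" "path_length ?t \<le> ereal (dist y z) + ereal (dist z x)"
    using path_length_join[of "geod y z" "geod z x"]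
    by (auto simp: geod pathfinish_def pathstart_def)
  then have tf: "path_length ?t < \<infinity>" by (auto intro: le_less_trans)
  have "path_length ?u \<le> ereal (dist x y) + path_length ?t"
    using path_length_join[of "geod x y" ?t] t by (simp add: geod)
  also have "\<dots> \<le> ereal (dist x y) + (ereal (dist y z) + ereal (dist z x))"
    using t by (intro add_left_mono) auto
  also have "\<dots> < ereal (3 * r)" using assms by (simp add: dist_commute)
  finally have "coset ?u = \<one>\<^bsub>M\<^esub>"
    using t by (intro coset_small) (auto simp: geod pathfinish_def pathstart_def)
  moreover have "coset ?u = \<phi> x y \<otimes>\<^bsub>M\<^esub> coset ?t"
    unfolding \<phi>_def using t tf by (intro coset_join) (auto simp: geod)
  moreover have "coset ?t = \<phi> y z \<otimes>\<^bsub>M\<^esub> \<phi> z x"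
    unfolding \<phi>_def by (intro coset_join) (auto simp: geod)
  ultimately have 1: "\<phi> x y \<otimes>\<^bsub>M\<^esub> \<phi> y z \<otimes>\<^bsub>M\<^esub> \<phi> z x = \<one>\<^bsub>M\<^esub>"
    by (simp add: M.m_assoc \<phi>_closed)
  have 2: "\<phi> x z \<otimes>\<^bsub>M\<^esub> \<phi> z x = \<one>\<^bsub>M\<^esub>"
    using coset_two[of "geod x z"] assms by (simp add: geod \<phi>_def)
  from 1 2 show ?thesis
    by (metis M.m_closed M.right_cancel \<phi>_closed)
qed

text \<open>The path and the chosen geodesic become trivial after appending the same return
  geodesic, which is then cancelled. In particular short geodesics with the same ends have the same
  class.\<close>

lemma coset_geodesic:
  assumes "path p" "path_length p < ereal r" "dist (p 0) (p 1) < r"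
  shows "coset p = \<phi> (p 0) (p 1)"
proof -
  interpret M: group M by (rule group_M)
  have fin: "path_length p < \<infinity>" using assms by (cases "path_length p") auto
  have "coset p \<otimes>\<^bsub>M\<^esub> \<phi> (p 1) (p 0) = \<phi> (p 0) (p 1) \<otimes>\<^bsub>M\<^esub> \<phi> (p 1) (p 0)"
    using coset_two[OF assms] coset_two[of "geod (p 0) (p 1)"] assms by (simp add: geod \<phi>_def)
  then show ?thesis
    using M.right_cancel \<phi>_closed coset_closed[OF assms(1) fin] by metis
qed

text \<open>The class of a filling depends only on its vertices, not on the geodesics chosen between
  them; this is the well-definedness of fillings modulo \<open>N\<close>.\<close>

lemma coset_filling:
  assumes "filling xs g" "2 \<le> length xs" "successively (\<lambda>x y. dist x y < r) xs"
  shows "coset g = list_mult M (map2 \<phi> xs (tl xs))"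
proof -
  interpret M: group M by (rule group_M)
  obtain ps where ps: "ps \<noteq> []" "g = concat_paths ps" "Suc (length ps) = length xs"
    "\<And>i. i < length ps \<Longrightarrow> geodesic (xs ! i) (xs ! Suc i) (ps ! i)"
    "successively (\<lambda>p q. p 1 = q 0) ps" "\<And>p. p \<in> set ps \<Longrightarrow> path p"
    "hd ps 0 = hd xs" "last ps 1 = last xs"
    by (rule fillingE[OF assms(1,2)]) (rule that)
  have len: "path_length p < \<infinity>" if "p \<in> set ps" for p
    using that geodesicD(4)[OF ps(4)] by (metis in_set_conv_nth less_ereal.simps(4))
  \<comment> \<open>Being a path of finite length is carried along in the induction, because
    \<open>coset_join\<close> asks for it at every step.\<close>
  have "coset (concat_paths qs) = list_mult M (map coset qs) \<and> path (concat_paths qs) \<and> path_length (concat_paths qs) < \<infinity>"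
    if "qs \<noteq> []" "successively (\<lambda>p q. p 1 = q 0) qs" "\<And>p. p \<in> set qs \<Longrightarrow> path p \<and> path_length p < \<infinity>" for qs
    using that
  proof (induct qs rule: concat_paths.induct)
    case (2 p)
    then show ?case using coset_closed[of p] by simp
  next
    case (3 p q ps)
    have ih: "coset (concat_paths (q # ps)) = list_mult M (map coset (q # ps))"
      "path (concat_paths (q # ps))" "path_length (concat_paths (q # ps)) < \<infinity>"
      using 3 by auto
    have e: "p 1 = concat_paths (q # ps) 0"
      using concat_paths_ends(1)[of "q # ps"] 3(3) by simp
    have "coset (p +++ concat_paths (q # ps)) = coset p \<otimes>\<^bsub>M\<^esub> coset (concat_paths (q # ps))"
      using 3(4) ih e by (intro coset_join) auto
    moreover have "path (p +++ concat_paths (q # ps))"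
      using 3(4)[of p] ih e by (intro path_join_imp) (auto simp: pathfinish_def pathstart_def)
    moreover have "path_length (p +++ concat_paths (q # ps)) < \<infinity>"
      using 3(4)[of p] ih e by (intro path_length_join_finite) auto
    ultimately show ?case using ih(1) by simp
  qed auto
  then have "coset g = list_mult M (map coset ps)" using ps len by blast
  also have "map coset ps = map2 \<phi> xs (tl xs)"
  proof (rule nth_equalityI)
    show "length (map coset ps) = length (map2 \<phi> xs (tl xs))" using ps by simp
    fix i assume "i < length (map coset ps)"
    then have i: "i < length ps" by simp
    have d: "dist (xs ! i) (xs ! Suc i) < r"
      using assms(3) i ps(3) by (auto simp: successively_conv_nth)
    note g = geodesicD[OF ps(4)[OF i]]
    have "coset (ps ! i) = \<phi> ((ps ! i) 0) ((ps ! i) 1)"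
      using g d by (intro coset_geodesic) auto
    then show "map coset ps ! i = map2 \<phi> xs (tl xs) ! i"
      using i ps(3) g by (simp add: nth_tl)
  qed
  finally show ?thesis .
qed

text \<open>A path of finite length is cut into pieces of length less than \<open>r\<close>; replacing each of them by
  a geodesic changes the class by small loops.\<close>

lemma coset_discretize:
  assumes p: "path p" "path_length p < \<infinity>"
  obtains xs where "2 \<le> length xs" "hd xs = p 0" "last xs = p 1"
    "successively (\<lambda>x y. dist x y < r) xs" "coset p = list_mult M (map2 \<phi> xs (tl xs))"
proof -
  interpret M: group M by (rule group_M)
  obtain n where n: "0 < n"
    "\<And>j. j < n \<Longrightarrow> path_length (restrict_path (real j / real n) (real (Suc j) / real n) p) < ereal r"
    using uniform_small_pieces[OF p r_pos] by metis
  let ?p = "\<lambda>j. restrict_path (real j / real n) (real (Suc j) / real n) p"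
  define x where "x j = p (real j / real n)" for j
  have ends: "?p j 0 = x j" "?p j 1 = x (Suc j)" for j by (auto simp: restrict_path_def x_def)
  have pp: "path (?p j)" "dist (x j) (x (Suc j)) < r" "F (?p j) \<in> S" if "j < n" for j
  proof -
    show *: "path (?p j)"
      using pathin_subpath[of euclidean p "real j / real n" "real (Suc j) / real n"] that p by simp
    have "ereal (dist (x j) (x (Suc j))) \<le> path_length (?p j)"
      using dist_le_arc_length[of 0 0 1 1 "?p j"] ends[of j] by (simp add: path_length_arc)
    then show "dist (x j) (x (Suc j)) < r" using n(2)[OF that] by (metis le_less_trans less_ereal.simps(1))
    show "F (?p j) \<in> S" using * n(2)[OF that] by (intro F_finite) (auto intro: less_trans)
  qed
  have "F p = list_mult Q (map (\<lambda>j. F (?p j)) [0..<n])"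
    using F_uniform[of p n] p n by simp
  \<comment> \<open>Products of cosets are formed only after each factor is known to lie in
    \<open>S\<close>.\<close>
  moreover have mult: "N #> list_mult Q ys = list_mult M (map (\<lambda>y. N #> y) ys) \<and> list_mult Q ys \<in> S"
    if "set ys \<subseteq> S" for ys
    using that by (induct ys) (auto simp: N_coset_mult N_coset_one one_in_N subgroup.one_closed[OF S_subgroup]
        subgroup.m_closed[OF S_subgroup])
  ultimately have "coset p = list_mult M (map (\<lambda>y. N #> y) (map (\<lambda>j. F (?p j)) [0..<n]))"
    unfolding coset_def using mult[of "map (\<lambda>j. F (?p j)) [0..<n]"] pp(3) by fastforce
  also have "map (\<lambda>y. N #> y) (map (\<lambda>j. F (?p j)) [0..<n]) = map (\<lambda>j. \<phi> (x j) (x (Suc j))) [0..<n]"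
  proof -
    have "N #> F (?p j) = \<phi> (x j) (x (Suc j))" if "j < n" for j
      using coset_geodesic[OF pp(1)[OF that] n(2)[OF that]] pp(2)[OF that] ends by (simp add: coset_def)
    then show ?thesis by simp
  qed
  also have "\<dots> = map2 \<phi> (map x [0..<Suc n]) (tl (map x [0..<Suc n]))"
    by (rule nth_equalityI) (auto simp: nth_tl simp del: upt_Suc)
  finally have eq: "coset p = list_mult M (map2 \<phi> (map x [0..<Suc n]) (tl (map x [0..<Suc n])))" .
  show thesis
  proof (rule that[OF _ _ _ _ eq])
    show "2 \<le> length (map x [0..<Suc n])" using n by simp
    show "hd (map x [0..<Suc n]) = p 0" by (simp add: hd_map x_def del: upt_Suc)
    show "last (map x [0..<Suc n]) = p 1" using n by (simp add: x_def)
    show "successively (\<lambda>x y. dist x y < r) (map x [0..<Suc n])"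
      unfolding successively_conv_nth using pp(2) by (simp del: upt_Suc)
  qed
qed

lemma coset_eq_filling:
  assumes p: "path p" "path_length p < \<infinity>"
  obtains xs g where "2 \<le> length xs" "hd xs = p 0" "last xs = p 1"
    "successively (\<lambda>x y. dist x y < r) xs" "filling xs g" "coset p = coset g"
proof -
  obtain xs where xs: "2 \<le> length xs" "hd xs = p 0" "last xs = p 1"
    "successively (\<lambda>x y. dist x y < r) xs" "coset p = list_mult M (map2 \<phi> xs (tl xs))"
    using coset_discretize[OF p] .
  obtain g where "filling xs g" using filling_exists[OF geodesic_space xs(1)] .
  then show thesis using that[of xs g] xs coset_filling[of xs g] by simp
qed

interpretation R: complex "Rips r :: 'a set set" by (rule complex_Rips)

text \<open>Three stars with a common point come from a simplex, so the three distances are below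
  \<open>r\<close> and the triangle relation for \<phi> applies.\<close>

lemma cech_lambda: "cech_cocycle M (realization (Rips r)) R.star R.vertex_of \<phi>"
proof -
  interpret M: group M by (rule group_M)
  show ?thesis
  proof unfold_locales
    fix f u v w assume "f \<in> R.star u" "f \<in> R.star v" "f \<in> R.star w"
    then have "{u, v, w} \<in> Rips r" by (rule R.star_simplex)
    then show "\<phi> u v \<otimes>\<^bsub>M\<^esub> \<phi> v w = \<phi> u w"
      by (intro \<phi>_cocycle) (auto simp: Rips_iff)
  qed (auto intro: R.openin_star R.star_vertex_of \<phi>_closed)
qed

definition Lam :: "(real \<Rightarrow> 'a \<Rightarrow> real) \<Rightarrow> 'q set" where
  "Lam = cech_cocycle.hol M R.star R.vertex_of \<phi>"

lemma path_functor_Lam: "path_functor M (realization (Rips r)) Lam"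
  unfolding Lam_def by (rule cech_cocycle.path_functor_hol[OF cech_lambda])

lemma Lam_edge:
  assumes "dist x y < r"
  shows "Lam (realization_edge x y) = \<phi> x y"
proof -
  interpret M: group M by (rule group_M)
  interpret C: cech_cocycle M "realization (Rips r)" R.star R.vertex_of \<phi> by (rule cech_lambda)
  \<comment> \<open>The first half of the edge lies in the star of \<open>x\<close>, the second half
    in the star of \<open>y\<close>. Two pieces thus suffice, and their word reduces to
    \<open>\<phi> x y\<close> because the end factors are trivial.\<close>
  let ?w = "\<lambda>j. if j = 0 then x else y"
  have e: "{x, y} \<in> Rips r" using assms r_pos by (simp add: Rips_edge)
  have st: "realization_edge x y t \<in> R.star x" if "0 \<le> t" "t \<le> 1/2" for t
    using path_image_subset_topspace[OF R.pathin_realization_edge[OF e]] that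
    by (auto simp: R.star_def realization_edge_def indicator_def Pi_iff)
  have st': "realization_edge x y t \<in> R.star y" if "1/2 \<le> t" "t \<le> 1" for t
    using path_image_subset_topspace[OF R.pathin_realization_edge[OF e]] that
    by (auto simp: R.star_def realization_edge_def indicator_def Pi_iff)
  have c: "C.chain (realization_edge x y) 2 ?w"
    unfolding C.chain_def
  proof (intro conjI allI impI)
    fix j t assume "j < (2::nat)" "real j \<le> t * real 2 \<and> t * real 2 \<le> real (Suc j)"
    then show "realization_edge x y t \<in> R.star (?w j)"
      using st[of t] st'[of t] by (cases "j = 0") (auto simp: less_2_cases_iff)
  qed simp
  have "\<phi> x x = \<one>\<^bsub>M\<^esub>" "\<phi> y y = \<one>\<^bsub>M\<^esub>"
    using C.\<phi>_refl[OF st[of 0]] C.\<phi>_refl[OF st'[of 1]] by auto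
  then show ?thesis
    unfolding Lam_def C.hol_eq[OF c] using \<phi>_closed by (simp add: C.word_def)
qed

lemma Lam_edge_path:
  assumes "2 \<le> length xs" "successively (\<lambda>x y. dist x y < r) xs" "filling xs g"
  shows "Lam (edge_path xs) = coset g"
proof -
  interpret L: path_functor M "realization (Rips r)" Lam by (rule path_functor_Lam)
  interpret L: realization_functor "Rips r" M Lam by unfold_locales
  have s: "successively (\<lambda>x y. {x, y} \<in> Rips r) xs" using assms(2) r_pos by (simp add: Rips_edge)
  have "map2 (\<lambda>x y. Lam (realization_edge x y)) xs (tl xs) = map2 \<phi> xs (tl xs)"
    using assms(2) by (intro nth_equalityI) (auto simp: nth_tl successively_conv_nth Lam_edge)
  then show ?thesis
    unfolding L.F_edge_path[OF assms(1) s] coset_filling[OF assms(3,1,2)] by (rule arg_cong)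
qed

end

section \<open>From the space to the Rips complex\<close>

text \<open>The counterpart of \<open>length_functor\<close>. The functor on the realization stays
  abstract because homology uses one for each coefficient; in every application \<open>Q\<close> is
  the group of the Rips complex itself.\<close>

locale rips_functor = path_functor Q "realization (Rips r)" F
  for r :: real and Q :: "('q, 'm) monoid_scheme" (structure)
    and F :: "(real \<Rightarrow> 'a::metric_space \<Rightarrow> real) \<Rightarrow> 'q" +
  assumes r_pos: "0 < r"
begin

sublocale realization_functor "Rips r" Q F
  using complex_Rips path_functor_axioms by (simp add: realization_functor_def)

definition \<psi> :: "'a \<Rightarrow> 'a \<Rightarrow> 'q" where "\<psi> x y = F (realization_edge x y)"

lemma \<psi>_closed: "dist x y < r \<Longrightarrow> \<psi> x y \<in> carrier Q"
  unfolding \<psi>_def using r_pos by (simp add: pathin_realization_edge Rips_edge)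

text \<open>The three points span a simplex of the Rips complex, in which the edge path around the
  corner deforms to the third edge.\<close>

lemma \<psi>_cocycle:
  assumes "dist x y < r" "dist y z < r" "dist x z < r"
  shows "\<psi> x y \<otimes> \<psi> y z = \<psi> x z"
proof -
  have s: "{x, y, z} \<in> Rips r" using Rips_triangle r_pos assms by blast
  have "path_homotopic (realization (Rips r)) (segment_to (indicator {x}) z)
      (segment_to (indicator {x}) y +++ realization_edge y z)"
    using s by (rule segment_triangle[rotated]) (auto intro: indicator_closed_simplex)
  then have "F (realization_edge x z) = F (realization_edge x y +++ realization_edge y z)"
    unfolding realization_edge_segment[symmetric] by (rule F_homotopic)
  also have "\<dots> = \<psi> x y \<otimes> \<psi> y z"
    unfolding \<psi>_def using assms r_pos by (intro F_join pathin_realization_edge) (auto simp: Rips_edge)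
  finally show ?thesis by (simp add: \<psi>_def)
qed

text \<open>Each point is the centre of its own ball, so the selection is the identity. Two balls of
  radius \<open>r / 2\<close> with a common point have centres at distance less than
  \<open>r\<close>.\<close>

lemma cech_mu: "cech_cocycle Q (euclidean :: 'a topology) (\<lambda>x. ball x (r / 2)) (\<lambda>x. x) \<psi>"
proof unfold_locales
  have d: "dist u v < r" if "y \<in> ball u (r / 2)" "y \<in> ball v (r / 2)" for u v y :: 'a
    using dist_triangle_half_r[of y u r v] that by (simp add: dist_commute)
  show "\<psi> u v \<in> carrier Q" if "y \<in> ball u (r / 2)" "y \<in> ball v (r / 2)" for u v y
    using that d by (blast intro: \<psi>_closed)
  show "\<psi> u v \<otimes> \<psi> v w = \<psi> u w"
    if "y \<in> ball u (r / 2)" "y \<in> ball v (r / 2)" "y \<in> ball w (r / 2)" for u v w y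
    using that d by (blast intro: \<psi>_cocycle)
qed (use r_pos in auto)

definition Mu :: "(real \<Rightarrow> 'a) \<Rightarrow> 'q" where
  "Mu = cech_cocycle.hol Q (\<lambda>x. ball x (r / 2)) (\<lambda>x. x) \<psi>"

lemma path_functor_Mu: "path_functor Q euclidean Mu"
  unfolding Mu_def by (rule cech_cocycle.path_functor_hol[OF cech_mu])

lemma \<psi>_refl: "\<psi> x x = \<one>"
  using \<psi>_cocycle[of x x x] \<psi>_closed[of x x] r_pos by (simp add: l_cancel_one)

text \<open>Labels are taken at the nodes of a fine subdivision of the path. Balls around distant
  nodes need not meet, but all nodes are within \<open>r\<close> of each other, and
  \<open>\<psi>_cocycle\<close> asks for no more than that; the word therefore collapses to a single
  edge.\<close>

lemma Mu_small:
  assumes p: "path p" and d: "\<And>s t. 0 \<le> s \<Longrightarrow> s \<le> 1 \<Longrightarrow> 0 \<le> t \<Longrightarrow> t \<le> 1 \<Longrightarrow> dist (p s) (p t) < r"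
  shows "Mu p = \<psi> (p 0) (p 1)"
proof -
  interpret C: cech_cocycle Q "euclidean :: 'a topology" "\<lambda>x. ball x (r / 2)" "\<lambda>x. x" \<psi> by (rule cech_mu)
  have "uniformly_continuous_on {0..1} p"
    using p by (simp add: path_def compact_uniformly_continuous)
  then obtain \<delta> where \<delta>: "0 < \<delta>" "\<And>s t. s \<in> {0..1} \<Longrightarrow> t \<in> {0..1} \<Longrightarrow> dist s t < \<delta> \<Longrightarrow> dist (p s) (p t) < r / 2"
    using r_pos unfolding uniformly_continuous_on_def by (metis half_gt_zero)
  obtain n' where n': "inverse (real (Suc n')) < \<delta>" using reals_Archimedean[OF \<delta>(1)] by blast
  define n where "n = Suc n'"
  have n: "0 < n" by (simp add: n_def)
  define w where "w j = p (real j / real n)" for j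
  have g: "0 \<le> real j / real n" "real j / real n \<le> 1" if "j \<le> n" for j
    using that n by auto
  have c: "C.chain p n w"
    unfolding C.chain_def
  proof (intro conjI allI impI n)
    fix j t assume j: "j < n" and t: "real j \<le> t * real n \<and> t * real n \<le> real (Suc j)"
    have t': "real j / real n \<le> t" "t \<le> real (Suc j) / real n"
      using t n by (auto simp: field_simps)
    have "real (Suc j) / real n = real j / real n + inverse (real n)" using n by (simp add: field_simps)
    then have "dist (real j / real n) t < \<delta>" using t' n' by (simp add: dist_real_def n_def)
    moreover have "t \<in> {real j / real n..real (Suc j) / real n}" "real j / real n \<in> {0..1}"
      using t' g[of j] j by auto
    moreover from this(1) have "t \<in> {0..1}" using grid_interval[OF j] by blast
    ultimately show "p t \<in> ball (w j) (r / 2)"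
      using \<delta>(2) by (simp add: w_def)
  qed
  have dd: "dist (w i) (w j) < r" if "i \<le> n" "j \<le> n" for i j
    unfolding w_def using g that by (intro d) auto
  have w0: "w 0 = p 0" and wn: "w n = p 1" using n by (auto simp: w_def)
  have wj: "C.walk p w j = \<psi> (w 0) (w j)" if "j < n" for j
    using that
  proof (induct j)
    case (Suc j)
    \<comment> \<open>Here the relation among edges is used for the triple of the first node and two
      consecutive ones, whose balls may have no common point.\<close>
    then show ?case using \<psi>_cocycle[of "w 0" "w j" "w (Suc j)"] dd by simp
  qed (simp add: w0)
  have "\<psi> (w 0) (w (n - 1)) \<otimes> \<psi> (w (n - 1)) (w n) = \<psi> (w 0) (w n)"
    by (intro \<psi>_cocycle dd) auto
  then show ?thesis
    unfolding Mu_def C.hol_eq[OF c] C.word_def using wj[of "n - 1"] n by (simp add: w0 wn)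
qed

text \<open>A geodesic has diameter equal to its length, so each side of a filling of an
  \<open>r\<close>-loop is small in the sense of \<open>Mu_small\<close> and goes to the
  corresponding edge.\<close>

lemma Mu_filling:
  assumes "filling xs g" "2 \<le> length xs" "successively (\<lambda>x y. dist x y < r) xs"
  shows "Mu g = F (edge_path xs)"
proof -
  interpret m: path_functor Q "euclidean :: 'a topology" Mu by (rule path_functor_Mu)
  obtain ps where ps: "ps \<noteq> []" "g = concat_paths ps" "Suc (length ps) = length xs"
    "\<And>i. i < length ps \<Longrightarrow> geodesic (xs ! i) (xs ! Suc i) (ps ! i)"
    "successively (\<lambda>p q. p 1 = q 0) ps" "\<And>p. p \<in> set ps \<Longrightarrow> path p"
    "hd ps 0 = hd xs" "last ps 1 = last xs"
    by (rule fillingE[OF assms(1,2)]) (rule that)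
  have s: "successively (\<lambda>x y. {x, y} \<in> Rips r) xs" using assms(3) r_pos by (simp add: Rips_edge)
  have "map Mu ps = map2 (\<lambda>x y. F (realization_edge x y)) xs (tl xs)"
  proof (rule nth_equalityI)
    show "length (map Mu ps) = length (map2 (\<lambda>x y. F (realization_edge x y)) xs (tl xs))"
      using ps by simp
    fix i assume "i < length (map Mu ps)"
    then have i: "i < length ps" by simp
    have d: "dist (xs ! i) (xs ! Suc i) < r"
      using assms(3) i ps(3) by (auto simp: successively_conv_nth)
    note g = geodesicD[OF ps(4)[OF i]]
    have "Mu (ps ! i) = \<psi> ((ps ! i) 0) ((ps ! i) 1)"
      by (rule Mu_small[OF g(1)]) (rule le_less_trans[OF g(5) d])
    then show "map Mu ps ! i = map2 (\<lambda>x y. F (realization_edge x y)) xs (tl xs) ! i"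
      using i ps(3) g by (simp add: nth_tl \<psi>_def)
  qed
  then show ?thesis
    unfolding F_edge_path[OF assms(2) s] using m.F_concat_paths[OF ps(1,5)] ps by simp
qed

lemma Mu_small_loop:
  assumes p: "path p" "p 1 = p 0" "path_length p < ereal (3 * r)"
  shows "Mu p = \<one>"
proof -
  interpret m: path_functor Q "euclidean :: 'a topology" Mu by (rule path_functor_Mu)
  obtain s t where st: "0 \<le> s" "s \<le> t" "t \<le> 1"
    "arc_length p 0 s < ereal r" "arc_length p s t < ereal r" "arc_length p t 1 < ereal r"
    using trisect_path[OF p(1,3)] .
  have piece: "Mu (restrict_path a c p) = \<psi> (p a) (p c)" "dist (p a) (p c) < r"
    if "0 \<le> a" "a \<le> c" "c \<le> 1" "arc_length p a c < ereal r" for a c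
  proof -
    have q: "path (restrict_path a c p)"
      using pathin_subpath[of euclidean p a c] that p by simp
    have len: "path_length (restrict_path a c p) < ereal r"
      using path_length_restrict_path[OF that(2), of p] that(4) by simp
    have "dist (restrict_path a c p s) (restrict_path a c p t) < r" if "0 \<le> s" "s \<le> 1" "0 \<le> t" "t \<le> 1" for s t
      using dist_le_arc_length[of s 0 1 t "restrict_path a c p"] len that
      by (simp add: path_length_arc) (metis le_less_trans less_ereal.simps(1))
    from Mu_small[OF q this] this[of 0 1]
    show "Mu (restrict_path a c p) = \<psi> (p a) (p c)" "dist (p a) (p c) < r"
      by (auto simp: restrict_path_def)
  qed
  have "Mu p = Mu (restrict_path 0 1 p)" by (simp add: restrict_path_def)
  also have "\<dots> = Mu (restrict_path 0 t p) \<otimes> Mu (restrict_path t 1 p)"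
    using st p by (intro m.F_subpath) auto
  also have "Mu (restrict_path 0 t p) = Mu (restrict_path 0 s p) \<otimes> Mu (restrict_path s t p)"
    using st p by (intro m.F_subpath) auto
  also have "\<dots> = \<psi> (p 0) (p s) \<otimes> \<psi> (p s) (p t)"
    using piece(1)[of 0 s] piece(1)[of s t] st by simp
  \<comment> \<open>The bound on the distance from \<open>p 0\<close> to \<open>p t\<close> comes
    from the third arc, since the loop ends where it starts. With it the three division points span
    a simplex.\<close>
  also have "\<dots> = \<psi> (p 0) (p t)"
    using piece(2)[of 0 s] piece(2)[of s t] piece(2)[of t 1] st p
    by (intro \<psi>_cocycle) (auto simp: dist_commute)
  also have "Mu (restrict_path t 1 p) = \<psi> (p t) (p 0)"
    using piece(1)[of t 1] st p by simp
  also have "\<psi> (p 0) (p t) \<otimes> \<psi> (p t) (p 0) = \<psi> (p 0) (p 0)"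
    using piece(2)[of t 1] st p r_pos by (intro \<psi>_cocycle) (auto simp: dist_commute)
  finally show ?thesis by (simp add: \<psi>_refl)
qed

end

section \<open>The fundamental group\<close>

lemma loop_inD: "loop_in X a g \<Longrightarrow> pathin X g \<and> g 0 = a \<and> g 1 = a"
  by (simp add: loop_in_def)

lemma mem_loop_class: "loop_in X a g \<Longrightarrow> h \<in> loop_class X a g \<longleftrightarrow> path_homotopic X g h"
  by (simp add: loop_class_def path_homotopic_def loop_in_def)

lemma loop_class_eq:
  assumes "loop_in X a g" "path_homotopic X g h"
  shows "loop_class X a h = loop_class X a g"
proof -
  have "loop_in X a h" using assms path_homotopicD[OF assms(2)] by (auto simp: loop_in_def)
  moreover have "path_homotopic X h x \<longleftrightarrow> path_homotopic X g x" for x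
    using assms(2) path_homotopic_trans path_homotopic_sym by blast
  ultimately show ?thesis
    using assms(1) by (auto simp: mem_loop_class)
qed

lemma loop_class_eq_iff:
  assumes "loop_in X a g" "loop_in X a h"
  shows "loop_class X a g = loop_class X a h \<longleftrightarrow> path_homotopic X g h"
  using loop_class_eq[OF assms(1), of h] mem_loop_class[OF assms(1), of h] mem_loop_class[OF assms(2), of h]
    path_homotopic_refl[of X h] loop_inD[OF assms(2)] by blast

lemma loop_in_join: "loop_in X a g \<Longrightarrow> loop_in X a h \<Longrightarrow> loop_in X a (g +++ h)"
  by (auto simp: loop_in_def intro: pathin_join)

lemma loop_in_reversepath: "loop_in X a g \<Longrightarrow> loop_in X a (reversepath g)"
  by (auto simp: loop_in_def pathin_reversepath) (auto simp: reversepath_def)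

text \<open>The union in the definition of the product runs over representatives, all of which give
  the same class.\<close>

lemma pi1_mult:
  assumes g: "loop_in X a g" and h: "loop_in X a h"
  shows "loop_class X a g \<otimes>\<^bsub>fundamental_group X a\<^esub> loop_class X a h = loop_class X a (g +++ h)"
proof -
  let ?C = "loop_class X a g" and ?D = "loop_class X a h"
  have eq: "loop_class X a (g' +++ h') = loop_class X a (g +++ h)"
    if "g' \<in> loop_class X a g" "h' \<in> loop_class X a h" for g' h'
    using that loop_inD[OF g] loop_inD[OF h]
    by (intro loop_class_eq[OF loop_in_join[OF g h]] path_homotopic_join) (auto simp: mem_loop_class[OF g] mem_loop_class[OF h])
  have "g \<in> ?C" "h \<in> ?D"
    using g h by (auto simp: mem_loop_class loop_inD path_homotopic_refl)
  then have ne: "?C \<noteq> {}" "?D \<noteq> {}" by blast+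
  have "(\<Union>g'\<in>?C. \<Union>h'\<in>?D. loop_class X a (g' +++ h')) = (\<Union>g'\<in>?C. \<Union>h'\<in>?D. loop_class X a (g +++ h))"
    by (intro SUP_cong refl eq)
  also have "\<dots> = loop_class X a (g +++ h)" using ne by simp
  finally show ?thesis by (simp add: fundamental_group_def)
qed

lemma pi1_carrier: "C \<in> carrier (fundamental_group X a) \<longleftrightarrow> (\<exists>g. loop_in X a g \<and> C = loop_class X a g)"
  by (auto simp: fundamental_group_def)

lemma pi1_class_closed [simp]: "loop_in X a g \<Longrightarrow> loop_class X a g \<in> carrier (fundamental_group X a)"
  by (auto simp: pi1_carrier)

lemma pi1_one: "\<one>\<^bsub>fundamental_group X a\<^esub> = loop_class X a (\<lambda>_. a)"
  by (simp add: fundamental_group_def)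

lemma loop_in_const: "a \<in> topspace X \<Longrightarrow> loop_in X a (\<lambda>_. a)"
  by (simp add: loop_in_def)

lemma pi1_inverse:
  assumes "loop_in X a g"
  shows "loop_class X a (reversepath g) \<otimes>\<^bsub>fundamental_group X a\<^esub> loop_class X a g = \<one>\<^bsub>fundamental_group X a\<^esub>"
proof -
  have "path_homotopic X (\<lambda>_. reversepath g 0) (reversepath g +++ reversepath (reversepath g))"
    using assms by (intro path_homotopic_join_reverse pathin_reversepath) (simp add: loop_in_def)
  moreover have "reversepath g 0 = a" using assms by (simp add: reversepath_def loop_in_def)
  ultimately have "path_homotopic X (\<lambda>_. a) (reversepath g +++ g)" by (simp add: reversepath_reversepath)
  moreover have "a \<in> topspace X" using assms path_start_in_topspace[of X g] by (auto simp: loop_in_def)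
  ultimately show ?thesis
    using assms by (simp add: pi1_mult loop_in_reversepath pi1_one loop_class_eq[OF loop_in_const])
qed

lemma group_pi1:
  assumes a: "a \<in> topspace X"
  shows "group (fundamental_group X a)"
proof (rule groupI)
  let ?G = "fundamental_group X a"
  show "x \<otimes>\<^bsub>?G\<^esub> y \<in> carrier ?G" if xy: "x \<in> carrier ?G" "y \<in> carrier ?G" for x y
  proof -
    obtain g h where "loop_in X a g" "loop_in X a h" "x = loop_class X a g" "y = loop_class X a h"
      using xy unfolding pi1_carrier by blast
    then show ?thesis by (simp add: pi1_mult loop_in_join)
  qed
  show "\<one>\<^bsub>?G\<^esub> \<in> carrier ?G" using a by (simp add: pi1_one loop_in_const)
  show "x \<otimes>\<^bsub>?G\<^esub> y \<otimes>\<^bsub>?G\<^esub> z = x \<otimes>\<^bsub>?G\<^esub> (y \<otimes>\<^bsub>?G\<^esub> z)"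
    if in_G: "x \<in> carrier ?G" "y \<in> carrier ?G" "z \<in> carrier ?G" for x y z
  proof -
    obtain f g h where l: "loop_in X a f" "loop_in X a g" "loop_in X a h"
      and xyz: "x = loop_class X a f" "y = loop_class X a g" "z = loop_class X a h"
      using in_G unfolding pi1_carrier by blast
    have "path_homotopic X ((f +++ g) +++ h) (f +++ (g +++ h))"
      using l by (intro path_homotopic_assoc) (auto simp: loop_in_def)
    then show ?thesis
      using l by (simp add: xyz pi1_mult loop_in_join loop_class_eq_iff)
  qed
  show "\<one>\<^bsub>?G\<^esub> \<otimes>\<^bsub>?G\<^esub> x = x" if x: "x \<in> carrier ?G" for x
  proof -
    obtain g where g: "loop_in X a g" "x = loop_class X a g" using x by (auto simp: pi1_carrier)
    have "path_homotopic X g ((\<lambda>_. a) +++ g)"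
      using path_homotopic_const_join[of X g] g by (simp add: loop_in_def)
    then show ?thesis
      using g a by (simp add: pi1_one pi1_mult loop_in_const loop_class_eq)
  qed
  show "\<exists>y\<in>carrier ?G. y \<otimes>\<^bsub>?G\<^esub> x = \<one>\<^bsub>?G\<^esub>" if x: "x \<in> carrier ?G" for x
  proof -
    obtain g where "loop_in X a g" "x = loop_class X a g" using x unfolding pi1_carrier by blast
    then show ?thesis
      using pi1_inverse pi1_class_closed[OF loop_in_reversepath] by blast
  qed
qed

lemma pi1_inv:
  assumes "loop_in X a g"
  shows "inv\<^bsub>fundamental_group X a\<^esub> loop_class X a g = loop_class X a (reversepath g)"
proof -
  have "a \<in> topspace X" using assms path_start_in_topspace[of X g] by (auto simp: loop_in_def)
  then interpret group "fundamental_group X a" by (rule group_pi1)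
  show ?thesis
    using assms pi1_inverse[OF assms] by (intro inv_equality) (auto simp: loop_in_reversepath)
qed

section \<open>Path functors and the fundamental group\<close>

definition functor_hom :: "((real \<Rightarrow> 'y) \<Rightarrow> 'q) \<Rightarrow> (real \<Rightarrow> 'y) set \<Rightarrow> 'q" where
  "functor_hom F C = F (SOME g. g \<in> C)"

context path_functor begin

text \<open>Whichever representative is chosen, it is homotopic to \<open>g\<close>, and
  \<open>F\<close> does not see the difference.\<close>

lemma functor_hom_class:
  assumes "loop_in Y a g" shows "functor_hom F (loop_class Y a g) = F g"
proof -
  have "g \<in> loop_class Y a g" using assms by (simp add: mem_loop_class loop_inD path_homotopic_refl)
  then have "(SOME h. h \<in> loop_class Y a g) \<in> loop_class Y a g"
    by (rule someI[of "\<lambda>h. h \<in> loop_class Y a g"])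
  then show ?thesis
    unfolding functor_hom_def mem_loop_class[OF assms] by (simp add: F_homotopic)
qed

lemma functor_hom: "functor_hom F \<in> hom (fundamental_group Y a) Q"
proof (rule homI)
  show "functor_hom F x \<in> carrier Q" if "x \<in> carrier (fundamental_group Y a)" for x
    using that by (auto simp: pi1_carrier functor_hom_class loop_inD)
  show "functor_hom F (x \<otimes>\<^bsub>fundamental_group Y a\<^esub> y) = functor_hom F x \<otimes> functor_hom F y"
    if "x \<in> carrier (fundamental_group Y a)" "y \<in> carrier (fundamental_group Y a)" for x y
    using that by (auto simp: pi1_carrier functor_hom_class pi1_mult loop_in_join F_join loop_inD)
qed

end

lemma reversepath_ends [simp]: "reversepath p 0 = p 1" "reversepath p 1 = p 0"
  by (simp_all add: reversepath_def)

text \<open>Connecting paths from \<open>b\<close> close every path up to a based loop. The path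
  chosen at \<open>b\<close> is constant, so that loops already based at \<open>b\<close> keep their
  class.\<close>

locale base_paths =
  fixes Y :: "'y::topological_space topology" and b :: 'y and c :: "'y \<Rightarrow> real \<Rightarrow> 'y"
  assumes c_path: "y \<in> topspace Y \<Longrightarrow> pathin Y (c y) \<and> c y 0 = b \<and> c y 1 = y"
    and c_base: "c b = (\<lambda>_. b)" and b: "b \<in> topspace Y"
begin

definition based :: "(real \<Rightarrow> 'y) \<Rightarrow> (real \<Rightarrow> 'y)" where
  "based p = c (p 0) +++ (p +++ reversepath (c (p 1)))"

definition based_class :: "(real \<Rightarrow> 'y) \<Rightarrow> (real \<Rightarrow> 'y) set" where
  "based_class p = loop_class Y b (based p)"

lemma c_ends:
  assumes "pathin Y p"
  shows "pathin Y (c (p 0))" "c (p 0) 0 = b" "c (p 0) 1 = p 0"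
    "pathin Y (c (p 1))" "c (p 1) 0 = b" "c (p 1) 1 = p 1"
  using c_path[OF path_start_in_topspace[OF assms]] c_path[OF path_finish_in_topspace[OF assms]] by auto

lemma based_loop: "pathin Y p \<Longrightarrow> loop_in Y b (based p)"
  unfolding based_def loop_in_def using c_ends[of p]
  by (auto intro!: pathin_join pathin_reversepath)

text \<open>The connecting path to the junction is traversed back and then forth, and this excursion
  is contracted.\<close>

lemma based_join:
  assumes p: "pathin Y p" and q: "pathin Y q" and pq: "p 1 = q 0"
  shows "path_homotopic Y (based p +++ based q) (based (p +++ q))"
proof -
  let ?a = "c (p 0)" and ?m = "c (q 0)" and ?d = "reversepath (c (q 1))"
  let ?r = "reversepath ?m" and ?X = "q +++ ?d"
  note cp = c_ends[OF p] and cq = c_ends[OF q]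
  have pr: "pathin Y ?r" "pathin Y ?d" "pathin Y ?X" "pathin Y (p +++ ?r)" "pathin Y (?m +++ ?X)"
    "pathin Y (?r +++ ?m)" "pathin Y (p +++ q)"
    using p q pq cp cq by (auto intro!: pathin_join pathin_reversepath)
  have "path_homotopic Y (?r +++ (?m +++ ?X)) ((?r +++ ?m) +++ ?X)"
    by (rule path_homotopic_sym[OF path_homotopic_assoc]) (use pr cq in auto)
  moreover have "path_homotopic Y ((?r +++ ?m) +++ ?X) ((\<lambda>_. q 0) +++ ?X)"
  proof (rule path_homotopic_join)
    have "path_homotopic Y (\<lambda>_. ?r 0) (?r +++ reversepath ?r)"
      by (rule path_homotopic_join_reverse[OF pr(1)])
    then show "path_homotopic Y (?r +++ ?m) (\<lambda>_. q 0)"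
      using cq path_homotopic_sym by fastforce
    show "path_homotopic Y ?X ?X" by (rule path_homotopic_refl[OF pr(3)])
    show "(?r +++ ?m) 1 = ?X 0" using cq by simp
  qed
  moreover have "path_homotopic Y ((\<lambda>_. q 0) +++ ?X) ?X"
    using path_homotopic_sym[OF path_homotopic_const_join[OF pr(3)]] by simp
  ultimately have 1: "path_homotopic Y (?r +++ (?m +++ ?X)) ?X"
    by (blast intro: path_homotopic_trans)
  have "path_homotopic Y ((p +++ ?r) +++ (?m +++ ?X)) (p +++ (?r +++ (?m +++ ?X)))"
    by (rule path_homotopic_assoc) (use p pr cq pq in auto)
  moreover have "path_homotopic Y (p +++ (?r +++ (?m +++ ?X))) (p +++ ?X)"
    by (rule path_homotopic_join[OF path_homotopic_refl[OF p] 1]) (use cq pq in auto)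
  moreover have "path_homotopic Y (p +++ ?X) ((p +++ q) +++ ?d)"
    by (rule path_homotopic_sym[OF path_homotopic_assoc]) (use p q pq pr cq in auto)
  ultimately have 2: "path_homotopic Y ((p +++ ?r) +++ (?m +++ ?X)) ((p +++ q) +++ ?d)"
    by (blast intro: path_homotopic_trans)
  have "path_homotopic Y ((?a +++ (p +++ ?r)) +++ (?m +++ ?X)) (?a +++ ((p +++ ?r) +++ (?m +++ ?X)))"
    by (rule path_homotopic_assoc) (use pr cp cq pq in auto)
  moreover have "path_homotopic Y (?a +++ ((p +++ ?r) +++ (?m +++ ?X))) (?a +++ ((p +++ q) +++ ?d))"
    by (rule path_homotopic_join[OF path_homotopic_refl[OF cp(1)] 2]) (use cp in auto)
  ultimately show ?thesis
    unfolding based_def using pq by (auto intro: path_homotopic_trans)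
qed

text \<open>This is the retraction of the fundamental groupoid onto the group at \<open>b\<close>.
  It loses nothing about loops at \<open>b\<close>, so an identity among its values on such loops is
  a homotopy.\<close>

lemma path_functor_based: "path_functor (fundamental_group Y b) Y based_class"
proof -
  interpret G: group "fundamental_group Y b" by (rule group_pi1[OF b])
  show ?thesis
  proof unfold_locales
    show "based_class p \<in> carrier (fundamental_group Y b)" if "pathin Y p" for p
      using that by (simp add: based_class_def based_loop)
    show "based_class p = based_class q" if h: "path_homotopic Y p q" for p q
    proof -
      note pq = path_homotopicD[OF h]
      have "path_homotopic Y (based p) (based q)"
        unfolding based_def using h pq c_ends[OF pq(1)]
        by (auto intro!: path_homotopic_join path_homotopic_refl pathin_reversepath)
      then show ?thesis
        unfolding based_class_def using loop_class_eq[OF based_loop[OF pq(1)]] by simp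
    qed
    show "based_class (p +++ q) = based_class p \<otimes>\<^bsub>fundamental_group Y b\<^esub> based_class q"
      if "pathin Y p" "pathin Y q" "p 1 = q 0" for p q
      unfolding based_class_def
      using that based_join[OF that] by (simp add: pi1_mult based_loop loop_class_eq loop_in_join)
  qed
qed

lemma based_class_loop:
  assumes g: "loop_in Y b g"
  shows "based_class g = loop_class Y b g"
proof -
  interpret path_functor "fundamental_group Y b" Y based_class by (rule path_functor_based)
  let ?G = "fundamental_group Y b" and ?k = "\<lambda>_. b"
  have k: "loop_in Y b ?k" "reversepath ?k = ?k" using b by (auto simp: loop_in_const reversepath_def)
  have "based_class g = loop_class Y b (?k +++ (g +++ ?k))"
    unfolding based_class_def based_def using g k by (simp add: loop_in_def c_base)
  also have "\<dots> = loop_class Y b ?k \<otimes>\<^bsub>?G\<^esub> (loop_class Y b g \<otimes>\<^bsub>?G\<^esub> loop_class Y b ?k)"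
    using g k by (simp add: pi1_mult loop_in_join)
  also have "\<dots> = loop_class Y b g"
    using g unfolding pi1_one[symmetric] by simp
  finally show ?thesis .
qed

end

text \<open>Apply \<open>F_eq_edge_path\<close> to the functor \<open>based_class\<close>: for loops
  at the base vertex equality of values means being homotopic. No separate simplicial approximation
  is needed.\<close>

lemma loop_homotopic_edge_path:
  assumes "base_paths (realization K) (indicator {b}) c" and "complex K"
    and g: "pathin (realization K) g" "g 0 = indicator {b}" "g 1 = indicator {b}"
  obtains xs where "2 \<le> length xs" "successively (\<lambda>x y. {x, y} \<in> K) xs" "hd xs = b" "last xs = b"
    "path_homotopic (realization K) g (edge_path xs)"
proof -
  interpret B: base_paths "realization K" "indicator {b}" c by fact
  interpret K: complex K by fact
  interpret F: path_functor "fundamental_group (realization K) (indicator {b})" "realization K" B.based_class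
    by (rule B.path_functor_based)
  interpret F: realization_functor K "fundamental_group (realization K) (indicator {b})" B.based_class
    by unfold_locales
  obtain xs where xs: "2 \<le> length xs" "successively (\<lambda>x y. {x, y} \<in> K) xs" "hd xs = b" "last xs = b"
    "B.based_class g = B.based_class (edge_path xs)"
    using F.F_eq_edge_path[OF g] .
  have "loop_in (realization K) (indicator {b}) g" "loop_in (realization K) (indicator {b}) (edge_path xs)"
    using g K.edge_path_pathin[OF xs(1,2)] xs by (auto simp: loop_in_def)
  then show thesis
    using that xs by (simp add: B.based_class_loop loop_class_eq_iff)
qed

section \<open>Group-theoretic criterion\<close>

text \<open>A relation compatible with the group operations acts like a subgroup of the product; if
  every generator has a partner in \<open>B\<close>, then so has every generated element.\<close>

lemma generate_witness:
  assumes "group A" "E \<subseteq> carrier A" "a \<in> generate A E"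
    and one: "P \<one>\<^bsub>A\<^esub> \<one>\<^bsub>B\<^esub>"
    and mult: "\<And>a a' f f'. a \<in> carrier A \<Longrightarrow> a' \<in> carrier A \<Longrightarrow> f \<in> carrier B \<Longrightarrow> f' \<in> carrier B \<Longrightarrow>
      P a f \<Longrightarrow> P a' f' \<Longrightarrow> P (a \<otimes>\<^bsub>A\<^esub> a') (f \<otimes>\<^bsub>B\<^esub> f')"
    and inv: "\<And>a f. a \<in> carrier A \<Longrightarrow> f \<in> carrier B \<Longrightarrow> P a f \<Longrightarrow> P (inv\<^bsub>A\<^esub> a) (inv\<^bsub>B\<^esub> f)"
    and gen: "\<And>e. e \<in> E \<Longrightarrow> \<exists>f\<in>carrier B. P e f" and B: "group B"
  shows "\<exists>f\<in>carrier B. P a f"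
  using assms(3)
proof (induct rule: generate.induct)
  case one
  show ?case using assms(4) group.is_monoid[OF B] monoid.one_closed by blast
next
  case (incl h)
  then show ?case by (rule gen)
next
  case (inv h)
  then obtain f where "f \<in> carrier B" "P h f" using gen by blast
  then show ?case
    using assms(2) inv assms(6) group.inv_closed[OF B] by blast
next
  case (eng h1 h2)
  then obtain f1 f2 where "f1 \<in> carrier B" "P h1 f1" "f2 \<in> carrier B" "P h2 f2" by blast
  moreover have "h1 \<in> carrier A" "h2 \<in> carrier A"
    using eng group.generate_in_carrier[OF assms(1,2)] by auto
  ultimately show ?case
    using mult monoid.m_closed[OF group.is_monoid[OF B]] by blast
qed

text \<open>The witness \<open>f\<close> represents \<open>lam a\<close> and is sent back to
  \<open>a\<close> by \<open>mu\<close>. If \<open>lam a\<close> is trivial then \<open>f\<close>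
  lies in \<open>N\<close>, which \<open>mu\<close> kills, so \<open>a\<close> is trivial. Thus
  \<open>mu\<close> serves as an inverse without being factored through the quotient.\<close>

lemma iso_criterion:
  assumes A: "group A" and Q: "group Q" and S: "subgroup S Q" and N: "N \<lhd> (Q\<lparr>carrier := S\<rparr>)"
    and lam: "lam \<in> hom A ((Q\<lparr>carrier := S\<rparr>) Mod N)" and mu: "mu \<in> hom Q A"
    and muN: "\<And>n. n \<in> N \<Longrightarrow> mu n = \<one>\<^bsub>A\<^esub>"
    and wit: "\<And>a. a \<in> carrier A \<Longrightarrow> \<exists>f\<in>S. lam a = N #>\<^bsub>Q\<lparr>carrier := S\<rparr>\<^esub> f \<and> mu f = a"
    and surj: "\<And>s. s \<in> S \<Longrightarrow> \<exists>a\<in>carrier A. lam a = N #>\<^bsub>Q\<lparr>carrier := S\<rparr>\<^esub> s"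
  shows "lam \<in> iso A ((Q\<lparr>carrier := S\<rparr>) Mod N)"
proof -
  let ?H = "Q\<lparr>carrier := S\<rparr>"
  interpret N: normal N ?H by (rule N)
  interpret h: group_hom A "?H Mod N" lam
    using A N.factorgroup_is_group lam by (simp add: group_hom_def group_hom_axioms_def)
  have "inj_on lam (carrier A)"
    unfolding h.inj_on_one_iff
  proof (intro allI impI)
    fix a assume a: "a \<in> carrier A" "lam a = \<one>\<^bsub>?H Mod N\<^esub>"
    then obtain f where f: "f \<in> S" "lam a = N #>\<^bsub>?H\<^esub> f" "mu f = a" using wit by blast
    then have "N #>\<^bsub>?H\<^esub> f = N" using a by (simp add: FactGroup_def)
    moreover have "f \<in> N #>\<^bsub>?H\<^esub> f" using N.rcos_self[of f] f(1) N.subgroup_axioms by simp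
    ultimately show "a = \<one>\<^bsub>A\<^esub>" using muN f(3) by metis
  qed
  moreover have "lam ` carrier A = carrier (?H Mod N)"
  proof
    show "carrier (?H Mod N) \<subseteq> lam ` carrier A"
    proof
      fix C assume "C \<in> carrier (?H Mod N)"
      then obtain s where "s \<in> S" "C = N #>\<^bsub>?H\<^esub> s" by (auto simp: FactGroup_def RCOSETS_def)
      then show "C \<in> lam ` carrier A" using surj[of s] by force
    qed
  qed auto
  ultimately show ?thesis using lam by (simp add: iso_def bij_betw_def)
qed

section \<open>The fundamental group of a geodesic space\<close>

text \<open>Paths are functions on all reals, and a geodesic is unconstrained outside the unit
  interval. At \<open>b\<close> itself the constant function is put in, as \<open>base_paths\<close>
  demands equality of functions.\<close>

definition geod_from :: "'a::metric_space \<Rightarrow> 'a \<Rightarrow> real \<Rightarrow> 'a" where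
  "geod_from b x = (if x = b then (\<lambda>_. b) else geod b x)"

lemma geod_from:
  fixes b x :: "'a::metric_space"
  assumes "geodesic_space TYPE('a)"
  shows "path (geod_from b x)" "geod_from b x 0 = b" "geod_from b x 1 = x"
    "path_length (geod_from b x) < \<infinity>"
  using geodesicD(1-4)[OF geodesic_geod[OF assms, of b x]]
  by (auto simp: geod_from_def path_length_const path_def)

lemma base_paths_geod_from:
  fixes b :: "'a::metric_space"
  assumes "geodesic_space TYPE('a)"
  shows "base_paths euclidean b (geod_from b)"
  by unfold_locales (use geod_from[OF assms] in \<open>auto simp: geod_from_def\<close>)

lemma successively_mono_dist:
  "successively (\<lambda>x y. dist x y < p) xs \<Longrightarrow> p \<le> q \<Longrightarrow> successively (\<lambda>x y. dist x y < (q::real)) xs"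
  by (erule successively_mono) (auto intro: less_le_trans)

text \<open>Subdividing a geodesic finely shows that the Rips complex is connected at every positive
  scale.\<close>

lemma chain_between:
  fixes x y :: "'a::metric_space"
  assumes "geodesic_space TYPE('a)" "0 < r"
  obtains xs where "2 \<le> length xs" "hd xs = x" "last xs = y"
    "successively (\<lambda>x y. dist x y < r) xs"
proof -
  let ?g = "geod x y"
  note g = geodesicD[OF geodesic_geod[OF assms(1), of x y]]
  obtain n where n: "0 < n"
    "\<And>j. j < n \<Longrightarrow> path_length (restrict_path (real j / real n) (real (Suc j) / real n) ?g) < ereal r"
    using uniform_small_pieces[OF g(1) _ assms(2)] g(4) by auto
  let ?xs = "map (\<lambda>j. ?g (real j / real n)) [0..<Suc n]"
  have "dist (?g (real j / real n)) (?g (real (Suc j) / real n)) < r" if "j < n" for j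
  proof -
    let ?p = "restrict_path (real j / real n) (real (Suc j) / real n) ?g"
    have "ereal (dist (?p 0) (?p 1)) \<le> path_length ?p"
      using dist_le_arc_length[of 0 0 1 1 ?p] by (simp add: path_length_arc)
    then have "ereal (dist (?p 0) (?p 1)) < ereal r" using n(2)[OF that] by (rule le_less_trans)
    then show ?thesis by (simp add: restrict_path_def)
  qed
  then show thesis
    using n(1) g by (intro that[of ?xs])
      (auto simp: successively_conv_nth hd_map last_map simp del: upt_Suc)
qed

lemma Rips_base_paths:
  fixes b :: "'a::metric_space"
  assumes geo: "geodesic_space TYPE('a)" and r: "0 < r"
  obtains c where "base_paths (realization (Rips r)) (indicator {b}) c"
proof -
  interpret K: complex "Rips r :: 'a set set" by (rule complex_Rips)
  let ?Y = "realization (Rips r :: 'a set set)"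
  have "\<exists>p. pathin ?Y p \<and> p 0 = indicator {b} \<and> p 1 = f" if f: "f \<in> topspace ?Y" for f
  proof -
    let ?v = "K.vertex_of f"
    obtain xs where xs: "2 \<le> length xs" "hd xs = b" "last xs = ?v" "successively (\<lambda>x y. dist x y < r) xs"
      using chain_between[OF geo r] .
    have s: "successively (\<lambda>x y. {x, y} \<in> Rips r) xs" using xs(4) r by (simp add: Rips_edge)
    note e = K.edge_path_pathin[OF xs(1) s]
    have sg: "pathin ?Y (segment_to f ?v)"
      using K.pathin_segment_to K.supp_in_K[OF f] K.star_supp(1)[OF K.star_vertex_of[OF f]] by blast
    \<comment> \<open>From the base vertex an edge path leads to a vertex of the support of
      \<open>f\<close>; the segment from \<open>f\<close> to that vertex is then followed
      backwards.\<close>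
    have "pathin ?Y (edge_path xs +++ reversepath (segment_to f ?v))"
      by (intro pathin_join pathin_reversepath e sg) (simp add: e xs reversepath_def)
    then show ?thesis
      by (rule exI[where x = "edge_path xs +++ reversepath (segment_to f ?v)", OF conjI])
         (simp add: e xs reversepath_def)
  qed
  then obtain c' where c': "\<And>f. f \<in> topspace ?Y \<Longrightarrow> pathin ?Y (c' f) \<and> c' f 0 = indicator {b} \<and> c' f 1 = f"
    by metis
  have b: "indicator {b} \<in> topspace ?Y"
    using r by (intro K.indicator_in_topspace) (simp add: Rips_iff)
  show thesis
    by (rule that[of "\<lambda>f. if f = indicator {b} then (\<lambda>_. indicator {b}) else c' f"], unfold_locales)
       (use b c' in auto)
qed

section \<open>Finite-length loops and lassos\<close>

definition finite_loops :: "'a::metric_space \<Rightarrow> (real \<Rightarrow> 'a) set set" where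
  "finite_loops b = {loop_class euclidean b g |g. loop_in euclidean b g \<and> path_length g < \<infinity>}"

abbreviation Fin_pi1 :: "'a::metric_space \<Rightarrow> (real \<Rightarrow> 'a) set monoid" where
  "Fin_pi1 b \<equiv> (pi1 b)\<lparr>carrier := finite_loops b\<rparr>"

lemma group_pi1_euclidean: "group (pi1 b)"
  by (rule group_pi1) simp

lemma path_length_reversepath_finite: "path_length p < \<infinity> \<Longrightarrow> path_length (reversepath p) < \<infinity>"
  using path_length_reversepath by (rule le_less_trans)

lemma lassoE:
  assumes "lasso b l g"
  obtains \<alpha> \<beta> where "path \<alpha>" "\<alpha> 0 = b" "path_length \<alpha> < \<infinity>" "path \<beta>" "\<beta> 0 = \<alpha> 1" "\<beta> 1 = \<alpha> 1"
    "path_length \<beta> = ereal l" "g = \<alpha> +++ (\<beta> +++ reversepath \<alpha>)"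
  using assms unfolding lasso_def pathstart_def pathfinish_def by blast

lemma lasso_loop:
  assumes "lasso b l g"
  shows "loop_in euclidean b g" "path_length g < \<infinity>"
proof -
  obtain \<alpha> \<beta> where ab: "path \<alpha>" "\<alpha> 0 = b" "path_length \<alpha> < \<infinity>" "path \<beta>" "\<beta> 0 = \<alpha> 1" "\<beta> 1 = \<alpha> 1"
    "path_length \<beta> = ereal l" "g = \<alpha> +++ (\<beta> +++ reversepath \<alpha>)"
    using assms by (rule lassoE)
  show "loop_in euclidean b g"
    unfolding loop_in_def ab(8) using ab by (auto simp: pathstart_def pathfinish_def)
  have "path_length (\<beta> +++ reversepath \<alpha>) < \<infinity>"
    using ab by (intro path_length_join_finite path_length_reversepath_finite) auto
  then show "path_length g < \<infinity>"
    unfolding ab(8) using ab by (intro path_length_join_finite[OF ab(3)]) auto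
qed

lemma subgroup_finite_loops: "subgroup (finite_loops b) (pi1 b)"
proof (rule group.subgroupI[OF group_pi1_euclidean])
  show "finite_loops b \<subseteq> carrier (pi1 b)" by (auto simp: finite_loops_def)
  have "loop_class euclidean b (\<lambda>_. b) \<in> finite_loops b"
    by (auto simp: finite_loops_def path_length_const loop_in_const)
  then show "finite_loops b \<noteq> {}" by blast
  show "inv\<^bsub>pi1 b\<^esub> a \<in> finite_loops b" if "a \<in> finite_loops b" for a
    using that loop_in_reversepath path_length_reversepath_finite
    by (fastforce simp: finite_loops_def pi1_inv)
  show "x \<otimes>\<^bsub>pi1 b\<^esub> y \<in> finite_loops b" if xy: "x \<in> finite_loops b" "y \<in> finite_loops b" for x y
  proof -
    obtain g h where gh: "loop_in euclidean b g" "path_length g < \<infinity>" "x = loop_class euclidean b g"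
      "loop_in euclidean b h" "path_length h < \<infinity>" "y = loop_class euclidean b h"
      using xy unfolding finite_loops_def by blast
    have "path_length (g +++ h) < \<infinity>"
      using gh by (intro path_length_join_finite) (auto simp: loop_in_def)
    then show ?thesis
      using gh loop_in_join[OF gh(1,4)] unfolding finite_loops_def by (auto simp: pi1_mult)
  qed
qed

lemma lasso_classes_closed: "{loop_class euclidean b g |g l. lasso b l g \<and> l < r} \<subseteq> finite_loops b"
  using lasso_loop unfolding finite_loops_def by blast

lemma subgroup_L_pi1: "subgroup (L_pi1 b r) (pi1 b)"
  unfolding L_pi1_def
  using lasso_classes_closed subgroup.subset[OF subgroup_finite_loops]
  by (intro group.generate_is_subgroup[OF group_pi1_euclidean]) blast

lemma L_pi1_finite_loops: "L_pi1 b r \<subseteq> finite_loops b"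
  unfolding L_pi1_def
  by (rule group.generate_subgroup_incl[OF group_pi1_euclidean lasso_classes_closed subgroup_finite_loops])

lemma L_pi1_mono: "p \<le> q \<Longrightarrow> L_pi1 b p \<subseteq> L_pi1 b q"
  unfolding L_pi1_def by (intro group.mono_generate[OF group_pi1_euclidean]) force

text \<open>In a geodesic space the connecting path is a geodesic, so closing up a loop with it
  yields a lasso whose head is that loop.\<close>

lemma based_lasso:
  fixes b :: "'a::metric_space"
  assumes geo: "geodesic_space TYPE('a)" and "path p" "p 1 = p 0" "path_length p = ereal l"
  shows "lasso b l (base_paths.based (geod_from b) p)"
proof -
  interpret B: base_paths euclidean b "geod_from b" by (rule base_paths_geod_from[OF geo])
  show ?thesis
    unfolding lasso_def B.based_def using assms geod_from[OF geo]
    by (intro exI[of _ "geod_from b (p 0)"] exI[of _ p]) (auto simp: pathstart_def pathfinish_def)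
qed

text \<open>A loop of finite length at \<open>b\<close> is homotopic to a lasso with constant tail
  whose head is the loop itself, and its length is below some integer. Conversely lassos have finite
  length.\<close>

lemma Lfin_carrier:
  fixes b :: "'a::metric_space"
  assumes geo: "geodesic_space TYPE('a)"
  shows "(\<Union>n::nat. L_pi1 b (real n)) = finite_loops b"
proof
  show "(\<Union>n::nat. L_pi1 b (real n)) \<subseteq> finite_loops b" using L_pi1_finite_loops by blast
  interpret B: base_paths euclidean b "geod_from b" by (rule base_paths_geod_from[OF geo])
  show "finite_loops b \<subseteq> (\<Union>n::nat. L_pi1 b (real n))"
  proof
    fix C assume "C \<in> finite_loops b"
    then obtain g where g: "loop_in euclidean b g" "path_length g < \<infinity>" "C = loop_class euclidean b g"
      by (auto simp: finite_loops_def)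
    obtain l where l: "path_length g = ereal l"
      using g(2) arc_length_nonneg[of g 0 1] by (cases "path_length g") (auto simp: path_length_arc)
    obtain n :: nat where n: "l < real n" using reals_Archimedean2 by blast
    have "lasso b l (B.based g)"
      using g l by (intro based_lasso[OF geo]) (auto simp: loop_in_def)
    moreover have "C = loop_class euclidean b (B.based g)"
      using B.based_class_loop[OF g(1)] g(3) by (simp add: B.based_class_def)
    ultimately have "C \<in> L_pi1 b (real n)"
      unfolding L_pi1_def using n by (intro generate.incl) blast
    then show "C \<in> (\<Union>n::nat. L_pi1 b (real n))" by blast
  qed
qed

lemma Lfin_pi1_eq:
  fixes b :: "'a::metric_space"
  assumes "geodesic_space TYPE('a)"
  shows "Lfin_pi1 b = Fin_pi1 b"
  by (simp add: Lfin_pi1_def Lfin_carrier[OF assms])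

lemma (in group) conj_generate:
  assumes x: "x \<in> carrier G" and E: "E \<subseteq> carrier G" "\<And>e. e \<in> E \<Longrightarrow> x \<otimes> e \<otimes> inv x \<in> E" and h: "h \<in> generate G E"
  shows "x \<otimes> h \<otimes> inv x \<in> generate G E"
  using h
proof (induct rule: generate.induct)
  case one
  show ?case using x by (simp add: generate.one)
next
  case (incl h)
  then show ?case using E by (auto intro: generate.incl)
next
  case (inv h)
  then have "inv (x \<otimes> h \<otimes> inv x) \<in> generate G E" using E by (auto intro: generate.inv)
  moreover have "inv (x \<otimes> h \<otimes> inv x) = x \<otimes> inv h \<otimes> inv x"
    using inv x E(1) by (simp add: inv_mult_group m_assoc subset_iff)
  ultimately show ?case by simp
next
  case (eng h1 h2)
  have c: "h1 \<in> carrier G" "h2 \<in> carrier G" using eng generate_in_carrier[OF E(1)] by auto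
  have "x \<otimes> (h1 \<otimes> h2) \<otimes> inv x = (x \<otimes> h1 \<otimes> inv x) \<otimes> (x \<otimes> h2 \<otimes> inv x)"
    using x c by (simp add: m_assoc inv_solve_left)
  then show ?case using eng by (simp add: generate.eng)
qed

text \<open>Conjugating a lasso by a loop \<open>g\<close> prolongs its tail to
  \<open>g +++ \<alpha>\<close> and leaves the length of its head unchanged. A tail must have finite
  length, hence normality inside the finite-length classes.\<close>

lemma L_pi1_normal:
  fixes b :: "'a::metric_space"
  assumes geo: "geodesic_space TYPE('a)"
  shows "L_pi1 b r \<lhd> Fin_pi1 b"
proof -
  interpret G: group "pi1 b" by (rule group_pi1_euclidean)
  interpret B: base_paths euclidean b "geod_from b" by (rule base_paths_geod_from[OF geo])
  interpret F: path_functor "pi1 b" euclidean B.based_class by (rule B.path_functor_based)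
  let ?H = "Fin_pi1 b" and ?E = "{loop_class euclidean b g |g l. lasso b l g \<and> l < r}"
  interpret H: group ?H by (rule G.subgroup_imp_group[OF subgroup_finite_loops])
  have sub: "subgroup (L_pi1 b r) ?H"
    using G.subgroup_incl[OF subgroup_L_pi1 subgroup_finite_loops L_pi1_finite_loops] .
  have fin: "finite_loops b \<subseteq> carrier (pi1 b)" by (rule subgroup.subset[OF subgroup_finite_loops])
  show ?thesis
    unfolding H.normal_inv_iff
  proof (intro conjI ballI sub)
    fix x h assume x: "x \<in> carrier ?H" and h: "h \<in> L_pi1 b r"
    from x obtain g where g: "loop_in euclidean b g" "path_length g < \<infinity>" "x = loop_class euclidean b g"
      by (auto simp: finite_loops_def)
    have "x \<otimes>\<^bsub>pi1 b\<^esub> h \<otimes>\<^bsub>pi1 b\<^esub> inv\<^bsub>pi1 b\<^esub> x \<in> L_pi1 b r"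
      unfolding L_pi1_def
    proof (rule G.conj_generate[OF _ _ _ h[unfolded L_pi1_def]])
      show "x \<in> carrier (pi1 b)" using x fin by auto
      show "?E \<subseteq> carrier (pi1 b)" by (rule subset_trans[OF lasso_classes_closed fin])
      fix e assume "e \<in> ?E"
      then obtain k l where k: "lasso b l k" "l < r" "e = loop_class euclidean b k" by blast
      obtain \<alpha> \<beta> where ab: "path \<alpha>" "\<alpha> 0 = b" "path_length \<alpha> < \<infinity>" "path \<beta>" "\<beta> 0 = \<alpha> 1" "\<beta> 1 = \<alpha> 1"
        "path_length \<beta> = ereal l" "k = \<alpha> +++ (\<beta> +++ reversepath \<alpha>)"
        using k(1) by (rule lassoE)
      let ?\<alpha> = "g +++ \<alpha>"
      have ga: "path ?\<alpha>" "path g" "g 0 = b" "g 1 = b"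
        using g ab by (auto simp: loop_in_def pathstart_def pathfinish_def)
      have l: "lasso b l (?\<alpha> +++ \<beta> +++ reversepath ?\<alpha>)"
        unfolding lasso_def
        using ab g ga path_length_join_finite[OF g(2) ab(3)]
        by (intro exI[of _ ?\<alpha>] exI[of _ \<beta>]) (auto simp: pathstart_def pathfinish_def)
      have rev: "path (reversepath \<alpha>)" "path (reversepath ?\<alpha>)" using ab(1) ga(1) by simp_all
      have b1: "path (\<beta> +++ reversepath \<alpha>)" "path (\<beta> +++ reversepath ?\<alpha>)"
        using ab ga by (auto simp: pathstart_def pathfinish_def)
      have F: "B.based_class g \<in> carrier (pi1 b)" "B.based_class \<alpha> \<in> carrier (pi1 b)" "B.based_class \<beta> \<in> carrier (pi1 b)"
        using ga ab by auto
      \<comment> \<open>The homotopy between the two loops is replaced by a computation with the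
        path functor \<open>B.based_class\<close>, which agrees with the loop class on loops at
        \<open>b\<close>.\<close>
      have "loop_class euclidean b (?\<alpha> +++ \<beta> +++ reversepath ?\<alpha>) = B.based_class (?\<alpha> +++ (\<beta> +++ reversepath ?\<alpha>))"
        using B.based_class_loop[OF lasso_loop(1)[OF l]] by simp
      also have "\<dots> = B.based_class g \<otimes>\<^bsub>pi1 b\<^esub> B.based_class \<alpha> \<otimes>\<^bsub>pi1 b\<^esub> (B.based_class \<beta> \<otimes>\<^bsub>pi1 b\<^esub>
          inv\<^bsub>pi1 b\<^esub> (B.based_class g \<otimes>\<^bsub>pi1 b\<^esub> B.based_class \<alpha>))"
        using ab ga rev b1 by (simp add: F.F_join F.F_reversepath)
      also have "\<dots> = B.based_class g \<otimes>\<^bsub>pi1 b\<^esub> (B.based_class \<alpha> \<otimes>\<^bsub>pi1 b\<^esub> (B.based_class \<beta> \<otimes>\<^bsub>pi1 b\<^esub>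
          inv\<^bsub>pi1 b\<^esub> B.based_class \<alpha>)) \<otimes>\<^bsub>pi1 b\<^esub> inv\<^bsub>pi1 b\<^esub> B.based_class g"
        using F by (simp add: G.m_assoc G.inv_mult_group)
      also have "B.based_class \<alpha> \<otimes>\<^bsub>pi1 b\<^esub> (B.based_class \<beta> \<otimes>\<^bsub>pi1 b\<^esub> inv\<^bsub>pi1 b\<^esub> B.based_class \<alpha>) = B.based_class k"
        unfolding ab(8) using ab rev b1 by (simp add: F.F_join F.F_reversepath)
      finally have "loop_class euclidean b (?\<alpha> +++ \<beta> +++ reversepath ?\<alpha>) = x \<otimes>\<^bsub>pi1 b\<^esub> e \<otimes>\<^bsub>pi1 b\<^esub> inv\<^bsub>pi1 b\<^esub> x"
        using B.based_class_loop[OF g(1)] B.based_class_loop[OF lasso_loop(1)[OF k(1)]] g(3) k(3) by simp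
      then show "x \<otimes>\<^bsub>pi1 b\<^esub> e \<otimes>\<^bsub>pi1 b\<^esub> inv\<^bsub>pi1 b\<^esub> x \<in> ?E" using l k(2) by (metis (mono_tags, lifting) mem_Collect_eq)
    qed
    then show "x \<otimes>\<^bsub>?H\<^esub> h \<otimes>\<^bsub>?H\<^esub> inv\<^bsub>?H\<^esub> x \<in> L_pi1 b r"
      using G.m_inv_consistent[OF subgroup_finite_loops, of x] x by simp
  qed
qed

section \<open>The comparison map on fundamental groups\<close>

definition Lambda_class :: "'a::metric_space \<Rightarrow> (real \<Rightarrow> 'a) \<Rightarrow> (real \<Rightarrow> 'a) set" where
  "Lambda_class b = base_paths.based_class euclidean b (geod_from b)"

lemma Lambda_class_loop:
  fixes b :: "'a::metric_space"
  assumes "geodesic_space TYPE('a)" "loop_in euclidean b g"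
  shows "Lambda_class b g = loop_class euclidean b g"
  unfolding Lambda_class_def
  by (rule base_paths.based_class_loop[OF base_paths_geod_from[OF assms(1)] assms(2)])

text \<open>Connecting geodesics have finite length, so closing up preserves finiteness; a closed
  path shorter than \<open>3 * r\<close> becomes a lasso with a head of that length.\<close>

lemma length_functor_pi1:
  fixes b :: "'a::metric_space"
  assumes geo: "geodesic_space TYPE('a)" and r: "0 < r"
  shows "length_functor (pi1 b) (Lambda_class b) (finite_loops b) (L_pi1 b (3 * r)) r"
proof -
  interpret B: base_paths euclidean b "geod_from b" by (rule base_paths_geod_from[OF geo])
  interpret F: path_functor "pi1 b" euclidean "Lambda_class b"
    unfolding Lambda_class_def by (rule B.path_functor_based)
  show ?thesis
  proof (intro length_functor.intro length_functor_axioms.intro F.path_functor_axioms)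
    show "L_pi1 b (3 * r) \<lhd> Fin_pi1 b" by (rule L_pi1_normal[OF geo])
    show "Lambda_class b p \<in> finite_loops b" if p: "path p" "path_length p < \<infinity>" for p
    proof -
      have "path_length (p +++ reversepath (geod_from b (p 1))) < \<infinity>"
        using p geod_from[OF geo] by (intro path_length_join_finite path_length_reversepath_finite) auto
      then have "path_length (B.based p) < \<infinity>"
        unfolding B.based_def using geod_from[OF geo]
        by (intro path_length_join_finite[OF geod_from(4)[OF geo]]) auto
      then show ?thesis
        unfolding Lambda_class_def B.based_class_def finite_loops_def using B.based_loop[of p] p by auto
    qed
    show "Lambda_class b p \<in> L_pi1 b (3 * r)"
      if p: "path p" "p 1 = p 0" "path_length p < ereal (3 * r)" for p
    proof -
      obtain l where l: "path_length p = ereal l"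
        using p(3) arc_length_nonneg[of p 0 1] by (cases "path_length p") (auto simp: path_length_arc)
      then show ?thesis
        unfolding Lambda_class_def B.based_class_def L_pi1_def
        using based_lasso[OF geo p(1,2) l, of b] p(3) by (intro generate.incl) auto
    qed
  qed (use geo r subgroup_finite_loops in auto)
qed

definition lam_pi1 :: "'a::metric_space \<Rightarrow> real \<Rightarrow> (real \<Rightarrow> 'a \<Rightarrow> real) set \<Rightarrow> (real \<Rightarrow> 'a) set set" where
  "lam_pi1 b r = restrict
     (functor_hom (length_functor.Lam (pi1 b) (Lambda_class b) (finite_loops b) (L_pi1 b (3 * r)) r))
     (carrier (Rips_pi1 b r))"

lemma lam_pi1_hom:
  fixes b :: "'a::metric_space"
  assumes geo: "geodesic_space TYPE('a)" and r: "0 < r"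
  shows "lam_pi1 b r \<in> hom (Rips_pi1 b r) (Lfin_pi1 b Mod L_pi1 b (3 * r))"
proof -
  interpret L: length_functor "pi1 b" "Lambda_class b" "finite_loops b" "L_pi1 b (3 * r)" r
    by (rule length_functor_pi1[OF geo r])
  have "group (Rips_pi1 b r)"
    unfolding Rips_pi1_def using Rips_base_paths[OF geo r] by (metis base_paths.b group_pi1)
  then have "Rips_pi1 b r = Rips_pi1 b r \<and> monoid (Rips_pi1 b r)" by (simp add: group.is_monoid)
  moreover have "functor_hom L.Lam \<in> hom (Rips_pi1 b r) L.M"
    unfolding Rips_pi1_def by (rule path_functor.functor_hom[OF L.path_functor_Lam])
  ultimately show ?thesis
    unfolding lam_pi1_def Lfin_pi1_eq[OF geo] L.M_def[symmetric]
    by (auto simp: hom_def monoid.m_closed)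
qed

lemma Rips_pi1_edge_path:
  fixes b :: "'a::metric_space"
  assumes geo: "geodesic_space TYPE('a)" and r: "0 < r" and C: "C \<in> carrier (Rips_pi1 b r)"
  obtains xs where "r_loop r xs" "hd xs = b"
    "C = loop_class (realization (Rips r)) (indicator {b}) (edge_path xs)"
proof -
  obtain c where c: "base_paths (realization (Rips r)) (indicator {b}) c"
    using Rips_base_paths[OF geo r] .
  obtain g where g: "loop_in (realization (Rips r)) (indicator {b}) g"
    "C = loop_class (realization (Rips r)) (indicator {b}) g"
    using C by (auto simp: Rips_pi1_def pi1_carrier)
  obtain xs where xs: "2 \<le> length xs" "successively (\<lambda>x y. {x, y} \<in> Rips r) xs" "hd xs = b" "last xs = b"
    "path_homotopic (realization (Rips r)) g (edge_path xs)"
    using loop_homotopic_edge_path[OF c complex_Rips] g by (auto simp: loop_in_def)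
  then show thesis
    using that[of xs] g r loop_class_eq[OF g(1) xs(5)] by (simp add: r_loop_successively Rips_edge)
qed

lemma edge_path_loop:
  assumes r: "0 < r" and xs: "r_loop r xs"
  shows "loop_in (realization (Rips r)) (indicator {hd xs}) (edge_path xs)"
  using complex.edge_path_pathin[OF complex_Rips, of xs r] xs r
  by (auto simp: r_loop_successively loop_in_def Rips_edge)

lemma filling_loop:
  assumes "r_loop r xs" "filling xs g"
  shows "loop_in euclidean (hd xs) g" "path_length g < \<infinity>"
  using filling_path[OF assms(2)] assms(1) by (auto simp: r_loop_successively loop_in_def)

lemma lam_pi1_edge_path:
  fixes b :: "'a::metric_space"
  assumes geo: "geodesic_space TYPE('a)" and r: "0 < r"
    and xs: "r_loop r xs" "hd xs = b" "filling xs g"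
  shows "lam_pi1 b r (loop_class (realization (Rips r)) (indicator {b}) (edge_path xs))
     = L_pi1 b (3 * r) #>\<^bsub>Lfin_pi1 b\<^esub> loop_class euclidean b g"
proof -
  interpret L: length_functor "pi1 b" "Lambda_class b" "finite_loops b" "L_pi1 b (3 * r)" r
    by (rule length_functor_pi1[OF geo r])
  interpret P: path_functor L.M "realization (Rips r)" L.Lam by (rule L.path_functor_Lam)
  have e: "loop_in (realization (Rips r)) (indicator {b}) (edge_path xs)"
    using edge_path_loop[OF r xs(1)] xs(2) by simp
  have "lam_pi1 b r (loop_class (realization (Rips r)) (indicator {b}) (edge_path xs)) = L.Lam (edge_path xs)"
    unfolding lam_pi1_def using e by (simp add: Rips_pi1_def P.functor_hom_class)
  also have "\<dots> = L.coset g"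
    using xs by (intro L.Lam_edge_path) (auto simp: r_loop_successively)
  finally show ?thesis
    using Lambda_class_loop[OF geo, of b g] filling_loop[OF xs(1,3)] xs(2)
    by (simp add: L.coset_def Lfin_pi1_def r_coset_def)
qed

lemma is_lambda_lam_pi1:
  fixes b :: "'a::metric_space"
  assumes "geodesic_space TYPE('a)" "0 < r"
  shows "is_lambda_pi1 b r (lam_pi1 b r)"
  unfolding is_lambda_pi1_def using lam_pi1_edge_path[OF assms] by (auto simp: lam_pi1_def)

text \<open>Every class is represented by an \<open>r\<close>-loop at \<open>b\<close> and every
  \<open>r\<close>-loop has a filling, so the prescribed values determine the map on the whole
  carrier; off the carrier extensionality fixes it.\<close>

lemma lambda_pi1_eq:
  fixes b :: "'a::metric_space"
  assumes geo: "geodesic_space TYPE('a)" and r: "0 < r"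
  shows "lambda_pi1 b r = lam_pi1 b r"
  unfolding lambda_pi1_def
proof (rule the_equality[where P = "is_lambda_pi1 b r"], rule is_lambda_lam_pi1[OF assms])
  fix h assume h: "is_lambda_pi1 b r h"
  show "h = lam_pi1 b r"
  proof (rule extensionalityI)
    show "h \<in> extensional (carrier (Rips_pi1 b r))" using h by (simp add: is_lambda_pi1_def)
    show "lam_pi1 b r \<in> extensional (carrier (Rips_pi1 b r))" by (simp add: lam_pi1_def)
    fix C assume "C \<in> carrier (Rips_pi1 b r)"
    then obtain xs where xs: "r_loop r xs" "hd xs = b"
      "C = loop_class (realization (Rips r)) (indicator {b}) (edge_path xs)"
      using Rips_pi1_edge_path[OF geo r] by metis
    obtain g where g: "filling xs g"
      using filling_exists[OF geo, of xs] xs(1) by (auto simp: r_loop_def)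
    show "h C = lam_pi1 b r C"
      using h lam_pi1_edge_path[OF geo r xs(1,2) g] xs g unfolding is_lambda_pi1_def by metis
  qed
qed

lemma lam_pi1_iso:
  fixes b :: "'a::metric_space"
  assumes geo: "geodesic_space TYPE('a)" and r: "0 < r"
  shows "lam_pi1 b r \<in> iso (Rips_pi1 b r) (Lfin_pi1 b Mod L_pi1 b (3 * r))"
proof -
  let ?A = "Rips_pi1 b r" and ?Y = "realization (Rips r :: 'a set set)"
  obtain c where c: "base_paths ?Y (indicator {b}) c" using Rips_base_paths[OF geo r] .
  interpret B: base_paths ?Y "indicator {b}" c by fact
  interpret F: path_functor ?A ?Y B.based_class unfolding Rips_pi1_def by (rule B.path_functor_based)
  \<comment> \<open>Taking the based class as functor on the realization makes \<open>R.Mu\<close> a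
    map from paths in the space to the group of the Rips complex, the candidate inverse.\<close>
  interpret R: rips_functor r ?A B.based_class by unfold_locales (rule r)
  interpret m: path_functor ?A "euclidean :: 'a topology" R.Mu by (rule R.path_functor_Mu)
  interpret L: length_functor "pi1 b" "Lambda_class b" "finite_loops b" "L_pi1 b (3 * r)" r
    by (rule length_functor_pi1[OF geo r])
  have mu: "functor_hom R.Mu \<in> hom (pi1 b) ?A" by (rule m.functor_hom)
  interpret h: group_hom "pi1 b" ?A "functor_hom R.Mu"
    using mu by unfold_locales
  show ?thesis
    unfolding Lfin_pi1_eq[OF geo]
  proof (rule iso_criterion[OF F.group_axioms group_pi1_euclidean subgroup_finite_loops L_pi1_normal[OF geo] _ mu])
    show "lam_pi1 b r \<in> hom ?A (Fin_pi1 b Mod L_pi1 b (3 * r))"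
      using lam_pi1_hom[OF geo r, of b] by (simp add: Lfin_pi1_eq[OF geo])
    fix n assume "n \<in> L_pi1 b (3 * r)"
    \<comment> \<open>On a lasso the tail contributes a factor and its inverse, while the head has
      trivial value by \<open>Mu_small_loop\<close>.\<close>
    moreover have "L_pi1 b (3 * r) \<subseteq> kernel (pi1 b) ?A (functor_hom R.Mu)"
      unfolding L_pi1_def
    proof (rule group.generate_subgroup_incl[OF group_pi1_euclidean _ h.subgroup_kernel], clarify)
      fix g l assume l: "lasso b l g" "l < 3 * r"
      obtain \<alpha> \<beta> where ab: "path \<alpha>" "\<alpha> 0 = b" "path_length \<alpha> < \<infinity>" "path \<beta>" "\<beta> 0 = \<alpha> 1" "\<beta> 1 = \<alpha> 1"
        "path_length \<beta> = ereal l" "g = \<alpha> +++ (\<beta> +++ reversepath \<alpha>)"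
        using l(1) by (rule lassoE)
      have rev: "path (reversepath \<alpha>)" "path (\<beta> +++ reversepath \<alpha>)"
        using ab by (auto simp: pathstart_def pathfinish_def)
      have "functor_hom R.Mu (loop_class euclidean b g) = R.Mu g"
        by (rule m.functor_hom_class[OF lasso_loop(1)[OF l(1)]])
      also have "\<dots> = R.Mu \<alpha> \<otimes>\<^bsub>?A\<^esub> (R.Mu \<beta> \<otimes>\<^bsub>?A\<^esub> inv\<^bsub>?A\<^esub> R.Mu \<alpha>)"
        unfolding ab(8) using ab rev by (simp add: m.F_join m.F_reversepath)
      also have "R.Mu \<beta> = \<one>\<^bsub>?A\<^esub>"
        using ab l(2) by (intro R.Mu_small_loop) auto
      finally show "loop_class euclidean b g \<in> kernel (pi1 b) ?A (functor_hom R.Mu)"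
        using ab lasso_loop(1)[OF l(1)] by (simp add: kernel_def)
    qed
    ultimately show "functor_hom R.Mu n = \<one>\<^bsub>?A\<^esub>" by (auto simp: kernel_def)
  next
    fix C assume "C \<in> carrier ?A"
    then obtain xs where xs: "r_loop r xs" "hd xs = b"
      "C = loop_class ?Y (indicator {b}) (edge_path xs)"
      using Rips_pi1_edge_path[OF geo r] by metis
    obtain g where g: "filling xs g"
      using filling_exists[OF geo, of xs] xs(1) by (auto simp: r_loop_def)
    have gl: "loop_in euclidean b g" "path_length g < \<infinity>" using filling_loop[OF xs(1) g] xs(2) by auto
    have e: "loop_in ?Y (indicator {b}) (edge_path xs)" using edge_path_loop[OF r xs(1)] xs(2) by simp
    have "functor_hom R.Mu (loop_class euclidean b g) = R.Mu g" by (rule m.functor_hom_class[OF gl(1)])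
    also have "\<dots> = B.based_class (edge_path xs)"
      using xs g by (intro R.Mu_filling) (auto simp: r_loop_successively)
    also have "\<dots> = C" using B.based_class_loop[OF e] xs(3) by simp
    finally show "\<exists>f\<in>finite_loops b. lam_pi1 b r C = L_pi1 b (3 * r) #>\<^bsub>Fin_pi1 b\<^esub> f \<and>
        functor_hom R.Mu f = C"
      using lam_pi1_edge_path[OF geo r xs(1,2) g] gl xs(3)
      by (intro bexI[of _ "loop_class euclidean b g"]) (auto simp: Lfin_pi1_eq[OF geo] finite_loops_def)
  next
    fix s assume "s \<in> finite_loops b"
    then obtain g where g: "loop_in euclidean b g" "path_length g < \<infinity>" "s = loop_class euclidean b g"
      by (auto simp: finite_loops_def)
    \<comment> \<open>A finite-length loop has the same class modulo \<open>L_pi1 b (3 * r)\<close>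
      as a filling of an \<open>r\<close>-loop, and the class of that \<open>r\<close>-loop is the
      required preimage.\<close>
    obtain xs g' where xs: "2 \<le> length xs" "hd xs = g 0" "last xs = g 1"
      "successively (\<lambda>x y. dist x y < r) xs" "filling xs g'" "L.coset g = L.coset g'"
      using L.coset_eq_filling[of g] g by (auto simp: loop_in_def)
    have rl: "r_loop r xs" "hd xs = b" using xs g by (auto simp: r_loop_successively loop_in_def)
    have "lam_pi1 b r (loop_class ?Y (indicator {b}) (edge_path xs)) = L.coset g'"
      using lam_pi1_edge_path[OF geo r rl xs(5)] Lambda_class_loop[OF geo, of b g'] filling_loop[OF rl(1) xs(5)] rl(2)
      by (simp add: L.coset_def Lfin_pi1_def r_coset_def)
    also have "\<dots> = L_pi1 b (3 * r) #>\<^bsub>Fin_pi1 b\<^esub> s"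
      using Lambda_class_loop[OF geo g(1)] xs(6) g(3) by (simp add: L.coset_def r_coset_def)
    finally show "\<exists>a\<in>carrier ?A. lam_pi1 b r a = L_pi1 b (3 * r) #>\<^bsub>Fin_pi1 b\<^esub> s"
      using edge_path_loop[OF r rl(1)] rl(2) by (intro bexI) (auto simp: Rips_pi1_def)
  qed
qed

section \<open>Compatibility with the bonding maps\<close>

lemma set_mult_coset:
  assumes "group G" "subgroup N G" "subgroup N' G" "N \<subseteq> N'" "x \<in> carrier G"
  shows "N' <#>\<^bsub>G\<^esub> (N #>\<^bsub>G\<^esub> x) = N' #>\<^bsub>G\<^esub> x"
proof -
  interpret group G by fact
  \<comment> \<open>The larger subgroup absorbs the smaller one, so the quotient map keeps the
    representative of a coset.\<close>
  have "N' <#>\<^bsub>G\<^esub> N = N'"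
  proof
    show "N' <#>\<^bsub>G\<^esub> N \<subseteq> N'"
      using assms by (auto simp: set_mult_def subgroup.m_closed subset_iff)
    show "N' \<subseteq> N' <#>\<^bsub>G\<^esub> N"
    proof
      fix y assume y: "y \<in> N'"
      then have "y = y \<otimes>\<^bsub>G\<^esub> \<one>\<^bsub>G\<^esub>" using subgroup.subset[OF assms(3)] by auto
      then show "y \<in> N' <#>\<^bsub>G\<^esub> N" using y subgroup.one_closed[OF assms(2)] unfolding set_mult_def by blast
    qed
  qed
  then show ?thesis
    using setmult_rcos_assoc[OF subgroup.subset[OF assms(3)] subgroup.subset[OF assms(2)] assms(5)] by simp
qed

lemma fundamental_group_map_class:
  assumes "continuous_map X Y f" "loop_in X a g"
  shows "fundamental_group_map Y a f (loop_class X a g) = loop_class Y (f a) (f \<circ> g)"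
proof -
  have l: "loop_in Y (f a) (f \<circ> g)"
    using assms by (auto simp: loop_in_def pathin_compose)
  have eq: "loop_class Y (f a) (f \<circ> h) = loop_class Y (f a) (f \<circ> g)" if "h \<in> loop_class X a g" for h
    using that path_homotopic_map[OF _ assms(1)] by (intro loop_class_eq[OF l]) (simp add: mem_loop_class[OF assms(2)])
  have "g \<in> loop_class X a g" using assms(2) by (simp add: mem_loop_class loop_inD path_homotopic_refl)
  then have ne: "loop_class X a g \<noteq> {}" by blast
  have "fundamental_group_map Y a f (loop_class X a g) = (\<Union>h\<in>loop_class X a g. loop_class Y (f a) (f \<circ> g))"
    unfolding fundamental_group_map_def by (intro SUP_cong refl eq)
  then show ?thesis using ne by simp
qed

lemma persistence_iso_pi1:
  fixes b :: "'a::metric_space"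
  assumes geo: "geodesic_space TYPE('a)"
  shows "persistence_iso (Rips_pi1_persistence b)
    (quotient_persistence (Lfin_pi1 b) (\<lambda>r. L_pi1 b (3 * r))) (lambda_pi1 b)"
  unfolding persistence_iso_def Rips_pi1_persistence_def quotient_persistence_def fst_conv snd_conv
proof (intro conjI allI impI ballI)
  show "lambda_pi1 b r \<in> iso (Rips_pi1 b r) (Lfin_pi1 b Mod L_pi1 b (3 * r))" if "0 < r" for r
    using lam_pi1_iso[OF geo that] lambda_pi1_eq[OF geo that] by simp
  fix p q :: real and C assume pq: "0 < p \<and> p < q" and C: "C \<in> carrier (Rips_pi1 b p)"
  then have p: "0 < p" and q: "0 < q" by auto
  obtain xs where xs: "r_loop p xs" "hd xs = b"
    "C = loop_class (realization (Rips p)) (indicator {b}) (edge_path xs)"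
    using Rips_pi1_edge_path[OF geo p C] .
  \<comment> \<open>The same list of points is a loop at the larger scale, and one filling
    \<open>g\<close> computes both images; naturality is then visible on representatives.\<close>
  have xq: "r_loop q xs" using xs(1) pq successively_mono_dist[of p xs q] by (auto simp: r_loop_successively)
  obtain g where g: "filling xs g"
    using filling_exists[OF geo, of xs] xs(1) by (auto simp: r_loop_def)
  have gl: "loop_in euclidean b g" "path_length g < \<infinity>" using filling_loop[OF xs(1) g] xs(2) by auto
  have e: "loop_in (realization (Rips p)) (indicator {b}) (edge_path xs)"
    using edge_path_loop[OF p xs(1)] xs(2) by simp
  have "continuous_map (realization (Rips p)) (realization (Rips q)) (id :: ('a \<Rightarrow> real) \<Rightarrow> _)"
    using continuous_map_realization_mono[OF Rips_mono[of p q]] pq by (simp add: id_def)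
  from fundamental_group_map_class[OF this e]
  have m: "fundamental_group_map (realization (Rips q)) (indicator {b}) id C =
      loop_class (realization (Rips q)) (indicator {b}) (edge_path xs)"
    using xs(3) by simp
  let ?H = "Fin_pi1 b"
  have "L_pi1 b (3 * q) <#>\<^bsub>?H\<^esub> (L_pi1 b (3 * p) #>\<^bsub>?H\<^esub> loop_class euclidean b g)
      = L_pi1 b (3 * q) #>\<^bsub>?H\<^esub> loop_class euclidean b g"
  proof (rule set_mult_coset)
    show "group ?H" by (rule group.subgroup_imp_group[OF group_pi1_euclidean subgroup_finite_loops])
    show "subgroup (L_pi1 b (3 * p)) ?H" "subgroup (L_pi1 b (3 * q)) ?H"
      by (rule normal_imp_subgroup[OF L_pi1_normal[OF geo]])+
    show "L_pi1 b (3 * p) \<subseteq> L_pi1 b (3 * q)" using pq by (intro L_pi1_mono) simp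
    show "loop_class euclidean b g \<in> carrier ?H" using gl by (auto simp: finite_loops_def)
  qed
  then show "lambda_pi1 b q (fundamental_group_map (realization (Rips q)) (indicator {b}) id C) =
      L_pi1 b (3 * q) <#>\<^bsub>Lfin_pi1 b\<^esub> lambda_pi1 b p C"
    unfolding m lambda_pi1_eq[OF geo p] lambda_pi1_eq[OF geo q]
      lam_pi1_edge_path[OF geo q xq xs(2) g] using lam_pi1_edge_path[OF geo p xs(1,2) g] xs(3)
    by (simp add: Lfin_pi1_eq[OF geo])
qed

section \<open>First homology with coefficients\<close>

context
  notes One_nat_def [simp del]
begin

text \<open>The additive extension of a family of coefficient maps, one for each basis element.
  Boundaries and the cone below are instances, which makes them additive at once.\<close>

definition chain_sum :: "('k \<Rightarrow> 'g::ab_group_add \<Rightarrow> 'h::ab_group_add) \<Rightarrow> ('k \<Rightarrow>\<^sub>0 'g) \<Rightarrow> 'h" where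
  "chain_sum T c = (\<Sum>k\<in>Poly_Mapping.keys c. T k (Poly_Mapping.lookup c k))"

lemma additive_chain_sum:
  assumes "\<And>k u v. T k (u + v) = T k u + T k v"
  shows "Modules.additive (chain_sum T)"
proof
  have "T k 0 = 0" for k using assms[of k 0 0] by simp
  then show "chain_sum T (x + y) = chain_sum T x + chain_sum T y" for x y
    unfolding chain_sum_def by (intro setsum_keys_plus_distrib) (auto simp: assms)
qed

lemma chain_sum_single:
  assumes "T k 0 = 0" shows "chain_sum T (Poly_Mapping.single k u) = T k u"
  using assms by (cases "u = 0") (auto simp: chain_sum_def)

lemma chain_decompose:
  "c = (\<Sum>k\<in>Poly_Mapping.keys c. Poly_Mapping.single k (Poly_Mapping.lookup c k))"
  by (rule poly_mapping_eqI)
     (auto simp: lookup_sum lookup_single when_def not_in_keys_iff_lookup_eq_zero)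

lemma gchain_boundary_chain_sum:
  assumes "0 < p"
  shows "gchain_boundary p = chain_sum (\<lambda>f u. \<Sum>k\<le>p.
     Poly_Mapping.single (singular_face p k f) (if even k then u else - u))"
  using assms by (auto simp: gchain_boundary_def chain_sum_def fun_eq_iff)

lemma additive_gchain_boundary: "0 < p \<Longrightarrow> Modules.additive (gchain_boundary p)"
  unfolding gchain_boundary_chain_sum
  by (rule additive_chain_sum) (auto simp: single_add single_uminus single_diff simp flip: sum.distrib intro!: sum.cong)

lemma gchain_boundary_single:
  assumes "0 < p"
  shows "gchain_boundary p (Poly_Mapping.single f u) =
    (\<Sum>k\<le>p. Poly_Mapping.single (singular_face p k f) (if even k then u else - u))"
  unfolding gchain_boundary_chain_sum[OF assms] by (rule chain_sum_single) (auto intro!: sum.neutral)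

lemmas boundary_add = Modules.additive.add[OF additive_gchain_boundary]
lemmas boundary_diff = Modules.additive.diff[OF additive_gchain_boundary]
lemmas boundary_minus = Modules.additive.minus[OF additive_gchain_boundary]
lemmas boundary_zero = Modules.additive.zero[OF additive_gchain_boundary]
lemmas boundary_sum = Modules.additive.sum[OF additive_gchain_boundary]

section \<open>Paths as singular 1-simplices, triangles as singular 2-simplices\<close>

definition bary :: "real \<Rightarrow> nat \<Rightarrow> real" where
  "bary t = (\<lambda>i. if i = 0 then 1 - t else if i = 1 then t else 0)"

text \<open>The convention of \<open>loop_homology_class\<close>: coordinate 1 of the standard
  simplex is the path parameter. Its inverse \<open>simplex_path\<close> reads a singular simplex
  along \<open>bary\<close>.\<close>

definition path_simplex :: "(real \<Rightarrow> 'a) \<Rightarrow> (nat \<Rightarrow> real) \<Rightarrow> 'a" where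
  "path_simplex p = restrict (\<lambda>z. p (z 1)) (standard_simplex 1)"

definition point_simplex :: "'a \<Rightarrow> (nat \<Rightarrow> real) \<Rightarrow> 'a" where
  "point_simplex y = restrict (\<lambda>_. y) (standard_simplex 0)"

definition simplex_path :: "((nat \<Rightarrow> real) \<Rightarrow> 'a) \<Rightarrow> real \<Rightarrow> 'a" where
  "simplex_path \<sigma> = (\<lambda>t. \<sigma> (bary t))"

lemma atMost_1: "{..1::nat} = {0, 1}" and atMost_2: "{..2::nat} = {0, 1, 2}"
  by auto

lemma bary_simplex: "0 \<le> t \<Longrightarrow> t \<le> 1 \<Longrightarrow> bary t \<in> standard_simplex 1"
  by (auto simp: bary_def standard_simplex_def atMost_1)

lemma simplex_bary: "z \<in> standard_simplex 1 \<Longrightarrow> z = bary (z 1)"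
proof
  fix i assume z: "z \<in> standard_simplex 1"
  then have "z 0 + z 1 = 1" "\<forall>i>1. z i = 0" by (auto simp: standard_simplex_def atMost_1)
  then show "z i = bary (z 1) i" by (auto simp: bary_def)
qed

lemma bary_1 [simp]: "bary t 1 = t" by (simp add: bary_def)

lemma continuous_map_standard_simplex:
  assumes "continuous_on Z h" "h \<in> Z \<rightarrow> standard_simplex n"
  shows "continuous_map (top_of_set Z) (subtopology (powertop_real UNIV) (standard_simplex n)) h"
  using assms by (simp add: euclidean_product_topology continuous_map_in_subtopology image_subset_iff_funcset)

lemma singular_path_simplex:
  assumes p: "pathin Y p"
  shows "path_simplex p \<in> singular_simplex_set 1 Y"
proof -
  let ?X = "subtopology (powertop_real UNIV) (standard_simplex 1)"
  have "continuous_map ?X (top_of_set {0..1}) (\<lambda>z. z 1)"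
    unfolding continuous_map_in_subtopology
    by (auto simp: standard_simplex_def intro!: continuous_map_from_subtopology continuous_map_product_projection)
  from continuous_map_compose[OF this p[unfolded pathin_def]]
  have "continuous_map ?X Y (\<lambda>z. p (z 1))" by (simp add: o_def)
  then have "continuous_map ?X Y (path_simplex p)"
    by (rule continuous_map_eq) (simp add: path_simplex_def)
  then show ?thesis by (simp add: singular_simplex_def path_simplex_def)
qed

lemma pathin_simplex_path:
  assumes "\<sigma> \<in> singular_simplex_set 1 Y"
  shows "pathin Y (simplex_path \<sigma>)"
proof -
  have "continuous_on {0..1} (\<lambda>t. bary t i)" for i
    by (cases "i = 0"; cases "i = 1") (auto simp: bary_def continuous_on_op_minus)
  then have "continuous_on {0..1} bary"
    by (rule continuous_on_coordinatewise_then_product)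
  then have "continuous_map (top_of_set {0..1}) (subtopology (powertop_real UNIV) (standard_simplex 1)) bary"
    by (rule continuous_map_standard_simplex) (auto intro: bary_simplex)
  from continuous_map_compose[OF this] assms show ?thesis
    by (auto simp: singular_simplex_def pathin_def simplex_path_def o_def)
qed

lemma path_simplex_path:
  assumes "\<sigma> \<in> singular_simplex_set 1 Y"
  shows "path_simplex (simplex_path \<sigma>) = \<sigma>"
proof
  fix z
  show "path_simplex (simplex_path \<sigma>) z = \<sigma> z"
    using assms simplex_bary[of z]
    by (cases "z \<in> standard_simplex 1")
       (auto simp: path_simplex_def simplex_path_def singular_simplex_def extensional_def)
qed

lemma simplex_path_simplex: "0 \<le> t \<Longrightarrow> t \<le> 1 \<Longrightarrow> simplex_path (path_simplex p) t = p t"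
  by (simp add: simplex_path_def path_simplex_def bary_simplex)

lemma path_simplex_cong:
  assumes "\<And>t. 0 \<le> t \<Longrightarrow> t \<le> 1 \<Longrightarrow> p t = q t"
  shows "path_simplex p = path_simplex q"
  unfolding path_simplex_def by (rule restrict_ext) (auto simp: standard_simplex_def intro!: assms)

lemma boundary_path:
  "gchain_boundary 1 (Poly_Mapping.single (path_simplex p) u) =
     Poly_Mapping.single (point_simplex (p 1)) u - Poly_Mapping.single (point_simplex (p 0)) u"
proof -
  \<comment> \<open>Face 0 omits vertex 0 and is therefore the end point of the path, not its
    start.\<close>
  have f: "singular_face 1 k (path_simplex p) = point_simplex (p (if k = 0 then 1 else 0))" if "k \<le> 1" for k
    unfolding singular_face_def point_simplex_def
  proof -
    have 0: "1 - Suc 0 = (0 :: nat)" by arith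
    show "restrict (path_simplex p \<circ> simplical_face k) (standard_simplex (1 - Suc 0)) =
        restrict (\<lambda>_. p (if k = 0 then 1 else 0)) (standard_simplex 0)"
      unfolding 0
    proof (rule restrict_ext)
    fix z :: "nat \<Rightarrow> real" assume z: "z \<in> standard_simplex 0"
    have "simplical_face k z \<in> standard_simplex 1"
      using simplical_face_in_standard_simplex[of 1 k z] z that by simp
    moreover have "simplical_face k z 1 = (if k = 0 then 1 else 0)"
      using z that by (auto simp: simplical_face_def standard_simplex_0)
    ultimately show "(path_simplex p \<circ> simplical_face k) z = p (if k = 0 then 1 else 0)"
      by (simp add: path_simplex_def)
    qed
  qed
  show ?thesis
    using f[of 0] f[of 1] by (simp add: gchain_boundary_single single_uminus atMost_1)
qed

definition unit_triangle :: "(real \<times> real) set" where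
  "unit_triangle = {z. 0 \<le> fst z \<and> 0 \<le> snd z \<and> fst z + snd z \<le> 1}"

text \<open>Coordinates 1 and 2 of the standard 2-simplex serve as planar coordinates, so homotopies
  can be made in a convex subset of the plane.\<close>

definition tri :: "real \<times> real \<Rightarrow> nat \<Rightarrow> real" where
  "tri z = (\<lambda>i. if i = 0 then 1 - fst z - snd z else if i = 1 then fst z else if i = 2 then snd z else 0)"

lemma tri_simplex: "z \<in> unit_triangle \<Longrightarrow> tri z \<in> standard_simplex 2"
  by (auto simp: tri_def unit_triangle_def standard_simplex_def atMost_2)

lemma convex_triangle: "convex unit_triangle"
proof -
  have eq: "unit_triangle = {z. (-1, 0) \<bullet> z \<le> 0} \<inter> {z. (0, -1) \<bullet> z \<le> 0} \<inter> {z. (1, 1) \<bullet> z \<le> 1}"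
    by (auto simp: unit_triangle_def inner_prod_def)
  show ?thesis unfolding eq by (intro convex_Int convex_halfspace_le)
qed

lemma continuous_map_tri:
  assumes "\<tau> \<in> singular_simplex_set 2 Y"
  shows "continuous_map (top_of_set unit_triangle) Y (\<tau> \<circ> tri)"
proof (rule continuous_map_compose)
  have "continuous_on unit_triangle (\<lambda>z. tri z i)" for i
    by (cases "i = 0"; cases "i = 1"; cases "i = 2") (auto simp: tri_def intro!: continuous_intros)
  then have "continuous_on unit_triangle tri"
    by (rule continuous_on_coordinatewise_then_product)
  then show "continuous_map (top_of_set unit_triangle) (subtopology (powertop_real UNIV) (standard_simplex 2)) tri"
    by (rule continuous_map_standard_simplex) (auto intro: tri_simplex)
qed (use assms in \<open>auto simp: singular_simplex_def\<close>)

lemma boundary_triangle: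
  "gchain_boundary 2 (Poly_Mapping.single \<tau> u) =
     Poly_Mapping.single (path_simplex (\<lambda>t. \<tau> (tri (1 - t, t)))) u
     - Poly_Mapping.single (path_simplex (\<lambda>t. \<tau> (tri (0, t)))) u
     + Poly_Mapping.single (path_simplex (\<lambda>t. \<tau> (tri (t, 0)))) u"
proof -
  have eq: "singular_face 2 k \<tau> = path_simplex (\<lambda>t. \<tau> (h t))"
    if "\<And>z. z \<in> standard_simplex 1 \<Longrightarrow> simplical_face k z = h (z 1)" for k h
    unfolding singular_face_def path_simplex_def using that by (auto intro!: restrict_ext)
  have z: "z = bary (z 1)" if "z \<in> standard_simplex 1" for z using simplex_bary[OF that] .
  have f0: "singular_face 2 0 \<tau> = path_simplex (\<lambda>t. \<tau> (tri (1 - t, t)))"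
    by (rule eq, subst z) (auto simp: simplical_face_def tri_def bary_def fun_eq_iff)
  have f1: "singular_face 2 1 \<tau> = path_simplex (\<lambda>t. \<tau> (tri (0, t)))"
    by (rule eq, subst z) (auto simp: simplical_face_def tri_def bary_def fun_eq_iff)
  have f2: "singular_face 2 2 \<tau> = path_simplex (\<lambda>t. \<tau> (tri (t, 0)))"
    by (rule eq, subst z) (auto simp: simplical_face_def tri_def bary_def fun_eq_iff)
  show ?thesis
    using f0 f1 f2 by (simp add: gchain_boundary_single single_uminus atMost_2)
qed

context
  fixes G :: "'g::ab_group_add itself" and Y :: "'y::topological_space topology"
begin

definition bds :: "('y, 'g) gchain set" where "bds = gboundaries G 1 Y"

private abbreviation pc :: "(real \<Rightarrow> 'y) \<Rightarrow> 'g \<Rightarrow> ('y, 'g) gchain" where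
  "pc p u \<equiv> Poly_Mapping.single (path_simplex p) u"

lemma bds_zero: "0 \<in> bds"
  unfolding bds_def gboundaries_def by (rule image_eqI[of _ _ 0]) (simp_all add: boundary_zero)

lemma bds_add: "c \<in> bds \<Longrightarrow> d \<in> bds \<Longrightarrow> c + d \<in> bds"
  unfolding bds_def gboundaries_def
  by (auto simp flip: boundary_add intro!: imageI dest!: subsetD[OF keys_add])

lemma bds_minus: "c \<in> bds \<Longrightarrow> - c \<in> bds"
  unfolding bds_def gboundaries_def by (auto simp flip: boundary_minus intro!: imageI simp: keys_minus)

lemma bds_diff: "c \<in> bds \<Longrightarrow> d \<in> bds \<Longrightarrow> c - d \<in> bds"
  using bds_add[of c "- d"] bds_minus[of d] by simp

text \<open>It is enough to treat one triangle: the end points of its three edges cancel in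
  pairs.\<close>

lemma bds_cycle: "c \<in> bds \<Longrightarrow> Poly_Mapping.keys c \<subseteq> singular_simplex_set 1 Y \<and> gchain_boundary 1 c = 0"
proof -
  assume "c \<in> bds"
  then obtain d where d: "Poly_Mapping.keys d \<subseteq> singular_simplex_set 2 Y" "c = gchain_boundary 2 d"
    by (auto simp: bds_def gboundaries_def)
  let ?s = "\<lambda>k. Poly_Mapping.single k (Poly_Mapping.lookup d k)"
  have c: "c = (\<Sum>k\<in>Poly_Mapping.keys d. gchain_boundary 2 (?s k))"
    unfolding d(2) by (subst (1) chain_decompose) (simp add: boundary_sum)
  have "Poly_Mapping.keys (gchain_boundary 2 (?s k)) \<subseteq> singular_simplex_set 1 Y" if "k \<in> Poly_Mapping.keys d" for k
  proof -
    have "singular_simplex 2 Y k" using that d by auto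
    then have "singular_simplex 1 Y (singular_face 2 j k)" if "j \<le> 2" for j
      using singular_simplex_singular_face[of 2 Y k j] that by simp
    then show ?thesis
      unfolding gchain_boundary_single[OF zero_less_numeral]
      by (intro order_trans[OF keys_sum]) (auto split: if_splits)
  qed
  then have "Poly_Mapping.keys c \<subseteq> singular_simplex_set 1 Y"
    unfolding c by (intro order_trans[OF keys_sum]) auto
  moreover have "gchain_boundary 1 (gchain_boundary 2 (?s k)) = 0" for k
    unfolding boundary_triangle by (simp add: boundary_add boundary_diff boundary_path)
  then have "gchain_boundary 1 c = 0" unfolding c by (simp add: boundary_sum)
  ultimately show ?thesis by blast
qed

text \<open>Any map of the planar triangle makes its three edges satisfy one relation modulo
  boundaries. Constant paths, concatenations and homotopies are all handled by choosing such a
  map.\<close>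

lemma triangle_boundary:
  assumes H: "continuous_map (top_of_set unit_triangle) Y H"
  shows "pc (\<lambda>t. H (t, 0)) u + pc (\<lambda>t. H (1 - t, t)) u - pc (\<lambda>t. H (0, t)) u \<in> bds"
proof -
  let ?X = "subtopology (powertop_real UNIV) (standard_simplex 2)"
  let ?\<tau> = "restrict (\<lambda>z. H (z 1, z 2)) (standard_simplex 2)"
  have "(z 1, z 2) \<in> unit_triangle" if "z \<in> standard_simplex 2" for z
  proof -
    have "z 0 + z 1 + z 2 = 1" "0 \<le> z 0" "0 \<le> z 1" "0 \<le> z 2"
      using that by (auto simp: standard_simplex_def atMost_2)
    then show ?thesis by (simp add: unit_triangle_def)
  qed
  then have "continuous_map ?X (top_of_set unit_triangle) (\<lambda>z. (z 1, z 2))"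
    unfolding continuous_map_in_subtopology
    by (auto simp: euclidean_product_topology
        intro!: continuous_intros continuous_on_product_coordinates[THEN continuous_on_subset])
  from continuous_map_compose[OF this H]
  have "continuous_map ?X Y (\<lambda>z. H (z 1, z 2))" by (simp add: o_def)
  then have "continuous_map ?X Y ?\<tau>" by (rule continuous_map_eq) simp
  then have \<tau>: "?\<tau> \<in> singular_simplex_set 2 Y" by (simp add: singular_simplex_def)
  have "gchain_boundary 2 (Poly_Mapping.single ?\<tau> u) \<in> bds"
    unfolding bds_def gboundaries_def
    by (rule image_eqI[of _ _ "Poly_Mapping.single ?\<tau> u"]) (use \<tau> in \<open>auto split: if_splits\<close>)
  moreover have "?\<tau> (tri z) = H z" if "z \<in> unit_triangle" for z
    using tri_simplex[OF that] by (simp add: tri_def)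
  then have "path_simplex (\<lambda>t. ?\<tau> (tri (1 - t, t))) = path_simplex (\<lambda>t. H (1 - t, t))"
    "path_simplex (\<lambda>t. ?\<tau> (tri (0, t))) = path_simplex (\<lambda>t. H (0, t))"
    "path_simplex (\<lambda>t. ?\<tau> (tri (t, 0))) = path_simplex (\<lambda>t. H (t, 0))"
    by (auto intro!: path_simplex_cong simp: unit_triangle_def)
  ultimately show ?thesis
    unfolding boundary_triangle by (simp add: algebra_simps)
qed

lemma const_boundary:
  assumes "y \<in> topspace Y" shows "pc (\<lambda>_. y) u \<in> bds"
  using triangle_boundary[of "\<lambda>_. y" u] assms by simp

lemma join_boundary:
  assumes "pathin Y p" "pathin Y q" "p 1 = q 0"
  shows "pc p u + pc q u - pc (p +++ q) u \<in> bds"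
proof -
  \<comment> \<open>Along the three edges the argument is \<open>t / 2\<close>,
    \<open>(1 + t) / 2\<close> and \<open>t\<close>, so they carry \<open>p\<close>,
    \<open>q\<close> and the concatenation.\<close>
  let ?H = "(p +++ q) \<circ> (\<lambda>z. fst z / 2 + snd z)"
  have "continuous_map (top_of_set unit_triangle) Y ?H"
  proof (rule continuous_map_compose)
    show "continuous_map (top_of_set unit_triangle) (top_of_set {0..1}) (\<lambda>z. fst z / 2 + snd z)"
      by (auto simp: continuous_map_in_subtopology unit_triangle_def intro!: continuous_intros)
    show "continuous_map (top_of_set {0..1}) Y (p +++ q)"
      using pathin_join[OF assms] by (simp add: pathin_def)
  qed
  from triangle_boundary[OF this, of u]
  have "pc (\<lambda>t. ?H (t, 0)) u + pc (\<lambda>t. ?H (1 - t, t)) u - pc (\<lambda>t. ?H (0, t)) u \<in> bds" .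
  moreover have "path_simplex (\<lambda>t. ?H (t, 0)) = path_simplex p"
    by (rule path_simplex_cong) (simp add: joinpaths_def)
  moreover have "path_simplex (\<lambda>t. ?H (1 - t, t)) = path_simplex q"
  proof (rule path_simplex_cong)
    fix t :: real assume "0 \<le> t" "t \<le> 1"
    moreover have "2 * ((1 - t) / 2 + t) - 1 = t" by (simp add: field_simps)
    ultimately show "?H (1 - t, t) = q t"
      using assms(3) by (cases "t = 0") (auto simp: joinpaths_def field_simps)
  qed
  moreover have "path_simplex (\<lambda>t. ?H (0, t)) = path_simplex (p +++ q)"
    by (rule path_simplex_cong) simp
  ultimately show ?thesis by simp
qed

text \<open>The square of the homotopy is cut along its diagonal into two triangles. Each relates
  one of the paths to the diagonal, up to a constant side, which is itself a boundary.\<close>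

lemma homotopic_boundary:
  assumes "path_homotopic Y p q"
  shows "pc p u - pc q u \<in> bds"
proof -
  obtain K :: "real \<times> real \<Rightarrow> 'y" where K: "continuous_map (top_of_set ({0..1} \<times> {0..1})) Y K"
    "\<And>t. K (0, t) = p t" "\<And>t. K (1, t) = q t"
    "\<And>s. 0 \<le> s \<Longrightarrow> s \<le> 1 \<Longrightarrow> K (s, 0) = p 0" "\<And>s. 0 \<le> s \<Longrightarrow> s \<le> 1 \<Longrightarrow> K (s, 1) = p 1"
    using assms by (rule path_homotopicE) blast
  have p: "pathin Y p" using assms by (rule path_homotopicD)
  have c: "pc (\<lambda>_. p 0) u \<in> bds" "pc (\<lambda>_. p 1) u \<in> bds"
    using path_start_in_topspace[OF p] path_finish_in_topspace[OF p] by (auto intro: const_boundary)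
  let ?D = "pc (\<lambda>t. K (t, t)) u"
  have "continuous_map (top_of_set unit_triangle) Y (K \<circ> (\<lambda>z. (snd z, fst z + snd z)))"
    by (rule continuous_map_compose[OF _ K(1)])
       (auto simp: continuous_map_in_subtopology unit_triangle_def intro!: continuous_intros)
  from triangle_boundary[OF this, of u]
  have "pc p u + pc (\<lambda>t. K (t, 1)) u - ?D \<in> bds" by (simp add: K(2) eta_contract_eq)
  moreover have "path_simplex (\<lambda>t. K (t, 1)) = path_simplex (\<lambda>_. p 1)"
    by (rule path_simplex_cong) (simp add: K(5))
  ultimately have "pc p u + pc (\<lambda>_. p 1) u - ?D \<in> bds" by simp
  from bds_diff[OF this c(2)]
  have "pc p u + pc (\<lambda>_. p 1) u - ?D - pc (\<lambda>_. p 1) u \<in> bds" .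
  then have 1: "pc p u - ?D \<in> bds" by (simp add: algebra_simps)
  have "continuous_map (top_of_set unit_triangle) Y (K \<circ> (\<lambda>z. (fst z + snd z, snd z)))"
    by (rule continuous_map_compose[OF _ K(1)])
       (auto simp: continuous_map_in_subtopology unit_triangle_def intro!: continuous_intros)
  from triangle_boundary[OF this, of u]
  have "pc (\<lambda>t. K (t, 0)) u + pc q u - ?D \<in> bds" by (simp add: K(3) eta_contract_eq)
  moreover have "path_simplex (\<lambda>t. K (t, 0)) = path_simplex (\<lambda>_. p 0)"
    by (rule path_simplex_cong) (simp add: K(4))
  ultimately have "pc (\<lambda>_. p 0) u + pc q u - ?D \<in> bds" by simp
  from bds_diff[OF this c(1)]
  have "pc (\<lambda>_. p 0) u + pc q u - ?D - pc (\<lambda>_. p 0) u \<in> bds" .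
  then have 2: "pc q u - ?D \<in> bds" by (simp add: algebra_simps)
  show ?thesis using bds_diff[OF 1 2] by simp
qed

private abbreviation "Z \<equiv> gcycle_group G 1 Y"
private abbreviation "H \<equiv> ghomology_group G 1 Y"
private abbreviation "cls \<equiv> ghomology_class G 1 Y"

lemma cycle_iff: "c \<in> carrier Z \<longleftrightarrow> Poly_Mapping.keys c \<subseteq> singular_simplex_set 1 Y \<and> gchain_boundary 1 c = 0"
  by (simp add: gcycle_group_def)

lemma Z_ops [simp]: "c \<otimes>\<^bsub>Z\<^esub> d = c + d" "\<one>\<^bsub>Z\<^esub> = 0"
  by (simp_all add: gcycle_group_def)

lemma comm_group_Z: "comm_group Z"
proof (rule comm_groupI)
  show "x \<otimes>\<^bsub>Z\<^esub> y \<in> carrier Z" if "x \<in> carrier Z" "y \<in> carrier Z" for x y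
    using that subsetD[OF keys_add, of _ x y] by (auto simp: cycle_iff boundary_add)
  show "\<exists>y\<in>carrier Z. y \<otimes>\<^bsub>Z\<^esub> x = \<one>\<^bsub>Z\<^esub>" if "x \<in> carrier Z" for x
    using that by (intro bexI[of _ "- x"]) (auto simp: cycle_iff boundary_minus keys_minus)
qed (auto simp: cycle_iff boundary_zero add_ac)

lemma bds_subgroup: "subgroup bds Z"
proof -
  interpret Z: comm_group Z by (rule comm_group_Z)
  show ?thesis
  proof (rule Z.subgroupI)
    show "bds \<subseteq> carrier Z" using bds_cycle by (auto simp: cycle_iff)
    show "bds \<noteq> {}" using bds_zero by blast
    show "inv\<^bsub>Z\<^esub> a \<in> bds" if "a \<in> bds" for a
    proof -
      have "inv\<^bsub>Z\<^esub> a = - a"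
        using that bds_minus[OF that] bds_cycle by (intro Z.inv_equality) (auto simp: cycle_iff)
      then show ?thesis using bds_minus[OF that] by simp
    qed
  qed (auto intro: bds_add)
qed

lemma comm_group_H: "comm_group H"
  using comm_group.abelian_FactGroup[OF comm_group_Z bds_subgroup]
  by (simp add: ghomology_group_def bds_def)

lemma cls_eq: "cls c = {b + c |b. b \<in> bds}"
  by (auto simp: ghomology_class_def r_coset_def bds_def)

lemma cls_mem: "d \<in> cls c \<longleftrightarrow> d - c \<in> bds"
  unfolding cls_eq by (auto intro: exI[of _ "d - c"])

lemma cls_self: "c \<in> cls c"
  by (simp add: cls_mem bds_zero)

lemma cls_cong:
  assumes "c - d \<in> bds"
  shows "cls c = cls d"
proof -
  have "x - c \<in> bds \<longleftrightarrow> x - d \<in> bds" for x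
    using bds_add[OF _ assms, of "x - c"] bds_diff[OF _ assms, of "x - d"] by auto
  then show ?thesis by (auto simp: cls_mem)
qed

lemma cls_carrier: "C \<in> carrier H \<longleftrightarrow> (\<exists>c\<in>carrier Z. C = cls c)"
  by (auto simp: ghomology_group_def FactGroup_def RCOSETS_def ghomology_class_def)

lemma cls_mult:
  assumes "c \<in> carrier Z" "d \<in> carrier Z"
  shows "cls c \<otimes>\<^bsub>H\<^esub> cls d = cls (c + d)"
proof -
  interpret Z: comm_group Z by (rule comm_group_Z)
  interpret N: normal bds Z using bds_subgroup by (rule Z.subgroup_imp_normal)
  show ?thesis
    using N.rcos_sum[OF assms] by (simp add: ghomology_group_def FactGroup_def ghomology_class_def bds_def)
qed

lemma cls_one: "\<one>\<^bsub>H\<^esub> = cls 0"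
  by (simp add: ghomology_group_def FactGroup_def cls_eq bds_def[symmetric])

lemma cls_sum:
  assumes "finite A" "\<And>k. k \<in> A \<Longrightarrow> f k \<in> carrier Z \<and> cls (f k) \<in> generate H E" "E \<subseteq> carrier H"
  shows "sum f A \<in> carrier Z \<and> cls (sum f A) \<in> generate H E"
  using assms(1,2)
proof (induct A rule: finite_induct)
  case empty
  interpret Z: comm_group Z by (rule comm_group_Z)
  have "(0 :: ('y, 'g) gchain) \<in> carrier Z" using Z.one_closed by simp
  then show ?case using generate.one[of H E] cls_one by simp
next
  case (insert x A)
  interpret Z: comm_group Z by (rule comm_group_Z)
  have *: "f x \<in> carrier Z" "sum f A \<in> carrier Z" "cls (f x) \<in> generate H E" "cls (sum f A) \<in> generate H E"
    using insert by auto
  have "f x + sum f A \<in> carrier Z" using Z.m_closed[OF *(1,2)] by simp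
  then show ?case
    using insert(1,2) generate.eng[OF *(3,4)] cls_mult[OF *(1,2)] by simp
qed

lemma loop_homology_class_eq: "loop_homology_class G Y u g = cls (pc g u)"
  by (simp add: loop_homology_class_def path_simplex_def)

lemma loop_cycle: "pathin Y g \<Longrightarrow> g 0 = g 1 \<Longrightarrow> pc g u \<in> carrier Z"
  using singular_path_simplex[of Y g] by (auto simp: cycle_iff boundary_path split: if_splits)

subsection \<open>Path functors with values in homology\<close>

context
  fixes b :: 'y and c :: "'y \<Rightarrow> real \<Rightarrow> 'y"
  assumes base: "base_paths Y b c"
begin

text \<open>The path is closed by its connecting paths at the level of chains, where they enter with
  opposite signs. Additivity under concatenation is then a telescoping identity, with no homotopies
  of based loops.\<close>

definition cyc :: "'g \<Rightarrow> (real \<Rightarrow> 'y) \<Rightarrow> ('y, 'g) gchain" where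
  "cyc u p = pc (c (p 0)) u + pc p u - pc (c (p 1)) u"

lemma cyc_cycle:
  assumes p: "pathin Y p" shows "cyc u p \<in> carrier Z"
proof -
  note e = base_paths.c_ends[OF base p]
  have "Poly_Mapping.keys (cyc u p) \<subseteq> singular_simplex_set 1 Y"
    unfolding cyc_def
    using singular_path_simplex[OF e(1)] singular_path_simplex[OF e(4)] singular_path_simplex[OF p]
    by (intro order_trans[OF keys_diff] Un_least order_trans[OF keys_add]) (auto split: if_splits)
  moreover have "gchain_boundary 1 (cyc u p) = 0"
    unfolding cyc_def using e by (simp add: boundary_add boundary_diff boundary_path)
  ultimately show ?thesis by (simp add: cycle_iff)
qed

definition hpath :: "'g \<Rightarrow> (real \<Rightarrow> 'y) \<Rightarrow> ('y, 'g) gchain set" where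
  "hpath u p = cls (cyc u p)"

lemma path_functor_hpath: "path_functor H Y (hpath u)"
proof -
  interpret H: comm_group H by (rule comm_group_H)
  show ?thesis
  proof unfold_locales
    show "hpath u p \<in> carrier H" if "pathin Y p" for p
      using cyc_cycle[OF that] by (auto simp: hpath_def cls_carrier)
    show "hpath u p = hpath u q" if h: "path_homotopic Y p q" for p q
      unfolding hpath_def
    proof (rule cls_cong)
      show "cyc u p - cyc u q \<in> bds"
        using homotopic_boundary[OF h] path_homotopicD[OF h] by (simp add: cyc_def)
    qed
    show "hpath u (p +++ q) = hpath u p \<otimes>\<^bsub>H\<^esub> hpath u q" if pq: "pathin Y p" "pathin Y q" "p 1 = q 0" for p q
    proof -
      have "cyc u (p +++ q) - (cyc u p + cyc u q) = - (pc p u + pc q u - pc (p +++ q) u)"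
        using pq(3) by (simp add: cyc_def)
      then have "cyc u (p +++ q) - (cyc u p + cyc u q) \<in> bds"
        using bds_minus[OF join_boundary[OF pq]] by metis
      then show ?thesis
        unfolding hpath_def using cyc_cycle[OF pq(1)] cyc_cycle[OF pq(2)] by (simp add: cls_mult cls_cong)
    qed
  qed
qed

lemma hpath_loop: "pathin Y g \<Longrightarrow> g 0 = g 1 \<Longrightarrow> hpath u g = loop_homology_class G Y u g"
  by (simp add: hpath_def cyc_def loop_homology_class_eq)

lemma hpath_add: "pathin Y p \<Longrightarrow> hpath (u + v) p = hpath u p \<otimes>\<^bsub>H\<^esub> hpath v p"
  by (simp add: hpath_def cls_mult cyc_cycle) (simp add: cyc_def single_add algebra_simps)

text \<open>Closing by concatenation and closing by chains agree in homology, because the connecting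
  paths themselves have trivial value: their chain closure is a constant path at
  \<open>b\<close>.\<close>

lemma hpath_based:
  assumes p: "pathin Y p"
  shows "hpath u (base_paths.based c p) = hpath u p"
proof -
  interpret H: comm_group H by (rule comm_group_H)
  interpret F: path_functor H Y "hpath u" by (rule path_functor_hpath)
  interpret B: base_paths Y b c by (rule base)
  note e = B.c_ends[OF p]
  let ?r = "reversepath (c (p 1))"
  have r: "pathin Y ?r" "pathin Y (p +++ ?r)"
    using p e by (auto intro!: pathin_join pathin_reversepath)
  have const: "hpath u (c y) = \<one>\<^bsub>H\<^esub>" if "y \<in> topspace Y" for y
  proof -
    have y: "c y 0 = b" "c y 1 = y" using B.c_path[OF that] by auto
    have "cyc u (c y) - 0 \<in> bds"
      using const_boundary[OF B.b, of u] by (simp add: cyc_def y B.c_base)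
    then show ?thesis unfolding hpath_def cls_one by (rule cls_cong)
  qed
  have "hpath u (B.based p) = hpath u (c (p 0)) \<otimes>\<^bsub>H\<^esub> (hpath u p \<otimes>\<^bsub>H\<^esub> hpath u ?r)"
    unfolding B.based_def using e r p by (simp add: F.F_join)
  also have "\<dots> = hpath u p"
    using const path_start_in_topspace[OF p] path_finish_in_topspace[OF p] e p
    by (simp add: F.F_reversepath)
  finally show ?thesis .
qed

text \<open>Coning off the boundary of each simplex of a cycle replaces the simplex by a loop
  through \<open>b\<close>. The cones add up to the cone of the boundary of the whole cycle, which
  vanishes.\<close>

lemma H_generate:
  assumes C: "C \<in> carrier H"
  shows "C \<in> generate H {loop_homology_class G Y u g |u g. loop_in Y b g}" (is "_ \<in> generate H ?E")
proof -
  interpret B: base_paths Y b c by (rule base)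
  obtain z where z: "z \<in> carrier Z" "C = cls z" using C by (auto simp: cls_carrier)
  have keys: "Poly_Mapping.keys z \<subseteq> singular_simplex_set 1 Y" and bz: "gchain_boundary 1 z = 0"
    using z(1) by (auto simp: cycle_iff)
  let ?l = "Poly_Mapping.lookup z" and ?K = "Poly_Mapping.keys z"
  let ?p = "\<lambda>\<sigma>. simplex_path \<sigma>"
  \<comment> \<open>Evaluating a 0-simplex at the only point of the standard 0-simplex recovers the
    point it represents, and the cone is the connecting path to it.\<close>
  define cone :: "('y, 'g) gchain \<Rightarrow> ('y, 'g) gchain" where
    "cone = chain_sum (\<lambda>q u. pc (c (q (\<lambda>j. if j = 0 then 1 else 0))) u)"
  have add: "Modules.additive cone" unfolding cone_def by (rule additive_chain_sum) (simp add: single_add)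
  have cone1: "cone (Poly_Mapping.single (point_simplex y) u) = pc (c y) u" for y u
    unfolding cone_def by (subst chain_sum_single) (simp_all add: point_simplex_def standard_simplex_0)
  have split: "cyc (?l \<sigma>) (?p \<sigma>) = Poly_Mapping.single \<sigma> (?l \<sigma>) - cone (gchain_boundary 1 (Poly_Mapping.single \<sigma> (?l \<sigma>)))"
    if "\<sigma> \<in> ?K" for \<sigma>
  proof -
    have s: "path_simplex (?p \<sigma>) = \<sigma>" using path_simplex_path that keys by blast
    have "gchain_boundary 1 (Poly_Mapping.single \<sigma> (?l \<sigma>)) =
      Poly_Mapping.single (point_simplex (?p \<sigma> 1)) (?l \<sigma>) - Poly_Mapping.single (point_simplex (?p \<sigma> 0)) (?l \<sigma>)"
      using boundary_path[of "?p \<sigma>" "?l \<sigma>"] by (simp add: s)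
    then show ?thesis
      unfolding cyc_def by (simp add: s Modules.additive.diff[OF add] cone1)
  qed
  have "(\<Sum>\<sigma>\<in>?K. cyc (?l \<sigma>) (?p \<sigma>)) =
      (\<Sum>\<sigma>\<in>?K. Poly_Mapping.single \<sigma> (?l \<sigma>)) - cone (gchain_boundary 1 (\<Sum>\<sigma>\<in>?K. Poly_Mapping.single \<sigma> (?l \<sigma>)))"
    using split by (simp add: sum_subtractf boundary_sum Modules.additive.sum[OF add])
  also have "\<dots> = z"
    using bz by (simp add: chain_decompose[symmetric] Modules.additive.zero[OF add])
  finally have eq: "z = (\<Sum>\<sigma>\<in>?K. cyc (?l \<sigma>) (?p \<sigma>))" by simp
  have E: "?E \<subseteq> carrier H"
    using loop_cycle by (force simp: loop_homology_class_eq cls_carrier loop_in_def)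
  have mem: "cyc (?l \<sigma>) (?p \<sigma>) \<in> carrier Z \<and> cls (cyc (?l \<sigma>) (?p \<sigma>)) \<in> generate H ?E" if "\<sigma> \<in> ?K" for \<sigma>
  proof
    have p: "pathin Y (?p \<sigma>)" using that keys by (auto intro: pathin_simplex_path)
    show "cyc (?l \<sigma>) (?p \<sigma>) \<in> carrier Z" by (rule cyc_cycle[OF p])
    have "cls (cyc (?l \<sigma>) (?p \<sigma>)) = loop_homology_class G Y (?l \<sigma>) (B.based (?p \<sigma>))"
      using hpath_based[OF p] hpath_loop B.based_loop[OF p] unfolding hpath_def[symmetric]
      by (metis loop_inD)
    then show "cls (cyc (?l \<sigma>) (?p \<sigma>)) \<in> generate H ?E"
      using B.based_loop[OF p] by (auto intro!: generate.incl)
  qed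
  have "cls (\<Sum>\<sigma>\<in>?K. cyc (?l \<sigma>) (?p \<sigma>)) \<in> generate H ?E"
    by (rule conjunct2[OF cls_sum[OF finite_keys mem E]])
  then show ?thesis
    unfolding z(2) by (simp only: eq[symmetric])
qed

end

subsection \<open>Homomorphisms out of homology\<close>

text \<open>The coefficient enters as the index of a functor, so no action of coefficients on
  \<open>Q\<close> has to exist; additivity of \<open>T\<close> in its index is what makes the
  product additive in the chain.\<close>

definition eval_chain :: "('q, 'm) monoid_scheme \<Rightarrow> ('g \<Rightarrow> (real \<Rightarrow> 'y) \<Rightarrow> 'q) \<Rightarrow> ('y, 'g) gchain \<Rightarrow> 'q" where
  "eval_chain Q T c = finprod Q (\<lambda>\<sigma>. T (Poly_Mapping.lookup c \<sigma>) (simplex_path \<sigma>)) (Poly_Mapping.keys c)"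

definition homology_hom :: "('q, 'm) monoid_scheme \<Rightarrow> ('g \<Rightarrow> (real \<Rightarrow> 'y) \<Rightarrow> 'q) \<Rightarrow> ('y, 'g) gchain set \<Rightarrow> 'q" where
  "homology_hom Q T C = eval_chain Q T (SOME c. c \<in> C)"

context
  fixes Q :: "('q, 'm) monoid_scheme" and T :: "'g \<Rightarrow> (real \<Rightarrow> 'y) \<Rightarrow> 'q"
  assumes Q: "comm_group Q" and T: "\<And>u. path_functor Q Y (T u)"
    and T_add: "\<And>u v p. pathin Y p \<Longrightarrow> T (u + v) p = T u p \<otimes>\<^bsub>Q\<^esub> T v p"
begin

lemma T_closed: "pathin Y p \<Longrightarrow> T u p \<in> carrier Q"
  by (rule path_functor.F_closed[OF T])

lemma T_zero: "pathin Y p \<Longrightarrow> T 0 p = \<one>\<^bsub>Q\<^esub>"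
proof -
  interpret comm_group Q by (rule Q)
  assume p: "pathin Y p"
  have "T 0 p \<otimes>\<^bsub>Q\<^esub> T 0 p = T 0 p" using T_add[OF p, of 0 0] by simp
  then show ?thesis using T_closed[OF p] by (simp add: l_cancel_one)
qed

text \<open>The functor for coefficient 0 is trivial, so simplices outside the support may be
  included. Two chains can thus be evaluated over a common finite set although terms cancel in their
  sum.\<close>

lemma eval_chain_superset:
  assumes "finite A" "Poly_Mapping.keys c \<subseteq> A" "A \<subseteq> singular_simplex_set 1 Y"
  shows "eval_chain Q T c = finprod Q (\<lambda>\<sigma>. T (Poly_Mapping.lookup c \<sigma>) (simplex_path \<sigma>)) A"
proof -
  interpret comm_group Q by (rule Q)
  have p: "pathin Y (simplex_path \<sigma>)" if "\<sigma> \<in> A" for \<sigma>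
    using that assms(3) by (auto intro: pathin_simplex_path)
  show ?thesis
    unfolding eval_chain_def
    by (rule finprod_mono_neutral_cong_left[OF assms(1,2)])
       (use p T_zero T_closed in \<open>auto simp: in_keys_iff Pi_iff\<close>)
qed

lemma eval_chain_closed: "Poly_Mapping.keys c \<subseteq> singular_simplex_set 1 Y \<Longrightarrow> eval_chain Q T c \<in> carrier Q"
proof -
  interpret comm_group Q by (rule Q)
  assume "Poly_Mapping.keys c \<subseteq> singular_simplex_set 1 Y"
  then show ?thesis
    unfolding eval_chain_def by (intro finprod_closed) (auto intro!: T_closed pathin_simplex_path)
qed

lemma eval_chain_add:
  assumes "Poly_Mapping.keys c \<subseteq> singular_simplex_set 1 Y" "Poly_Mapping.keys d \<subseteq> singular_simplex_set 1 Y"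
  shows "eval_chain Q T (c + d) = eval_chain Q T c \<otimes>\<^bsub>Q\<^esub> eval_chain Q T d"
proof -
  interpret comm_group Q by (rule Q)
  let ?A = "Poly_Mapping.keys c \<union> Poly_Mapping.keys d"
  have A: "finite ?A" "?A \<subseteq> singular_simplex_set 1 Y" using assms by auto
  have p: "pathin Y (simplex_path \<sigma>)" if "\<sigma> \<in> ?A" for \<sigma>
    using that A(2) by (intro pathin_simplex_path) blast
  have "eval_chain Q T (c + d) =
      finprod Q (\<lambda>\<sigma>. T (Poly_Mapping.lookup c \<sigma>) (simplex_path \<sigma>) \<otimes>\<^bsub>Q\<^esub> T (Poly_Mapping.lookup d \<sigma>) (simplex_path \<sigma>)) ?A"
    unfolding eval_chain_superset[OF A(1) keys_add A(2)]
    by (rule finprod_cong') (use p in \<open>auto simp: lookup_add T_add Pi_iff T_closed\<close>)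
  also have "\<dots> = eval_chain Q T c \<otimes>\<^bsub>Q\<^esub> eval_chain Q T d"
    using p unfolding eval_chain_superset[OF A(1) Un_upper1 A(2)] eval_chain_superset[OF A(1) Un_upper2 A(2)]
    by (intro finprod_multf) (auto intro: T_closed)
  finally show ?thesis .
qed

lemma eval_chain_single:
  assumes p: "pathin Y p"
  shows "eval_chain Q T (pc p u) = T u p"
proof -
  interpret comm_group Q by (rule Q)
  have "eval_chain Q T (pc p u) = T u (simplex_path (path_simplex p))"
    using singular_path_simplex[OF p] T_closed[OF pathin_simplex_path[OF singular_path_simplex[OF p]]]
    by (subst eval_chain_superset[of "{path_simplex p}"]) auto
  also have "\<dots> = T u p"
    using path_functor.F_cong[OF T p] simplex_path_simplex by blast
  finally show ?thesis .
qed

lemma eval_chain_zero: "eval_chain Q T 0 = \<one>\<^bsub>Q\<^esub>"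
proof -
  interpret comm_group Q by (rule Q)
  show ?thesis by (simp add: eval_chain_def)
qed

lemma eval_chain_minus:
  assumes "Poly_Mapping.keys c \<subseteq> singular_simplex_set 1 Y"
  shows "eval_chain Q T (- c) = inv\<^bsub>Q\<^esub> eval_chain Q T c"
proof -
  interpret comm_group Q by (rule Q)
  have k: "Poly_Mapping.keys (- c) \<subseteq> singular_simplex_set 1 Y" using assms by (simp add: keys_minus)
  have "eval_chain Q T (- c) \<otimes>\<^bsub>Q\<^esub> eval_chain Q T c = \<one>\<^bsub>Q\<^esub>"
    using eval_chain_add[OF k assms] by (simp add: eval_chain_zero)
  then show ?thesis
    using eval_chain_closed[OF assms] eval_chain_closed[OF k] by (simp add: inv_equality)
qed

text \<open>In the convex triangle the path along two edges is homotopic to the third, so the value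
  of the third edge is the product of the other two; commutativity makes the alternating product
  trivial.\<close>

lemma eval_chain_triangle:
  assumes \<tau>: "\<tau> \<in> singular_simplex_set 2 Y"
  shows "eval_chain Q T (gchain_boundary 2 (Poly_Mapping.single \<tau> u)) = \<one>\<^bsub>Q\<^esub>"
proof -
  interpret comm_group Q by (rule Q)
  interpret F: path_functor Q Y "T u" by (rule T)
  let ?H = "\<tau> \<circ> tri"
  let ?a = "\<lambda>t. (t, 0::real)" and ?b = "\<lambda>t. (1 - t, t::real)" and ?d = "\<lambda>t. (0::real, t::real)"
  note H = continuous_map_tri[OF \<tau>]
  have side: "continuous_on {0..1} ?a" "continuous_on {0..1} ?b" "continuous_on {0..1} ?d"
    "?a ` {0..1} \<subseteq> unit_triangle" "?b ` {0..1} \<subseteq> unit_triangle" "?d ` {0..1} \<subseteq> unit_triangle"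
    by (auto simp: unit_triangle_def intro!: continuous_intros)
  have pth: "pathin Y (?H \<circ> h)" if "continuous_on {0..1} h" "h ` {0..1} \<subseteq> unit_triangle" for h
    unfolding pathin_def
    by (rule continuous_map_compose[OF _ H]) (use that in \<open>auto simp: continuous_map_in_subtopology\<close>)
  have hom: "path_homotopic Y (?H \<circ> (?a +++ ?b)) (?H \<circ> ?d)"
  proof (rule path_homotopic_convex[OF convex_triangle H])
    show "continuous_on {0..1} (?a +++ ?b)"
      unfolding path_def[symmetric] using side
      by (auto intro!: path_join_imp) (auto simp: path_def pathstart_def pathfinish_def intro!: continuous_intros)
    show "(?a +++ ?b) ` {0..1} \<subseteq> unit_triangle"
      using side(4,5) by (auto simp: joinpaths_def unit_triangle_def)
  qed (use side in \<open>auto simp: joinpaths_def\<close>)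
  have "T u (?H \<circ> ?d) = T u (?H \<circ> (?a +++ ?b))" by (rule F.F_homotopic[OF hom, symmetric])
  also have "?H \<circ> (?a +++ ?b) = (?H \<circ> ?a) +++ (?H \<circ> ?b)" by (auto simp: joinpaths_def)
  also have "T u ((?H \<circ> ?a) +++ (?H \<circ> ?b)) = T u (?H \<circ> ?a) \<otimes>\<^bsub>Q\<^esub> T u (?H \<circ> ?b)"
    using pth[OF side(1,4)] pth[OF side(2,5)] by (intro F.F_join) auto
  finally have eq: "T u (?H \<circ> ?d) = T u (?H \<circ> ?a) \<otimes>\<^bsub>Q\<^esub> T u (?H \<circ> ?b)" .
  have b: "gchain_boundary 2 (Poly_Mapping.single \<tau> u) = pc (?H \<circ> ?b) u + - pc (?H \<circ> ?d) u + pc (?H \<circ> ?a) u"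
    unfolding boundary_triangle by (simp add: o_def)
  have k: "Poly_Mapping.keys (pc (?H \<circ> h) u) \<subseteq> singular_simplex_set 1 Y" 
    if "continuous_on {0..1} h" "h ` {0..1} \<subseteq> unit_triangle" for h
    using singular_path_simplex[OF pth[OF that]] by (auto split: if_splits)
  have k2: "Poly_Mapping.keys (- pc (?H \<circ> ?d) u) \<subseteq> singular_simplex_set 1 Y"
    using k[OF side(3,6)] by (simp add: keys_minus)
  have k3: "Poly_Mapping.keys (pc (?H \<circ> ?b) u + - pc (?H \<circ> ?d) u) \<subseteq> singular_simplex_set 1 Y"
    by (rule order_trans[OF keys_add Un_least[OF k[OF side(2,5)] k2]])
  have "eval_chain Q T (gchain_boundary 2 (Poly_Mapping.single \<tau> u)) =
      T u (?H \<circ> ?b) \<otimes>\<^bsub>Q\<^esub> inv\<^bsub>Q\<^esub> T u (?H \<circ> ?d) \<otimes>\<^bsub>Q\<^esub> T u (?H \<circ> ?a)"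
    unfolding b eval_chain_add[OF k3 k[OF side(1,4)]] eval_chain_add[OF k[OF side(2,5)] k2]
      eval_chain_minus[OF k[OF side(3,6)]]
      eval_chain_single[OF pth[OF side(1,4)]] eval_chain_single[OF pth[OF side(2,5)]] eval_chain_single[OF pth[OF side(3,6)]]
    ..
  also have "\<dots> = \<one>\<^bsub>Q\<^esub>"
  proof -
    have cl: "T u (?H \<circ> ?a) \<in> carrier Q" "T u (?H \<circ> ?b) \<in> carrier Q"
      using pth[OF side(1,4)] pth[OF side(2,5)] by (auto intro: T_closed)
    have "b \<otimes>\<^bsub>Q\<^esub> inv\<^bsub>Q\<^esub> (a \<otimes>\<^bsub>Q\<^esub> b) \<otimes>\<^bsub>Q\<^esub> a = \<one>\<^bsub>Q\<^esub>" if ab: "a \<in> carrier Q" "b \<in> carrier Q" for a b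
    proof -
      let ?i = "inv\<^bsub>Q\<^esub> (a \<otimes>\<^bsub>Q\<^esub> b)"
      have i: "?i \<in> carrier Q" using ab by simp
      have "b \<otimes>\<^bsub>Q\<^esub> ?i \<otimes>\<^bsub>Q\<^esub> a = a \<otimes>\<^bsub>Q\<^esub> (b \<otimes>\<^bsub>Q\<^esub> ?i)"
        using ab i by (intro m_comm) auto
      also have "\<dots> = a \<otimes>\<^bsub>Q\<^esub> b \<otimes>\<^bsub>Q\<^esub> ?i"
        by (rule m_assoc[symmetric, OF ab i])
      also have "\<dots> = \<one>\<^bsub>Q\<^esub>" using ab by (intro r_inv) simp
      finally show ?thesis .
    qed
    then show ?thesis using cl eq by simp
  qed
  finally show ?thesis .
qed

lemma eval_chain_bds:
  assumes "c \<in> bds" shows "eval_chain Q T c = \<one>\<^bsub>Q\<^esub>"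
proof -
  interpret comm_group Q by (rule Q)
  obtain d where d: "Poly_Mapping.keys d \<subseteq> singular_simplex_set 2 Y" "c = gchain_boundary 2 d"
    using assms by (auto simp: bds_def gboundaries_def)
  let ?s = "\<lambda>k. gchain_boundary 2 (Poly_Mapping.single k (Poly_Mapping.lookup d k))"
  have c: "c = sum ?s (Poly_Mapping.keys d)"
    unfolding d(2) by (subst (1) chain_decompose) (simp add: boundary_sum)
  have s: "?s k \<in> bds" if "k \<in> Poly_Mapping.keys d" for k
    unfolding bds_def gboundaries_def
    by (rule image_eqI[of _ _ "Poly_Mapping.single k (Poly_Mapping.lookup d k)"]) (use that d(1) in auto)
  have main: "sum ?s A \<in> bds \<and> eval_chain Q T (sum ?s A) = \<one>\<^bsub>Q\<^esub>" if "finite A" "A \<subseteq> Poly_Mapping.keys d" for A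
    using that
  proof (induct A rule: finite_induct)
    case empty
    then show ?case by (simp add: bds_zero eval_chain_zero)
  next
    case (insert k A)
    then have A: "sum ?s A \<in> bds" "eval_chain Q T (sum ?s A) = \<one>\<^bsub>Q\<^esub>" and k: "k \<in> Poly_Mapping.keys d" by auto
    have "eval_chain Q T (?s k + sum ?s A) = eval_chain Q T (?s k) \<otimes>\<^bsub>Q\<^esub> eval_chain Q T (sum ?s A)"
      using bds_cycle[OF s[OF k]] bds_cycle[OF A(1)] by (intro eval_chain_add) auto
    also have "eval_chain Q T (?s k) = \<one>\<^bsub>Q\<^esub>" using k d(1) by (intro eval_chain_triangle) auto
    finally show ?case using insert(1,2) A bds_add[OF s[OF k] A(1)] by simp
  qed
  show ?thesis unfolding c by (rule conjunct2[OF main[OF finite_keys order_refl]])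
qed

lemma homology_hom_cls:
  assumes z: "z \<in> carrier Z"
  shows "homology_hom Q T (cls z) = eval_chain Q T z"
proof -
  interpret comm_group Q by (rule Q)
  define d where "d = (SOME c. c \<in> cls z)"
  have "d \<in> cls z" unfolding d_def by (rule someI[of "\<lambda>c. c \<in> cls z", OF cls_self])
  then have b: "d - z \<in> bds" by (simp add: cls_mem)
  have "eval_chain Q T ((d - z) + z) = eval_chain Q T (d - z) \<otimes>\<^bsub>Q\<^esub> eval_chain Q T z"
    using bds_cycle[OF b] z by (intro eval_chain_add) (auto simp: cycle_iff)
  then have "eval_chain Q T d = eval_chain Q T z"
    using eval_chain_bds[OF b] eval_chain_closed[of z] z by (simp add: cycle_iff)
  then show ?thesis by (simp add: homology_hom_def d_def)
qed

lemma homology_hom: "homology_hom Q T \<in> hom H Q"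
proof (rule homI)
  show "homology_hom Q T x \<in> carrier Q" if "x \<in> carrier H" for x
    using that eval_chain_closed by (auto simp: cls_carrier homology_hom_cls cycle_iff)
  show "homology_hom Q T (x \<otimes>\<^bsub>H\<^esub> y) = homology_hom Q T x \<otimes>\<^bsub>Q\<^esub> homology_hom Q T y"
    if xy: "x \<in> carrier H" "y \<in> carrier H" for x y
  proof -
    interpret Z: comm_group Z by (rule comm_group_Z)
    obtain c d where cd: "c \<in> carrier Z" "d \<in> carrier Z" "x = cls c" "y = cls d"
      using xy by (auto simp: cls_carrier)
    have "c + d \<in> carrier Z" using Z.m_closed[OF cd(1,2)] by simp
    then show ?thesis
      using cd by (simp add: cls_mult homology_hom_cls eval_chain_add cycle_iff)
  qed
qed

lemma homology_hom_loop:
  assumes "pathin Y g" "g 0 = g 1"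
  shows "homology_hom Q T (loop_homology_class G Y u g) = T u g"
  unfolding loop_homology_class_eq
  using homology_hom_cls[OF loop_cycle[OF assms]] eval_chain_single[OF assms(1)] by simp

end

end

end

section \<open>First homology of a geodesic space\<close>

text \<open>Classes of \<open>r\<close>-loops only generate first homology, so a property checked on
  fillings has to be extended to products. Two pairs of homomorphisms let a single witness satisfy
  two conditions at once.\<close>

lemma witness_two:
  assumes A: "group A" and B: "group B" and M: "group M1" "group M2"
    and h: "h1 \<in> hom A M1" "h2 \<in> hom A M2" and k: "k1 \<in> hom B M1" "k2 \<in> hom B M2"
    and E: "E \<subseteq> carrier A" "a \<in> generate A E"
    and gen: "\<And>e. e \<in> E \<Longrightarrow> \<exists>f\<in>carrier B. h1 e = k1 f \<and> h2 e = k2 f"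
  shows "\<exists>f\<in>carrier B. h1 a = k1 f \<and> h2 a = k2 f"
proof -
  interpret h1: group_hom A M1 h1 using A M h by (simp add: group_hom_def group_hom_axioms_def)
  interpret h2: group_hom A M2 h2 using A M h by (simp add: group_hom_def group_hom_axioms_def)
  interpret k1: group_hom B M1 k1 using B M k by (simp add: group_hom_def group_hom_axioms_def)
  interpret k2: group_hom B M2 k2 using B M k by (simp add: group_hom_def group_hom_axioms_def)
  show ?thesis
    by (rule generate_witness[OF A E(1) E(2), where P = "\<lambda>a f. h1 a = k1 f \<and> h2 a = k2 f"])
       (use gen B in auto)
qed

context
  notes One_nat_def [simp del]
begin

section \<open>Homology under maps that are the identity on points\<close>

lemma gchain_map_id:
  assumes "Poly_Mapping.keys c \<subseteq> singular_simplex_set 1 X"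
  shows "gchain_map 1 id c = c"
proof -
  have "simplex_map 1 id s = s" if "s \<in> singular_simplex_set 1 X" for s
    using that by (simp add: simplex_map_def singular_simplex_def extensional_restrict)
  then have "gchain_map 1 id c = (\<Sum>s\<in>Poly_Mapping.keys c. Poly_Mapping.single s (Poly_Mapping.lookup c s))"
    unfolding gchain_map_def using assms by (intro sum.cong) auto
  then show ?thesis by (simp flip: chain_decompose)
qed

lemma singular_simplex_mono:
  assumes "continuous_map X Y id"
  shows "singular_simplex_set p X \<subseteq> singular_simplex_set p Y"
proof
  fix f assume "f \<in> singular_simplex_set p X"
  then show "f \<in> singular_simplex_set p Y"
    using continuous_map_compose[OF _ assms, of "subtopology (powertop_real UNIV) (standard_simplex p)" f]
    by (simp add: singular_simplex_def)
qed

lemma ghomology_map_id_class: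
  fixes X Y :: "'y::topological_space topology" and G :: "'g::ab_group_add itself"
  assumes id: "continuous_map X Y id" and c: "c \<in> carrier (gcycle_group G 1 X)"
  shows "ghomology_map G 1 Y id (ghomology_class G 1 X c) = ghomology_class G 1 Y c"
    "c \<in> carrier (gcycle_group G 1 Y)"
proof -
  have b: "bds G X \<subseteq> bds G Y"
    unfolding bds_def gboundaries_def using singular_simplex_mono[OF id] by blast
  have eq: "ghomology_class G 1 Y (gchain_map 1 id d) = ghomology_class G 1 Y c" if "d \<in> ghomology_class G 1 X c" for d
  proof -
    have d: "d - c \<in> bds G X" using that by (simp add: cls_mem)
    have "Poly_Mapping.keys ((d - c) + c) \<subseteq> singular_simplex_set 1 X"
      using bds_cycle[OF d] c by (intro order_trans[OF keys_add]) (auto simp: cycle_iff)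
    then have "gchain_map 1 id d = d" by (simp add: gchain_map_id)
    then show ?thesis using cls_cong[OF subsetD[OF b d]] by simp
  qed
  have "ghomology_map G 1 Y id (ghomology_class G 1 X c) = (\<Union>d\<in>ghomology_class G 1 X c. ghomology_class G 1 Y c)"
    unfolding ghomology_map_def by (intro SUP_cong refl eq)
  then show "ghomology_map G 1 Y id (ghomology_class G 1 X c) = ghomology_class G 1 Y c"
    using cls_self[of c G X] by auto
  show "c \<in> carrier (gcycle_group G 1 Y)"
    using c singular_simplex_mono[OF id, of 1] by (auto simp: cycle_iff)
qed

lemma ghomology_map_id_hom:
  fixes X Y :: "'y::topological_space topology" and G :: "'g::ab_group_add itself"
  assumes id: "continuous_map X Y id"
  shows "ghomology_map G 1 Y id \<in> hom (ghomology_group G 1 X) (ghomology_group G 1 Y)"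
proof (rule homI)
  let ?h = "ghomology_map G 1 Y id"
  show "?h x \<in> carrier (ghomology_group G 1 Y)" if "x \<in> carrier (ghomology_group G 1 X)" for x
    using that ghomology_map_id_class[OF id] unfolding cls_carrier by metis
  show "?h (x \<otimes>\<^bsub>ghomology_group G 1 X\<^esub> y) = ?h x \<otimes>\<^bsub>ghomology_group G 1 Y\<^esub> ?h y"
    if xy: "x \<in> carrier (ghomology_group G 1 X)" "y \<in> carrier (ghomology_group G 1 X)" for x y
  proof -
    obtain c d where cd: "c \<in> carrier (gcycle_group G 1 X)" "d \<in> carrier (gcycle_group G 1 X)"
      "x = ghomology_class G 1 X c" "y = ghomology_class G 1 X d"
      using xy unfolding cls_carrier by blast
    have "c + d \<in> carrier (gcycle_group G 1 X)"
      using monoid.m_closed[OF group.is_monoid[OF comm_group.axioms(2)[OF comm_group_Z]] cd(1,2)] by simp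
    then show ?thesis
      using cd ghomology_map_id_class[OF id cd(1)] ghomology_map_id_class[OF id cd(2)]
        ghomology_map_id_class[OF id, of "c + d" G] by (simp add: cls_mult)
  qed
qed

lemma ghomology_map_loop:
  fixes X Y :: "'y::topological_space topology" and G :: "'g::ab_group_add itself"
  assumes "continuous_map X Y id" "pathin X g" "g 0 = g 1"
  shows "ghomology_map G 1 Y id (loop_homology_class G X u g) = loop_homology_class G Y u g"
  unfolding loop_homology_class_eq by (rule ghomology_map_id_class[OF assms(1) loop_cycle[OF assms(2,3)]])

lemma comm_group_H1: "comm_group (H1 G)"
  by (rule comm_group_H)

lemma group_H1: "group (H1 G)"
  by (rule comm_group.axioms(2)[OF comm_group_H1])

section \<open>Homology classes generated by finite-length loops\<close>

definition finite_hloops :: "'g::ab_group_add itself \<Rightarrow> ('a::metric_space, 'g) gchain set set" where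
  "finite_hloops G = generate (H1 G)
     {loop_homology_class G euclidean u g |u g. path g \<and> pathfinish g = pathstart g \<and> path_length g < \<infinity>}"

abbreviation Fin_H1 :: "'g::ab_group_add itself \<Rightarrow> ('a::metric_space, 'g) gchain set monoid" where
  "Fin_H1 G \<equiv> (H1 G)\<lparr>carrier := finite_hloops G\<rparr>"

lemma hloop_closed:
  fixes G :: "'g::ab_group_add itself" and P :: "(real \<Rightarrow> 'a::metric_space) \<Rightarrow> bool"
  shows "{loop_homology_class G euclidean u g |u g. path g \<and> pathfinish g = pathstart g \<and> P g} \<subseteq> carrier (H1 G)"
proof clarify
  fix u and g :: "real \<Rightarrow> 'a" assume "path g" "pathfinish g = pathstart g"
  then show "loop_homology_class G euclidean u g \<in> carrier (H1 G)"
    unfolding loop_homology_class_eq cls_carrier using loop_cycle[of euclidean g u G]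
    by (auto simp: pathfinish_def pathstart_def)
qed

lemma subgroup_finite_hloops: "subgroup (finite_hloops G) (H1 G)"
  unfolding finite_hloops_def by (rule group.generate_is_subgroup[OF group_H1 hloop_closed])

lemma subgroup_L_H1: "subgroup (L_H1 G r) (H1 G)"
  unfolding L_H1_def by (rule group.generate_is_subgroup[OF group_H1 hloop_closed])

lemma L_H1_mono: "p \<le> q \<Longrightarrow> L_H1 G p \<subseteq> L_H1 G q"
  unfolding L_H1_def by (intro group.mono_generate[OF group_H1]) (force intro: less_le_trans)

lemma L_H1_finite_hloops: "L_H1 G r \<subseteq> finite_hloops G"
  unfolding L_H1_def finite_hloops_def
  by (intro group.mono_generate[OF group_H1]) (force intro: less_trans)

text \<open>A generated element involves finitely many loops, and the subgroups increase with the
  bound, so one integer bounds all the lengths involved.\<close>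

lemma Lfin_H1_carrier: "(\<Union>n::nat. L_H1 G (real n)) = finite_hloops G"
proof
  show "(\<Union>n::nat. L_H1 G (real n)) \<subseteq> finite_hloops G" using L_H1_finite_hloops by blast
  have "\<exists>n::nat. x \<in> L_H1 G (real n)" if "x \<in> finite_hloops G" for x
    using that unfolding finite_hloops_def
  proof (induct rule: generate.induct)
    case one
    show ?case using subgroup.one_closed[OF subgroup_L_H1] by blast
  next
    case (incl h)
    then obtain u g where g: "h = loop_homology_class G euclidean u g" "path g" "pathfinish g = pathstart g" "path_length g < \<infinity>"
      by blast
    obtain l where l: "path_length g = ereal l"
      using g(4) arc_length_nonneg[of g 0 1] by (cases "path_length g") (auto simp: path_length_arc)
    obtain n :: nat where n: "l < real n" using reals_Archimedean2 by blast
    then show ?case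
      unfolding L_H1_def using g l by (intro exI[of _ n] generate.incl) (auto intro!: exI[of _ u] exI[of _ g])
  next
    case (inv h)
    then obtain u g where g: "h = loop_homology_class G euclidean u g" "path g" "pathfinish g = pathstart g" "path_length g < \<infinity>"
      by blast
    obtain l where l: "path_length g = ereal l"
      using g(4) arc_length_nonneg[of g 0 1] by (cases "path_length g") (auto simp: path_length_arc)
    obtain n :: nat where n: "l < real n" using reals_Archimedean2 by blast
    then show ?case
      unfolding L_H1_def using g l by (intro exI[of _ n] generate.inv) (auto intro!: exI[of _ u] exI[of _ g])
  next
    case (eng h1 h2)
    then obtain m n :: nat where "h1 \<in> L_H1 G (real m)" "h2 \<in> L_H1 G (real n)" by blast
    then have "h1 \<in> L_H1 G (real (max m n))" "h2 \<in> L_H1 G (real (max m n))"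
      using L_H1_mono[of "real m" "real (max m n)" G] L_H1_mono[of "real n" "real (max m n)" G] by auto
    then show ?case using subgroup.m_closed[OF subgroup_L_H1] by blast
  qed
  then show "finite_hloops G \<subseteq> (\<Union>n::nat. L_H1 G (real n))" by blast
qed

lemma Lfin_H1_eq: "Lfin_H1 G = Fin_H1 G"
  by (simp add: Lfin_H1_def Lfin_H1_carrier)

lemma comm_group_Lfin_H1: "comm_group (Fin_H1 G)"
  by (rule group.group_comm_groupI[OF group.subgroup_imp_group[OF group_H1 subgroup_finite_hloops]])
     (use subgroup.subset[OF subgroup_finite_hloops] in
       \<open>auto intro!: comm_monoid.m_comm[OF comm_group.axioms(1)[OF comm_group_H1]]\<close>)

lemma L_H1_normal: "L_H1 G r \<lhd> Fin_H1 G"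
  using group.subgroup_incl[OF group_H1 subgroup_L_H1 subgroup_finite_hloops L_H1_finite_hloops]
  by (rule comm_group.subgroup_imp_normal[OF comm_group_Lfin_H1])

abbreviation hclass :: "'g::ab_group_add itself \<Rightarrow> 'a::metric_space \<Rightarrow> 'g \<Rightarrow> (real \<Rightarrow> 'a) \<Rightarrow> ('a, 'g) gchain set" where
  "hclass G b \<equiv> hpath G euclidean (geod_from b)"

text \<open>The base point here is auxiliary, serving only to close up open paths. On closed paths
  the functor is the homology class, and in general it is the class of the based loop, which has
  finite length if the path has.\<close>

lemma length_functor_H1:
  fixes b :: "'a::metric_space" and G :: "'g::ab_group_add itself"
  assumes geo: "geodesic_space TYPE('a)" and r: "0 < r"
  shows "length_functor (H1 G) (hclass G b u) (finite_hloops G) (L_H1 G (3 * r)) r"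
proof -
  note base = base_paths_geod_from[OF geo, of b]
  interpret B: base_paths euclidean b "geod_from b" by (rule base)
  have F: "path_functor (H1 G) euclidean (hclass G b u)" by (rule path_functor_hpath[OF base])
  show ?thesis
  proof (intro length_functor.intro length_functor_axioms.intro F geo r subgroup_finite_hloops L_H1_normal)
    fix p :: "real \<Rightarrow> 'a" assume p: "path p" "path_length p < \<infinity>"
    have "path_length (p +++ reversepath (geod_from b (p 1))) < \<infinity>"
      using p geod_from[OF geo] by (intro path_length_join_finite path_length_reversepath_finite) auto
    then have len: "path_length (B.based p) < \<infinity>"
      unfolding B.based_def using geod_from[OF geo]
      by (intro path_length_join_finite[OF geod_from(4)[OF geo]]) auto
    have l: "path (B.based p)" "B.based p 0 = B.based p 1"
      using B.based_loop[of p] p by (auto simp: loop_in_def)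
    have "hclass G b u p = loop_homology_class G euclidean u (B.based p)"
      using hpath_based[OF base, of p G u] hpath_loop[OF base, of "B.based p" G u] p l by simp
    then show "hclass G b u p \<in> finite_hloops G"
      unfolding finite_hloops_def using l len
      by (auto intro!: generate.incl exI[of _ u] exI[of _ "B.based p"] simp: pathfinish_def pathstart_def)
  next
    fix p :: "real \<Rightarrow> 'a" assume p: "path p" "p 1 = p 0" "path_length p < ereal (3 * r)"
    then show "hclass G b u p \<in> L_H1 G (3 * r)"
      unfolding L_H1_def using hpath_loop[OF base, of p G u]
      by (auto intro!: generate.incl exI[of _ u] exI[of _ p] simp: pathfinish_def pathstart_def)
  qed
qed

section \<open>The comparison map on first homology\<close>

definition Lam_H1 :: "'g::ab_group_add itself \<Rightarrow> 'a::metric_space \<Rightarrow> real \<Rightarrow> 'g \<Rightarrow> (real \<Rightarrow> 'a \<Rightarrow> real) \<Rightarrow> ('a, 'g) gchain set set" where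
  "Lam_H1 G b r u = length_functor.Lam (H1 G) (hclass G b u) (finite_hloops G) (L_H1 G (3 * r)) r"

abbreviation Mod_H1 :: "'g::ab_group_add itself \<Rightarrow> real \<Rightarrow> ('a::metric_space, 'g) gchain set set monoid" where
  "Mod_H1 G r \<equiv> Fin_H1 G Mod L_H1 G (3 * r)"

lemma comm_group_Mod_H1: "comm_group (Mod_H1 G r)"
  using comm_group.abelian_FactGroup[OF comm_group_Lfin_H1] normal_imp_subgroup[OF L_H1_normal] by blast

lemma path_functor_Lam_H1:
  fixes b :: "'a::metric_space" and G :: "'g::ab_group_add itself"
  assumes geo: "geodesic_space TYPE('a)" and r: "0 < r"
  shows "path_functor (Mod_H1 G r) (realization (Rips r)) (Lam_H1 G b r u)"
proof -
  interpret L: length_functor "H1 G" "hclass G b u" "finite_hloops G" "L_H1 G (3 * r)" r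
    by (rule length_functor_H1[OF geo r])
  show ?thesis using L.path_functor_Lam unfolding Lam_H1_def L.M_def .
qed

text \<open>The cocycles for \<open>u\<close>, \<open>v\<close> and \<open>u + v\<close> are related
  by \<open>hpath_add\<close> on chosen geodesics; \<open>hol_mult\<close> transfers the relation to
  holonomies.\<close>

lemma Lam_H1_add:
  fixes b :: "'a::metric_space" and G :: "'g::ab_group_add itself"
  assumes geo: "geodesic_space TYPE('a)" and r: "0 < r" and p: "pathin (realization (Rips r)) p"
  shows "Lam_H1 G b r (u + v) p = Lam_H1 G b r u p \<otimes>\<^bsub>Mod_H1 G r\<^esub> Lam_H1 G b r v p"
proof -
  interpret U: length_functor "H1 G" "hclass G b u" "finite_hloops G" "L_H1 G (3 * r)" r
    by (rule length_functor_H1[OF geo r])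
  interpret V: length_functor "H1 G" "hclass G b v" "finite_hloops G" "L_H1 G (3 * r)" r
    by (rule length_functor_H1[OF geo r])
  interpret W: length_functor "H1 G" "hclass G b (u + v)" "finite_hloops G" "L_H1 G (3 * r)" r
    by (rule length_functor_H1[OF geo r])
  have \<phi>: "W.\<phi> x y = U.\<phi> x y \<otimes>\<^bsub>U.M\<^esub> V.\<phi> x y" for x y
  proof -
    have g: "path (geod x y)" "path_length (geod x y) < \<infinity>" using U.geod[of x y] by auto
    show ?thesis
      unfolding U.\<phi>_def V.\<phi>_def W.\<phi>_def U.coset_def V.coset_def W.coset_def
      using hpath_add[OF base_paths_geod_from[OF geo, of b], of "geod x y" G u v] g
        U.N_coset_mult[OF U.F_finite[OF g] V.F_finite[OF g]]
      by simp
  qed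
  have M: "comm_group U.M" unfolding U.M_def by (rule comm_group_Mod_H1)
  show ?thesis
    unfolding Lam_H1_def U.Lam_def V.Lam_def W.Lam_def U.M_def[symmetric]
    by (rule hol_mult[OF M U.cech_lambda V.cech_lambda \<phi> p])
qed

definition lam_H1 :: "'g::ab_group_add itself \<Rightarrow> 'a::metric_space \<Rightarrow> real \<Rightarrow> ('a \<Rightarrow> real, 'g) gchain set \<Rightarrow> ('a, 'g) gchain set set" where
  "lam_H1 G b r = restrict (homology_hom (Mod_H1 G r) (Lam_H1 G b r)) (carrier (Rips_H1 G r))"

lemma group_Rips_H1: "group (Rips_H1 G r)"
  unfolding Rips_H1_def by (rule comm_group.axioms(2)[OF comm_group_H])

lemma lam_H1_hom:
  fixes b :: "'a::metric_space" and G :: "'g::ab_group_add itself"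
  assumes geo: "geodesic_space TYPE('a)" and r: "0 < r"
  shows "lam_H1 G b r \<in> hom (Rips_H1 G r) (Mod_H1 G r)"
proof -
  have "homology_hom (Mod_H1 G r) (Lam_H1 G b r) \<in> hom (Rips_H1 G r) (Mod_H1 G r)"
    unfolding Rips_H1_def
    by (rule homology_hom[OF comm_group_Mod_H1 path_functor_Lam_H1[OF geo r] Lam_H1_add[OF geo r]])
  then show ?thesis
    unfolding lam_H1_def using monoid.m_closed[OF group.is_monoid[OF group_Rips_H1]]
    by (auto simp: hom_def)
qed

lemma edge_path_hloop:
  assumes "0 < r" "r_loop r xs"
  shows "pathin (realization (Rips r)) (edge_path xs)" "edge_path xs 0 = edge_path xs 1"
    "loop_homology_class G (realization (Rips r)) u (edge_path xs) \<in> carrier (Rips_H1 G r)"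
proof -
  show e: "pathin (realization (Rips r)) (edge_path xs)" "edge_path xs 0 = edge_path xs 1"
    using edge_path_loop[OF assms] by (auto simp: loop_in_def)
  show "loop_homology_class G (realization (Rips r)) u (edge_path xs) \<in> carrier (Rips_H1 G r)"
    unfolding Rips_H1_def loop_homology_class_eq cls_carrier using loop_cycle[OF e] by blast
qed

lemma coset_hclass_loop:
  fixes b :: "'a::metric_space" and G :: "'g::ab_group_add itself"
  assumes geo: "geodesic_space TYPE('a)" and r: "0 < r" and g: "path g" "g 0 = g 1"
  shows "length_functor.coset (H1 G) (hclass G b u) (L_H1 G (3 * r)) g
     = L_H1 G (3 * r) #>\<^bsub>Fin_H1 G\<^esub> loop_homology_class G euclidean u g"
proof -
  interpret L: length_functor "H1 G" "hclass G b u" "finite_hloops G" "L_H1 G (3 * r)" r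
    by (rule length_functor_H1[OF geo r])
  show ?thesis
    using hpath_loop[OF base_paths_geod_from[OF geo, of b], of g G u] g
    by (simp add: L.coset_def r_coset_def)
qed

lemma lam_H1_edge_path:
  fixes b :: "'a::metric_space" and G :: "'g::ab_group_add itself"
  assumes geo: "geodesic_space TYPE('a)" and r: "0 < r" and xs: "r_loop r xs" "filling xs g"
  shows "lam_H1 G b r (loop_homology_class G (realization (Rips r)) u (edge_path xs))
     = L_H1 G (3 * r) #>\<^bsub>Fin_H1 G\<^esub> loop_homology_class G euclidean u g"
proof -
  interpret L: length_functor "H1 G" "hclass G b u" "finite_hloops G" "L_H1 G (3 * r)" r
    by (rule length_functor_H1[OF geo r])
  note e = edge_path_hloop[OF r xs(1)]
  have "lam_H1 G b r (loop_homology_class G (realization (Rips r)) u (edge_path xs)) = Lam_H1 G b r u (edge_path xs)"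
    unfolding lam_H1_def using e(3)[of G u]
      homology_hom_loop[OF comm_group_Mod_H1 path_functor_Lam_H1[OF geo r, of G b]
        Lam_H1_add[OF geo r, of _ G b] e(1,2), of G u] by simp
  also have "\<dots> = L.coset g"
    unfolding Lam_H1_def using xs by (intro L.Lam_edge_path) (auto simp: r_loop_successively)
  finally show ?thesis
    using coset_hclass_loop[OF geo r, of g G b u] filling_loop[OF xs] by (simp add: loop_in_def)
qed

lemma Rips_H1_generate:
  fixes G :: "'g::ab_group_add itself"
  assumes geo: "geodesic_space TYPE('a::metric_space)" and r: "0 < r" and C: "C \<in> carrier (Rips_H1 G r)"
  shows "C \<in> generate (Rips_H1 G r)
    {loop_homology_class G (realization (Rips r :: 'a set set)) u (edge_path xs) |u xs. r_loop r xs}"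
proof -
  let ?Y = "realization (Rips r :: 'a set set)"
  \<comment> \<open>The statement has no base point; an arbitrary point of the space is taken to
    choose connecting paths.\<close>
  fix b :: 'a
  obtain c where c: "base_paths ?Y (indicator {b}) c" using Rips_base_paths[OF geo r] .
  have "C \<in> generate (Rips_H1 G r) {loop_homology_class G ?Y u g |u g. loop_in ?Y (indicator {b}) g}"
    using H_generate[OF c] C unfolding Rips_H1_def by blast
  moreover have "{loop_homology_class G ?Y u g |u g. loop_in ?Y (indicator {b}) g}
      \<subseteq> {loop_homology_class G ?Y u (edge_path xs) |u xs. r_loop r xs}"
  proof clarify
    fix u g assume g: "loop_in ?Y (indicator {b}) g"
    obtain xs where xs: "2 \<le> length xs" "successively (\<lambda>x y. {x, y} \<in> Rips r) xs" "hd xs = b" "last xs = b"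
      "path_homotopic ?Y g (edge_path xs)"
      using loop_homotopic_edge_path[OF c complex_Rips] g by (auto simp: loop_in_def)
    have "loop_homology_class G ?Y u g = loop_homology_class G ?Y u (edge_path xs)"
      unfolding loop_homology_class_eq by (rule cls_cong[OF homotopic_boundary[OF xs(5)]])
    then show "\<exists>u' xs. loop_homology_class G ?Y u g = loop_homology_class G ?Y u' (edge_path xs) \<and> r_loop r xs"
      using xs r by (intro exI[of _ u] exI[of _ xs]) (simp add: r_loop_successively Rips_edge)
  qed
  ultimately show ?thesis
    using group.mono_generate[OF group_Rips_H1] by blast
qed

lemma edge_classes_closed:
  assumes "0 < r"
  shows "{loop_homology_class G (realization (Rips r)) u (edge_path xs) |u xs. r_loop r xs} \<subseteq> carrier (Rips_H1 G r)"
  using edge_path_hloop(3)[OF assms] by blast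

lemma is_lambda_lam_H1:
  fixes b :: "'a::metric_space" and G :: "'g::ab_group_add itself"
  assumes "geodesic_space TYPE('a)" "0 < r"
  shows "is_lambda_H1 G r (lam_H1 G b r)"
  unfolding is_lambda_H1_def Lfin_H1_eq
  using lam_H1_edge_path[OF assms, of _ _ G b] lam_H1_hom[OF assms, of G b] by (auto simp: lam_H1_def)

text \<open>A homomorphism is determined by its values on generators, and these are prescribed.
  Consequently \<open>lam_H1\<close> does not depend on the auxiliary point
  \<open>b\<close>.\<close>

lemma lambda_H1_eq:
  fixes b :: "'a::metric_space" and G :: "'g::ab_group_add itself"
  assumes geo: "geodesic_space TYPE('a)" and r: "0 < r"
  shows "lambda_H1 G r = lam_H1 G b r"
  unfolding lambda_H1_def
proof (rule the_equality[where P = "is_lambda_H1 G r"], rule is_lambda_lam_H1[OF assms])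
  fix h :: "('a \<Rightarrow> real, 'g) gchain set \<Rightarrow> ('a, 'g) gchain set set"
  assume h: "is_lambda_H1 G r h"
  let ?A = "Rips_H1 G r :: ('a \<Rightarrow> real, 'g) gchain set monoid"
  have hom: "h \<in> hom ?A (Mod_H1 G r)" using h by (simp add: is_lambda_H1_def Lfin_H1_eq)
  have M: "group (Mod_H1 G r)" by (rule comm_group.axioms(2)[OF comm_group_Mod_H1])
  show "h = lam_H1 G b r"
  proof (rule extensionalityI)
    show "h \<in> extensional (carrier ?A)" using h by (simp add: is_lambda_H1_def)
    show "lam_H1 G b r \<in> extensional (carrier ?A)" by (simp add: lam_H1_def)
    fix C assume C: "C \<in> carrier ?A"
    \<comment> \<open>Equality of two homomorphisms is phrased as having a common witness, which on
      generators is the generator itself.\<close>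
    have "\<exists>f\<in>carrier ?A. h C = lam_H1 G b r f \<and> lam_H1 G b r C = lam_H1 G b r f"
    proof (rule witness_two[OF group_Rips_H1 group_Rips_H1 M M hom lam_H1_hom[OF geo r] lam_H1_hom[OF geo r]
          lam_H1_hom[OF geo r] edge_classes_closed[OF r] Rips_H1_generate[OF geo r C]])
      fix e assume "e \<in> {loop_homology_class G (realization (Rips r :: 'a set set)) u (edge_path xs) |u xs. r_loop r xs}"
      then obtain u xs where e: "e = loop_homology_class G (realization (Rips r)) u (edge_path xs)" "r_loop r xs"
        by blast
      obtain g where g: "filling xs g" using filling_exists[OF geo, of xs] e(2) by (auto simp: r_loop_def)
      have "h e = lam_H1 G b r e"
        using h lam_H1_edge_path[OF geo r e(2) g, of G b u] e g unfolding is_lambda_H1_def Lfin_H1_eq by metis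
      then show "\<exists>f\<in>carrier ?A. h e = lam_H1 G b r f \<and> lam_H1 G b r e = lam_H1 G b r f"
        using edge_path_hloop(3)[OF r e(2)] e(1) by blast
    qed
    then show "h C = lam_H1 G b r C" by metis
  qed
qed

lemma lam_H1_iso:
  fixes b :: "'a::metric_space" and G :: "'g::ab_group_add itself"
  assumes geo: "geodesic_space TYPE('a)" and r: "0 < r"
  shows "lam_H1 G b r \<in> iso (Rips_H1 G r) (Mod_H1 G r)"
proof -
  let ?A = "Rips_H1 G r :: ('a \<Rightarrow> real, 'g) gchain set monoid" and ?Y = "realization (Rips r :: 'a set set)"
  let ?H = "Fin_H1 G :: ('a, 'g) gchain set monoid" and ?N = "L_H1 G (3 * r) :: ('a, 'g) gchain set set"
  obtain c where c: "base_paths ?Y (indicator {b}) c" using Rips_base_paths[OF geo r] .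
  define F where "F u = hpath G ?Y c u" for u
  have F: "path_functor ?A ?Y (F u)" for u
    unfolding F_def Rips_H1_def by (rule path_functor_hpath[OF c])
  have RF: "rips_functor r ?A (F u)" for u
    using F r by (simp add: rips_functor_def rips_functor_axioms_def)
  define Mu where "Mu u = rips_functor.Mu r ?A (F u)" for u
  have Mu: "path_functor ?A (euclidean :: 'a topology) (Mu u)" for u
    unfolding Mu_def by (rule rips_functor.path_functor_Mu[OF RF])
  have A: "comm_group ?A" unfolding Rips_H1_def by (rule comm_group_H)
  have Mu_add: "Mu (u + v) p = Mu u p \<otimes>\<^bsub>?A\<^esub> Mu v p" if p: "pathin euclidean p" for u v p
  proof -
    interpret U: rips_functor r ?A "F u" by (rule RF)
    interpret V: rips_functor r ?A "F v" by (rule RF)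
    interpret W: rips_functor r ?A "F (u + v)" by (rule RF)
    have \<psi>: "W.\<psi> x y = U.\<psi> x y \<otimes>\<^bsub>?A\<^esub> V.\<psi> x y" if "z \<in> ball x (r / 2)" "z \<in> ball y (r / 2)" for x y z :: 'a
    proof -
      have "dist x y < r" using dist_triangle_half_r[of z x r y] that by (simp add: dist_commute)
      then have "pathin ?Y (realization_edge x y)"
        using complex.pathin_realization_edge[OF complex_Rips] Rips_edge[OF r] by blast
      then show ?thesis
        unfolding U.\<psi>_def V.\<psi>_def W.\<psi>_def unfolding F_def Rips_H1_def by (rule hpath_add[OF c])
    qed
    show ?thesis
      unfolding Mu_def U.Mu_def V.Mu_def W.Mu_def
      by (rule hol_mult[OF A U.cech_mu V.cech_mu \<psi> p])
  qed
  let ?mu = "homology_hom ?A Mu"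
  have mu: "?mu \<in> hom (H1 G) ?A" by (rule homology_hom[OF A Mu Mu_add])
  have mu_loop: "?mu (loop_homology_class G euclidean u g) = Mu u g" if "path g" "g 0 = g 1" for u g
    using homology_hom_loop[OF A Mu Mu_add, of g G u] that by simp
  interpret h: group_hom "H1 G" ?A ?mu
    by (intro group_hom.intro group_hom_axioms.intro group_H1 group_Rips_H1 mu)
  have fin: "finite_hloops G \<subseteq> carrier (H1 G :: ('a, 'g) gchain set monoid)"
    by (rule subgroup.subset[OF subgroup_finite_hloops])
  have muH: "?mu \<in> hom ?H ?A"
    by (rule homI) (use h.hom_closed h.hom_mult fin in \<open>simp_all add: subset_iff\<close>)
  have gH: "group ?H" by (rule group.subgroup_imp_group[OF group_H1 subgroup_finite_hloops])
  have gM: "group (Mod_H1 G r :: ('a, 'g) gchain set set monoid)"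
    by (rule comm_group.axioms(2)[OF comm_group_Mod_H1])
  have proj: "(\<lambda>a. ?N #>\<^bsub>?H\<^esub> a) \<in> hom ?H (Mod_H1 G r)"
    by (rule normal.r_coset_hom_Mod[OF L_H1_normal])
  have fill: "loop_homology_class G euclidean u g \<in> finite_hloops G"
    if "path g" "g 0 = g 1" "path_length g < \<infinity>" for u and g :: "real \<Rightarrow> 'a"
    unfolding finite_hloops_def using that
    by (intro generate.incl) (auto simp: pathfinish_def pathstart_def intro!: exI[of _ u] exI[of _ g])
  show ?thesis
  proof (rule iso_criterion[OF group_Rips_H1 group_H1 subgroup_finite_hloops L_H1_normal lam_H1_hom[OF geo r] mu])
    fix n assume "n \<in> ?N"
    moreover have "?N \<subseteq> kernel (H1 G) ?A ?mu"
      unfolding L_H1_def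
    proof (rule group.generate_subgroup_incl[OF group_H1 _ h.subgroup_kernel], clarify)
      fix u and g :: "real \<Rightarrow> 'a" assume g: "path g" "pathfinish g = pathstart g" "path_length g < ereal (3 * r)"
      then have g': "g 0 = g 1" by (simp add: pathfinish_def pathstart_def)
      interpret U: rips_functor r ?A "F u" by (rule RF)
      have "Mu u g = \<one>\<^bsub>?A\<^esub>" unfolding Mu_def using g g' by (intro U.Mu_small_loop) auto
      moreover have "loop_homology_class G euclidean u g \<in> carrier (H1 G)"
        using hloop_closed[of G "\<lambda>_. True"] g by blast
      ultimately show "loop_homology_class G euclidean u g \<in> kernel (H1 G) ?A ?mu"
        using mu_loop[OF g(1) g'] by (simp add: kernel_def)
    qed
    ultimately show "?mu n = \<one>\<^bsub>?A\<^esub>" by (auto simp: kernel_def)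
  next
    fix C assume C: "C \<in> carrier ?A"
    \<comment> \<open>The same \<open>f\<close> must represent the image of \<open>C\<close> and be
      sent back to \<open>C\<close>. Pairing \<open>lam_H1\<close> with the identity lets both
      requirements pass from fillings of \<open>r\<close>-loops to all of homology.\<close>
    have "\<exists>f\<in>carrier ?H. lam_H1 G b r C = ?N #>\<^bsub>?H\<^esub> f \<and> id C = ?mu f"
    proof (rule witness_two[OF group_Rips_H1 gH gM group_Rips_H1 lam_H1_hom[OF geo r] _ proj muH
          edge_classes_closed[OF r] Rips_H1_generate[OF geo r C]])
      show "id \<in> hom ?A ?A" by (simp add: hom_def)
      fix e assume "e \<in> {loop_homology_class G ?Y u (edge_path xs) |u xs. r_loop r xs}"
      then obtain u xs where e: "e = loop_homology_class G ?Y u (edge_path xs)" "r_loop r xs"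
        by blast
      obtain g where g: "filling xs g" using filling_exists[OF geo, of xs] e(2) by (auto simp: r_loop_def)
      have gl: "path g" "g 0 = g 1" "path_length g < \<infinity>"
        using filling_loop[OF e(2) g] by (auto simp: loop_in_def)
      interpret U: rips_functor r ?A "F u" by (rule RF)
      have "?mu (loop_homology_class G euclidean u g) = Mu u g" by (rule mu_loop[OF gl(1,2)])
      also have "\<dots> = F u (edge_path xs)"
        unfolding Mu_def using e(2) g by (intro U.Mu_filling) (auto simp: r_loop_successively)
      also have "\<dots> = e"
        unfolding F_def e(1) using edge_path_hloop(1,2)[OF r e(2)] by (rule hpath_loop[OF c])
      finally show "\<exists>f\<in>carrier ?H. lam_H1 G b r e = ?N #>\<^bsub>?H\<^esub> f \<and> id e = ?mu f"
        using lam_H1_edge_path[OF geo r e(2) g, of G b u] fill[OF gl, of u] e(1)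
        by (intro bexI[of _ "loop_homology_class G euclidean u g"]) auto
    qed
    then show "\<exists>f\<in>finite_hloops G. lam_H1 G b r C = ?N #>\<^bsub>?H\<^esub> f \<and> ?mu f = C" by auto
  next
    fix s assume s: "s \<in> (finite_hloops G :: ('a, 'g) gchain set set)"
    let ?E = "{loop_homology_class G euclidean u g |u (g :: real \<Rightarrow> 'a). path g \<and> pathfinish g = pathstart g \<and> path_length g < \<infinity>}"
    have E: "?E \<subseteq> finite_hloops G" unfolding finite_hloops_def by (blast intro: generate.incl)
    have "s \<in> generate ?H ?E"
      using s group.generate_consistent[OF group_H1 E subgroup_finite_hloops]
      by (simp add: finite_hloops_def)
    \<comment> \<open>Surjectivity needs one condition only, so the same pair of homomorphisms is
      entered twice.\<close>
    then have "\<exists>a\<in>carrier ?A. ?N #>\<^bsub>?H\<^esub> s = lam_H1 G b r a \<and> ?N #>\<^bsub>?H\<^esub> s = lam_H1 G b r a"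
    proof (rule witness_two[OF gH group_Rips_H1 gM gM proj proj lam_H1_hom[OF geo r] lam_H1_hom[OF geo r], rotated])
      show "?E \<subseteq> carrier ?H" using E by simp
      fix e assume "e \<in> ?E"
      then obtain u g where e: "e = loop_homology_class G euclidean u g"
        and g: "path g" "pathfinish g = pathstart g" "path_length g < \<infinity>" by blast
      then have g': "g 0 = g 1" by (simp add: pathfinish_def pathstart_def)
      interpret L: length_functor "H1 G" "hclass G b u" "finite_hloops G" "L_H1 G (3 * r)" r
        by (rule length_functor_H1[OF geo r])
      obtain xs k where xs: "2 \<le> length xs" "hd xs = g 0" "last xs = g 1"
        "successively (\<lambda>x y. dist x y < r) xs" "filling xs k" "L.coset g = L.coset k"
        using L.coset_eq_filling[OF g(1,3)] .
      have rl: "r_loop r xs" using xs g' by (simp add: r_loop_successively)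
      have k: "path k" "k 0 = k 1" using filling_loop[OF rl xs(5)] by (auto simp: loop_in_def)
      have "?N #>\<^bsub>?H\<^esub> e = L.coset g" unfolding e by (rule coset_hclass_loop[OF geo r g(1) g', symmetric])
      also have "\<dots> = ?N #>\<^bsub>?H\<^esub> loop_homology_class G euclidean u k"
        unfolding xs(6) by (rule coset_hclass_loop[OF geo r k])
      also have "\<dots> = lam_H1 G b r (loop_homology_class G ?Y u (edge_path xs))"
        by (rule lam_H1_edge_path[OF geo r rl xs(5), symmetric])
      finally show "\<exists>a\<in>carrier ?A. ?N #>\<^bsub>?H\<^esub> e = lam_H1 G b r a \<and> ?N #>\<^bsub>?H\<^esub> e = lam_H1 G b r a"
        using edge_path_hloop(3)[OF r rl] by blast
    qed
    then show "\<exists>a\<in>carrier ?A. lam_H1 G b r a = ?N #>\<^bsub>?H\<^esub> s" by metis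
  qed
qed

section \<open>Compatibility with the bonding maps in homology\<close>

lemma persistence_iso_H1:
  fixes G :: "'g::ab_group_add itself"
  assumes geo: "geodesic_space TYPE('a::metric_space)"
  shows "persistence_iso (Rips_H1_persistence G)
    (quotient_persistence (Lfin_H1 G) (\<lambda>r. L_H1 G (3 * r)))
    (lambda_H1 G :: real \<Rightarrow> ('a \<Rightarrow> real, 'g) gchain set \<Rightarrow> ('a, 'g) gchain set set)"
  unfolding persistence_iso_def Rips_H1_persistence_def quotient_persistence_def fst_conv snd_conv
proof (intro conjI allI impI ballI)
  fix b :: 'a
  let ?H = "Fin_H1 G :: ('a, 'g) gchain set monoid"
  show "lambda_H1 G r \<in> iso (Rips_H1 G r) (Lfin_H1 G Mod (L_H1 G (3 * r) :: ('a, 'g) gchain set set))"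
    if "0 < r" for r
    using lam_H1_iso[OF geo that, of G b] lambda_H1_eq[OF geo that, of G b] by (simp add: Lfin_H1_eq)
  fix p q :: real and C assume pq: "0 < p \<and> p < q" and C: "C \<in> carrier (Rips_H1 G p :: ('a \<Rightarrow> real, 'g) gchain set monoid)"
  then have p: "0 < p" and q: "0 < q" by auto
  let ?N = "\<lambda>r. L_H1 G (3 * r) :: ('a, 'g) gchain set set"
  let ?i = "ghomology_map G 1 (realization (Rips q :: 'a set set)) id"
  have id: "continuous_map (realization (Rips p)) (realization (Rips q)) (id :: ('a \<Rightarrow> real) \<Rightarrow> _)"
    using continuous_map_realization_mono[OF Rips_mono[of p q]] pq by (simp add: id_def)
  have i: "?i \<in> hom (Rips_H1 G p) (Rips_H1 G q)"
    unfolding Rips_H1_def by (rule ghomology_map_id_hom[OF id])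
  have gH: "group ?H" by (rule group.subgroup_imp_group[OF group_H1 subgroup_finite_hloops])
  have gM: "group (Mod_H1 G r :: ('a, 'g) gchain set set monoid)" for r
    by (rule comm_group.axioms(2)[OF comm_group_Mod_H1])
  have proj: "(\<lambda>a. ?N r #>\<^bsub>?H\<^esub> a) \<in> hom ?H (Mod_H1 G r)" for r
    by (rule normal.r_coset_hom_Mod[OF L_H1_normal])
  have hq: "(\<lambda>C. lam_H1 G b q (?i C)) \<in> hom (Rips_H1 G p) (Mod_H1 G q)"
    using hom_compose[OF i lam_H1_hom[OF geo q, of G b]] by (simp add: o_def)
  \<comment> \<open>One finite-length class \<open>f\<close> represents the images at both scales;
    for an \<open>r\<close>-loop it is the class of a common filling.\<close>
  have "\<exists>f\<in>carrier ?H. lam_H1 G b p C = ?N p #>\<^bsub>?H\<^esub> f \<and> lam_H1 G b q (?i C) = ?N q #>\<^bsub>?H\<^esub> f"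
  proof (rule witness_two[OF group_Rips_H1 gH gM gM lam_H1_hom[OF geo p] hq proj proj
        edge_classes_closed[OF p] Rips_H1_generate[OF geo p C]])
    fix e assume "e \<in> {loop_homology_class G (realization (Rips p :: 'a set set)) u (edge_path xs) |u xs. r_loop p xs}"
    then obtain u xs where e: "e = loop_homology_class G (realization (Rips p)) u (edge_path xs)" "r_loop p xs"
      by blast
    have rq: "r_loop q xs"
      using e(2) pq successively_mono_dist[of p xs q] by (auto simp: r_loop_successively)
    obtain g where g: "filling xs g" using filling_exists[OF geo, of xs] e(2) by (auto simp: r_loop_def)
    have gl: "path g" "g 0 = g 1" "path_length g < \<infinity>"
      using filling_loop[OF e(2) g] by (auto simp: loop_in_def)
    have "?i e = loop_homology_class G (realization (Rips q)) u (edge_path xs)"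
      unfolding e(1) by (rule ghomology_map_loop[OF id edge_path_hloop(1,2)[OF p e(2)]])
    moreover have "loop_homology_class G euclidean u g \<in> finite_hloops G"
      unfolding finite_hloops_def using gl
      by (intro generate.incl) (auto simp: pathfinish_def pathstart_def intro!: exI[of _ u] exI[of _ g])
    ultimately show "\<exists>f\<in>carrier ?H. lam_H1 G b p e = ?N p #>\<^bsub>?H\<^esub> f \<and> lam_H1 G b q (?i e) = ?N q #>\<^bsub>?H\<^esub> f"
      using lam_H1_edge_path[OF geo p e(2) g, of G b u] lam_H1_edge_path[OF geo q rq g, of G b u] e(1)
      by (intro bexI[of _ "loop_homology_class G euclidean u g"]) auto
  qed
  then obtain f where f: "f \<in> carrier ?H" "lam_H1 G b p C = ?N p #>\<^bsub>?H\<^esub> f" "lam_H1 G b q (?i C) = ?N q #>\<^bsub>?H\<^esub> f"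
    by blast
  have "?N q <#>\<^bsub>?H\<^esub> (?N p #>\<^bsub>?H\<^esub> f) = ?N q #>\<^bsub>?H\<^esub> f"
    by (rule set_mult_coset[OF gH normal_imp_subgroup[OF L_H1_normal] normal_imp_subgroup[OF L_H1_normal] _ f(1)])
       (use pq in \<open>auto intro!: L_H1_mono\<close>)
  then show "lambda_H1 G q (?i C) = ?N q <#>\<^bsub>Lfin_H1 G\<^esub> lambda_H1 G p C"
    unfolding lambda_H1_eq[OF geo p, of G b] lambda_H1_eq[OF geo q, of G b] Lfin_H1_eq f(2,3) ..
qed

end

section \<open>Semi-local simple connectivity\<close>

text \<open>Small loops being killed by \<open>F\<close>, short pieces of a path may be replaced by geodesics.\<close>

lemma path_functor_locally_trivial:
  fixes F :: "(real \<Rightarrow> 'a::metric_space) \<Rightarrow> 'q"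
  assumes geo: "geodesic_space TYPE('a)" and "path_functor Q euclidean F" and S: "subgroup S Q"
    and fin: "\<And>p. path p \<Longrightarrow> path_length p < \<infinity> \<Longrightarrow> F p \<in> S"
    and triv: "\<And>x. \<exists>e>0. \<forall>l. path l \<and> l 0 = x \<and> l 1 = x \<and> l ` {0..1} \<subseteq> ball x e \<longrightarrow> F l = \<one>\<^bsub>Q\<^esub>"
    and g: "path g"
  shows "F g \<in> S"
proof -
  interpret path_functor Q euclidean F by fact
  obtain e where e: "\<And>x. 0 < e x"
    "\<And>x l. path l \<Longrightarrow> l 0 = x \<Longrightarrow> l 1 = x \<Longrightarrow> l ` {0..1} \<subseteq> ball x (e x) \<Longrightarrow> F l = \<one>\<^bsub>Q\<^esub>"
    using triv by metis
  \<comment> \<open>A third of the radius leaves room for the geodesic between the end points of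
    \<open>p\<close>: its points are within \<open>e x / 3\<close> plus twice that of
    \<open>x\<close>.\<close>
  have small: "F p \<in> S" if p: "path p" and px: "p ` {0..1} \<subseteq> ball x (e x / 3)" for p x
  proof -
    have d: "dist x (p t) < e x / 3" if "0 \<le> t" "t \<le> 1" for t
      using px that by (auto simp: image_subset_iff)
    have gd: "path (geod u v)" "geod u v 0 = u" "geod u v 1 = v" "path_length (geod u v) < \<infinity>"
      "\<And>t. 0 \<le> t \<Longrightarrow> t \<le> 1 \<Longrightarrow> dist u (geod u v t) \<le> dist u v"
      "\<And>t. 0 \<le> t \<Longrightarrow> t \<le> 1 \<Longrightarrow> dist v (geod u v t) \<le> dist u v" for u v :: 'a
    proof -
      note h = geodesicD[OF geodesic_geod[OF geo, of u v]]
      show "path (geod u v)" "geod u v 0 = u" "geod u v 1 = v" using h by auto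
      show "path_length (geod u v) < \<infinity>" using h(4) by simp
      show "dist u (geod u v t) \<le> dist u v" "dist v (geod u v t) \<le> dist u v" if "0 \<le> t" "t \<le> 1" for t
        using h(5)[of 0 t] h(5)[of 1 t] h(2,3) that by auto
    qed
    let ?a = "geod x (p 0)" and ?z = "geod (p 1) x" and ?\<gamma> = "geod (p 0) (p 1)"
    \<comment> \<open>Joined to \<open>x\<close> by geodesics at both ends, any path
      \<open>q\<close> in the ball with the ends of \<open>p\<close> forms a loop that
      \<open>F\<close> kills. All such paths therefore have the same value, which is applied to
      \<open>p\<close> and to the geodesic.\<close>
    have one: "F ?a \<otimes>\<^bsub>Q\<^esub> (F q \<otimes>\<^bsub>Q\<^esub> F ?z) = \<one>\<^bsub>Q\<^esub>"
      if q: "path q" "q 0 = p 0" "q 1 = p 1" "\<And>t. 0 \<le> t \<Longrightarrow> t \<le> 1 \<Longrightarrow> dist x (q t) < e x" for q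
    proof -
      have "F (?a +++ (q +++ ?z)) = \<one>\<^bsub>Q\<^esub>"
      proof (rule e(2)[of _ x])
        show "path (?a +++ (q +++ ?z))"
          using q gd by (simp add: pathfinish_def pathstart_def)
        have "dist x (?a t) < e x" "dist x (?z t) < e x" if "0 \<le> t" "t \<le> 1" for t
          using gd(5)[OF that, of x "p 0"] gd(6)[OF that, of x "p 1"] d[of 0] d[of 1] e(1)[of x]
          by (simp_all add: dist_commute)
        then show "(?a +++ (q +++ ?z)) ` {0..1} \<subseteq> ball x (e x)"
          using q(4) by (auto simp: joinpaths_def)
      qed (simp_all add: gd)
      then show ?thesis
        using q gd by (simp add: F_join pathfinish_def pathstart_def)
    qed
    have "F ?a \<otimes>\<^bsub>Q\<^esub> (F p \<otimes>\<^bsub>Q\<^esub> F ?z) = F ?a \<otimes>\<^bsub>Q\<^esub> (F ?\<gamma> \<otimes>\<^bsub>Q\<^esub> F ?z)"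
    proof -
      have "dist x (p t) < e x" if "0 \<le> t" "t \<le> 1" for t
        using d[OF that] e(1)[of x] by simp
      moreover have "dist x (?\<gamma> t) < e x" if t: "0 \<le> t" "t \<le> 1" for t
      proof -
        have "dist (p 0) (p 1) \<le> dist x (p 0) + dist x (p 1)"
          using dist_triangle[of "p 0" "p 1" x] by (simp add: dist_commute)
        then show ?thesis
          using dist_triangle[of x "?\<gamma> t" "p 0"] gd(5)[OF t, of "p 0" "p 1"] d[of 0] d[of 1] by simp
      qed
      ultimately show ?thesis using one[of p] one[of ?\<gamma>] p gd by simp
    qed
    then have "F p = F ?\<gamma>" using p gd by simp
    then show ?thesis using fin gd by simp
  qed
  have "UNIV = (\<Union>v. ball v (e v / 3))"
  proof (rule UNIV_eq_I)
    fix x show "x \<in> (\<Union>v. ball v (e v / 3))" using e(1)[of x] by (intro UN_I[of x]) auto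
  qed
  then obtain n v where n: "0 < n"
    and v: "\<And>j. j < n \<Longrightarrow> g ` {real j / n..real (Suc j) / n} \<subseteq> ball (v j) (e (v j) / 3)"
    using uniform_subdivision[of euclidean g "\<lambda>x. ball x (e x / 3)"] g by auto
  have "F (restrict_path (real j / n) (real (Suc j) / n) g) \<in> S" if j: "j < n" for j
  proof (rule small)
    show "path (restrict_path (real j / n) (real (Suc j) / n) g)"
      using pathin_subpath[of euclidean g "real j / n" "real (Suc j) / n"] g j by simp
    have "restrict_path (real j / n) (real (Suc j) / n) g ` {0..1} \<subseteq> g ` {real j / n..real (Suc j) / n}"
      by (intro restrict_path_image divide_right_mono) auto
    then show "restrict_path (real j / n) (real (Suc j) / n) g ` {0..1} \<subseteq> ball (v j) (e (v j) / 3)"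
      using v[OF j] by blast
  qed
  then have "set (map (\<lambda>j. F (restrict_path (real j / n) (real (Suc j) / n) g)) [0..<n]) \<subseteq> S" by auto
  moreover have "list_mult Q xs \<in> S" if "set xs \<subseteq> S" for xs
    using that by (induct xs) (auto simp: subgroup.one_closed[OF S] subgroup.m_closed[OF S])
  ultimately show ?thesis using F_uniform[of g n] g n by simp
qed

text \<open>A loop in a small ball is null-homotopic in the space, hence trivial under
  \<open>Lambda_class\<close>. Every path then has the value of a finite-length one, and for loops
  at \<open>b\<close> this value is the class itself.\<close>

lemma Lfin_pi1_semi_local:
  fixes b :: "'a::metric_space"
  assumes geo: "geodesic_space TYPE('a)" and sl: "semi_locally_simply_connected TYPE('a)"
  shows "Lfin_pi1 b = pi1 b"
proof -
  \<comment> \<open>The scale 1 is arbitrary; the locale supplies the path functor and the fact that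
    finite-length paths have values in \<open>finite_loops b\<close>.\<close>
  interpret L: length_functor "pi1 b" "Lambda_class b" "finite_loops b" "L_pi1 b (3 * 1)" 1
    by (rule length_functor_pi1[OF geo]) simp
  have triv: "\<exists>e>0. \<forall>l. path l \<and> l 0 = x \<and> l 1 = x \<and> l ` {0..1} \<subseteq> ball x e \<longrightarrow> Lambda_class b l = \<one>\<^bsub>pi1 b\<^esub>" for x
  proof -
    obtain U where U: "x \<in> interior U"
      "fundamental_group_map euclidean x id ` carrier (fundamental_group (top_of_set U) x) = {\<one>\<^bsub>pi1 x\<^esub>}"
      using sl unfolding semi_locally_simply_connected_def by blast
    obtain e where e: "0 < e" "ball x e \<subseteq> U"
      using U(1) by (meson mem_interior)
    have "Lambda_class b l = \<one>\<^bsub>pi1 b\<^esub>" if l: "path l" "l 0 = x" "l 1 = x" "l ` {0..1} \<subseteq> ball x e" for l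
    proof -
      have lU: "loop_in (top_of_set U) x l"
        using l e by (auto simp: loop_in_def pathin_def continuous_map_in_subtopology path_def continuous_map_iff_continuous)
      have "fundamental_group_map euclidean x id (loop_class (top_of_set U) x l) = loop_class euclidean (id x) (id \<circ> l)"
        by (rule fundamental_group_map_class[OF _ lU]) (simp add: continuous_map_from_subtopology)
      moreover have "fundamental_group_map euclidean x id (loop_class (top_of_set U) x l) = \<one>\<^bsub>pi1 x\<^esub>"
        using U(2) pi1_class_closed[OF lU] by blast
      ultimately have "loop_class euclidean x l = loop_class euclidean x (\<lambda>_. x)" by (simp add: pi1_one)
      then have "path_homotopic euclidean l (\<lambda>_. x)"
        using l by (subst (asm) loop_class_eq_iff) (auto simp: loop_in_def)
      then show ?thesis using L.F_homotopic[of l] by simp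
    qed
    then show ?thesis using e(1) by blast
  qed
  have "C \<in> finite_loops b" if C: "C \<in> carrier (pi1 b)" for C
  proof -
    obtain g where g: "loop_in euclidean b g" "C = loop_class euclidean b g"
      using C unfolding pi1_carrier by blast
    have "Lambda_class b g \<in> finite_loops b"
      by (rule path_functor_locally_trivial[OF geo L.path_functor_axioms subgroup_finite_loops L.F_finite triv])
         (use g in \<open>auto simp: loop_in_def\<close>)
    then show ?thesis using Lambda_class_loop[OF geo g(1)] g(2) by simp
  qed
  then have "finite_loops b = carrier (pi1 b)"
    using subgroup.subset[OF subgroup_finite_loops] by blast
  then show ?thesis by (simp add: Lfin_pi1_eq[OF geo])
qed

text \<open>By \<open>H_generate\<close> it suffices to treat loops at one point with a single
  coefficient, and these fall under the local triviality argument for the functor with that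
  coefficient.\<close>

lemma Lfin_H1_semi_local:
  fixes G :: "'g::ab_group_add itself"
  assumes geo: "geodesic_space TYPE('a::metric_space)" and sl: "G_semi_locally_simply_connected G TYPE('a)"
  shows "Lfin_H1 G = (H1 G :: ('a, 'g) gchain set monoid)"
proof -
  fix b :: 'a
  note base = base_paths_geod_from[OF geo, of b]
  have triv: "\<exists>e>0. \<forall>l. path l \<and> l 0 = x \<and> l 1 = x \<and> l ` {0..1} \<subseteq> ball x e \<longrightarrow> hclass G b u l = \<one>\<^bsub>H1 G\<^esub>" for x u
  proof -
    obtain U where U: "x \<in> interior U"
      "ghomology_map G 1 euclidean id ` carrier (ghomology_group G 1 (top_of_set U)) = {\<one>\<^bsub>H1 G\<^esub>}"
      using sl unfolding G_semi_locally_simply_connected_def by blast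
    obtain e where e: "0 < e" "ball x e \<subseteq> U"
      using U(1) by (meson mem_interior)
    have "hclass G b u l = \<one>\<^bsub>H1 G\<^esub>" if l: "path l" "l 0 = x" "l 1 = x" "l ` {0..1} \<subseteq> ball x e" for l
    proof -
      have lU: "pathin (top_of_set U) l" "l 0 = l 1"
        using l e by (auto simp: pathin_def continuous_map_in_subtopology path_def continuous_map_iff_continuous)
      have "loop_homology_class G (top_of_set U) u l \<in> carrier (ghomology_group G 1 (top_of_set U))"
        unfolding loop_homology_class_eq cls_carrier using loop_cycle[OF lU] by blast
      then have "ghomology_map G 1 euclidean id (loop_homology_class G (top_of_set U) u l) = \<one>\<^bsub>H1 G\<^esub>"
        using U(2) by blast
      moreover have "ghomology_map G 1 euclidean id (loop_homology_class G (top_of_set U) u l) = loop_homology_class G euclidean u l"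
        by (rule ghomology_map_loop[OF _ lU]) (simp add: continuous_map_from_subtopology)
      moreover have "hclass G b u l = loop_homology_class G euclidean u l"
        by (rule hpath_loop[OF base]) (use l in auto)
      ultimately show ?thesis by simp
    qed
    then show ?thesis using e(1) by blast
  qed
  have "{loop_homology_class G euclidean u g |u g. loop_in euclidean b g} \<subseteq> (finite_hloops G :: ('a, 'g) gchain set set)"
  proof clarify
    fix u and g :: "real \<Rightarrow> 'a" assume g: "loop_in euclidean b g"
    interpret L: length_functor "H1 G" "hclass G b u" "finite_hloops G" "L_H1 G (3 * 1)" 1
      by (rule length_functor_H1[OF geo]) simp
    have "hclass G b u g \<in> finite_hloops G"
      by (rule path_functor_locally_trivial[OF geo L.path_functor_axioms subgroup_finite_hloops L.F_finite triv])
         (use g in \<open>auto simp: loop_in_def\<close>)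
    then show "loop_homology_class G euclidean u g \<in> finite_hloops G"
      using hpath_loop[OF base, of g G u] g by (simp add: loop_in_def)
  qed
  then have "generate (H1 G) {loop_homology_class G euclidean u g |u g. loop_in euclidean b g} \<subseteq> finite_hloops G"
    by (rule group.generate_subgroup_incl[OF group_H1 _ subgroup_finite_hloops])
  then have "carrier (H1 G) \<subseteq> (finite_hloops G :: ('a, 'g) gchain set set)"
    using H_generate[OF base, of _ G] by blast
  then have "finite_hloops G = carrier (H1 G :: ('a, 'g) gchain set monoid)"
    using subgroup.subset[OF subgroup_finite_hloops] by blast
  then show ?thesis by (simp add: Lfin_H1_eq)
qed

theorem theorem5p7:
  fixes b :: "'a::metric_space" and G :: "'g::ab_group_add itself"
  assumes "geodesic_space TYPE('a)"
  shows "((\<forall>r>0. is_lambda_pi1 b r (lambda_pi1 b r)) \<and>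
          persistence_iso (Rips_pi1_persistence b)
            (quotient_persistence (Lfin_pi1 b) (\<lambda>r. L_pi1 b (3 * r))) (lambda_pi1 b)) \<and>
         ((\<forall>r>0. is_lambda_H1 G r
             (lambda_H1 G r :: ('a \<Rightarrow> real, 'g) gchain set \<Rightarrow> ('a, 'g) gchain set set)) \<and>
          persistence_iso (Rips_H1_persistence G)
            (quotient_persistence (Lfin_H1 G) (\<lambda>r. L_H1 G (3 * r)))
            (lambda_H1 G :: real \<Rightarrow> ('a \<Rightarrow> real, 'g) gchain set \<Rightarrow> ('a, 'g) gchain set set)) \<and>
         (semi_locally_simply_connected TYPE('a) \<longrightarrow>
          isomorphic_persistences (Rips_pi1_persistence b)
            (quotient_persistence (pi1 b) (\<lambda>r. L_pi1 b (3 * r)))) \<and>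
         (G_semi_locally_simply_connected G TYPE('a) \<longrightarrow>
          isomorphic_persistences
            (Rips_H1_persistence G :: ('a \<Rightarrow> real, 'g) gchain set persistence)
            (quotient_persistence (H1 G) (\<lambda>r. L_H1 G (3 * r) :: ('a, 'g) gchain set set)))"
proof (intro conjI allI impI)
  note geo = assms
  show pi1: "persistence_iso (Rips_pi1_persistence b)
      (quotient_persistence (Lfin_pi1 b) (\<lambda>r. L_pi1 b (3 * r))) (lambda_pi1 b)"
    by (rule persistence_iso_pi1[OF geo])
  show H1: "persistence_iso (Rips_H1_persistence G)
      (quotient_persistence (Lfin_H1 G) (\<lambda>r. L_H1 G (3 * r)))
      (lambda_H1 G :: real \<Rightarrow> ('a \<Rightarrow> real, 'g) gchain set \<Rightarrow> ('a, 'g) gchain set set)"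
    by (rule persistence_iso_H1[OF geo])
  show "is_lambda_pi1 b r (lambda_pi1 b r)" if "0 < r" for r
    using is_lambda_lam_pi1[OF geo that] lambda_pi1_eq[OF geo that] by simp
  show "is_lambda_H1 G r (lambda_H1 G r :: ('a \<Rightarrow> real, 'g) gchain set \<Rightarrow> ('a, 'g) gchain set set)" if "0 < r" for r
    using is_lambda_lam_H1[OF geo that] lambda_H1_eq[OF geo that] by metis
  show "isomorphic_persistences (Rips_pi1_persistence b)
      (quotient_persistence (pi1 b) (\<lambda>r. L_pi1 b (3 * r)))"
    if "semi_locally_simply_connected TYPE('a)"
    \<comment> \<open>Once finite-length classes exhaust the whole group, the isomorphism already
      obtained is the required one.\<close>
    unfolding isomorphic_persistences_def using pi1 Lfin_pi1_semi_local[OF geo that, of b] by metis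
  show "isomorphic_persistences
      (Rips_H1_persistence G :: ('a \<Rightarrow> real, 'g) gchain set persistence)
      (quotient_persistence (H1 G) (\<lambda>r. L_H1 G (3 * r) :: ('a, 'g) gchain set set))"
    if "G_semi_locally_simply_connected G TYPE('a)"
    unfolding isomorphic_persistences_def using H1 Lfin_H1_semi_local[OF geo that] by metis
qed

end
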